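(* Let $\Gamma$ be a finite directed rooted binary tree with $n_\Gamma$ edges and root edge $r$, let $K_e,H_e,a_e>0$ for $e\in\Gamma$, and let $\lambda>0$. Consider the process $\boldsymbol X=[\boldsymbol Q;\boldsymbol R]$ with spatially uniform rainfall described in the context, and suppose that the rainfall depths satisfy $P_1\sim\mathrm{Pareto}(\alpha,k)$ for some $k>0$ and $0<\alpha<1$, i.e. $\mathbb P(P_1>x)=(k/x)^{\alpha}$ for $x\ge k$. Then, under the invariant distribution $g$ of $\boldsymbol X$, $$\mathbb P_g(Q_r>x)\sim\frac{\lambda\,(k\,a\,K_r)^{\alpha}}{H_r}\,c_\alpha\,x^{-\alpha}\qquad\text{as }x\to\infty$$ (the ratio of the two sides tends to $1$), where $a=\sum_{e\in\Gamma}a_e$ and $$c_\alpha=\int_0^1\frac{1}{u}\left[\sum_{e\in\Gamma}\frac{H_e}{K_r}\,\frac{a_e}{a}\,(\boldsymbol m_r(u))_e\right]^{\alpha}\mathrm du.$$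
   Context: $\Gamma$ is a finite rooted binary tree modelling a river network: its $n_\Gamma$ edges are called links, $r$ is the root (most downstream) link, and each link $e$ either has two tributaries (the two links immediately upstream of it) or none. Vectors indexed by $\Gamma$ list the root first. The incidence matrix $\boldsymbol\Lambda_\Gamma\in\mathbb R^{n_\Gamma\times n_\Gamma}$ has $(\boldsymbol\Lambda_\Gamma)_{e,e}=1$ for all $e$, $(\boldsymbol\Lambda_\Gamma)_{e,e'}=-1$ if $e'$ is a tributary of $e$, and all other entries zero. Put $\mathbf K=\mathrm{diag}(K_e:e\in\Gamma)$, $\mathbf H=\mathrm{diag}(H_e:e\in\Gamma)$, $\boldsymbol a=[a_e:e\in\Gamma]^{\intercal}$, and $$\mathbf M=\begin{bmatrix}-\mathbf K\boldsymbol\Lambda_\Gamma&\mathbf K\\ \mathbf O&-\mathbf H\end{bmatrix}\in\mathbb R^{2n_\Gamma\times 2n_\Gamma}.$$ Let $N$ be a Poisson process with rate $\lambda$ and jump times $T_1<T_2<\cdots$, and let $P_n$, $n\ge1$, be i.i.d. positive random variables, independent of $N$ (spatially uniform rainfall: every link receives the same depth $P_n$ at time $T_n$). The process $\boldsymbol X$ solves $\mathrm d\boldsymbol X=\mathbf M\boldsymbol X\,\mathrm dt+\mathrm d\boldsymbol Y$ with $\boldsymbol Y(t)=\sum_{n=1}^{N(t)}\begin{bmatrix}\boldsymbol 0\\ \mathbf H\boldsymbol a\,P_n\end{bmatrix}$, i.e. $$\boldsymbol X(t)=\begin{bmatrix}\boldsymbol Q(t)\\ \boldsymbol R(t)\end{bmatrix}=e^{\mathbf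 Mt}\boldsymbol X(0)+\sum_{n=1}^{N(t)}e^{\mathbf M(t-T_n)}\begin{bmatrix}\boldsymbol 0\\ \mathbf H\boldsymbol a\,P_n\end{bmatrix},$$ with $\boldsymbol Q=[Q_e:e\in\Gamma]^{\intercal}$, $\boldsymbol R=[R_e:e\in\Gamma]^{\intercal}$ and state space $(0,\infty)^{2n_\Gamma}$. A probability distribution is invariant for $\boldsymbol X$ if $\boldsymbol X(t)$ has that distribution for all $t>0$ whenever $\boldsymbol X(0)$ does (with $\boldsymbol X(0)$ independent of $\boldsymbol Y$). A unique invariant distribution $g$ exists whenever $\mathbb E[\max(\log P_1,0)]<\infty$, which is the case here; $\mathbb P_g$ denotes probability under it. For $u\in(0,1]$, $u^{-\mathbf M^{\intercal}/H_r}:=\exp\big(-\tfrac{\log u}{H_r}\mathbf M^{\intercal}\big)$, and $\boldsymbol m_r(u)\in\mathbb R^{n_\Gamma}$ consists of the last $n_\Gamma$ entries of its first column (the column corresponding to $Q_r$). *)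

theory Defs
  imports "HOL-Probability.Probability" "HOL-Library.Landau_Symbols"
begin

section \<open>River networks\<close>

text \<open>
  A finite rooted binary tree is given by its edges (links), which form the finite type \<open>'e\<close>:
  \<open>trib e\<close> is the set of tributaries of \<open>e\<close>, that is, of the links immediately upstream of \<open>e\<close>.
  Every link except the root flows into exactly one link, and every link lies upstream of the root.
\<close>

locale river_network =
  fixes root :: "'e::finite" and trib :: "'e \<Rightarrow> 'e set"
  assumes binary: "trib e = {} \<or> card (trib e) = 2"
    and root_no_downstream: "root \<notin> trib e"
    and unique_downstream: "e \<noteq> root \<Longrightarrow> \<exists>!d. e \<in> trib d"
    and upstream_of_root: "(root, e) \<in> {(d, u). u \<in> trib d}\<^sup>*"

definition incidence_matrix :: "('e::finite \<Rightarrow> 'e set) \<Rightarrow> real ^ 'e ^ 'e" where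
  "incidence_matrix trib = (\<chi> e e'. if e' = e then 1 else if e' \<in> trib e then -1 else 0)"


section \<open>Matrices\<close>

definition diag_matrix :: "real ^ 'e \<Rightarrow> real ^ 'e ^ 'e::finite" where
  "diag_matrix d = (\<chi> i j. if i = j then d $ i else 0)"

definition block_matrix ::
  "real ^ 'e ^ 'e \<Rightarrow> real ^ 'e ^ 'e \<Rightarrow> real ^ 'e ^ 'e \<Rightarrow> real ^ 'e ^ 'e \<Rightarrow>
   real ^ ('e + 'e) ^ ('e::finite + 'e)" where
  "block_matrix A B C D = (\<chi> i j.
     case i of
       Inl e \<Rightarrow> (case j of Inl e' \<Rightarrow> A $ e $ e' | Inr e' \<Rightarrow> B $ e $ e')
     | Inr e \<Rightarrow> (case j of Inl e' \<Rightarrow> C $ e $ e' | Inr e' \<Rightarrow> D $ e $ e'))"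

definition block_vector :: "real ^ 'e \<Rightarrow> real ^ 'e \<Rightarrow> real ^ ('e::finite + 'e)" where
  "block_vector v w = (\<chi> i. case i of Inl e \<Rightarrow> v $ e | Inr e \<Rightarrow> w $ e)"

text \<open>
  The library's \<open>exp\<close> and \<open>^\<close> do not apply: multiplication on the type of vectors of vectors
  is entrywise.
\<close>

primrec matrix_power :: "real ^ 'n ^ 'n \<Rightarrow> nat \<Rightarrow> real ^ 'n ^ 'n::finite" where
  "matrix_power A 0 = mat 1"
| "matrix_power A (Suc j) = A ** matrix_power A j"

definition matrix_exp :: "real ^ 'n ^ 'n \<Rightarrow> real ^ 'n ^ 'n::finite" where
  "matrix_exp A = (\<Sum>j. (1 / fact j) *\<^sub>R matrix_power A j)"

definition scalar_matrix_powr :: "real \<Rightarrow> real ^ 'n ^ 'n \<Rightarrow> real ^ 'n ^ 'n::finite" where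
  "scalar_matrix_powr u A = matrix_exp (ln u *\<^sub>R A)"


section \<open>The process\<close>

text \<open>
  The state \<open>[Q; R]\<close> is indexed by \<open>'e + 'e\<close>, with \<open>Inl e\<close> standing for \<open>Q\<^sub>e\<close> and \<open>Inr e\<close> for
  \<open>R\<^sub>e\<close>.
\<close>

definition system_matrix ::
  "('e::finite \<Rightarrow> 'e set) \<Rightarrow> real ^ 'e \<Rightarrow> real ^ 'e \<Rightarrow> real ^ ('e + 'e) ^ ('e + 'e)" where
  "system_matrix trib K H =
     block_matrix (- (diag_matrix K ** incidence_matrix trib)) (diag_matrix K)
                  0                                           (- diag_matrix H)"

text \<open>
  A Poisson process \<open>N\<close> with its jump times \<open>T\<close>, which are numbered from 1 (\<open>T 0\<close> is irrelevant).
\<close>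

definition (in prob_space) poisson_process ::
  "real \<Rightarrow> (real \<Rightarrow> 'a \<Rightarrow> nat) \<Rightarrow> (nat \<Rightarrow> 'a \<Rightarrow> real) \<Rightarrow> bool" where
  "poisson_process rate N T \<longleftrightarrow>
     (\<forall>t\<ge>0. random_variable (count_space UNIV) (N t)) \<and>
     (\<forall>n\<ge>1. random_variable borel (T n)) \<and>
     (AE \<omega> in M. 0 < T 1 \<omega> \<and> (\<forall>n\<ge>1. T n \<omega> < T (Suc n) \<omega>)) \<and>
     (AE \<omega> in M. \<forall>t\<ge>0. finite {n. 1 \<le> n \<and> T n \<omega> \<le> t} \<and>
                           N t \<omega> = card {n. 1 \<le> n \<and> T n \<omega> \<le> t}) \<and>
     (\<forall>s t. 0 \<le> s \<and> s < t \<longrightarrow>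
        distr M (count_space UNIV) (\<lambda>\<omega>. N t \<omega> - N s \<omega>) = measure_pmf (poisson_pmf (rate * (t - s)))) \<and>
     (\<forall>m t. 0 \<le> t 0 \<and> (\<forall>i<m. t i < t (Suc i)) \<longrightarrow>
        indep_vars (\<lambda>_. count_space UNIV) (\<lambda>i \<omega>. N (t (Suc i)) \<omega> - N (t i) \<omega>) {..<(m::nat)})"

definition (in prob_space) iid_from_1 :: "(nat \<Rightarrow> 'a \<Rightarrow> real) \<Rightarrow> bool" where
  "iid_from_1 P \<longleftrightarrow>
     indep_vars (\<lambda>_. borel) P {1..} \<and> (\<forall>n\<ge>1. distr M borel (P n) = distr M borel (P 1))"

definition (in prob_space) indep_of_process ::
  "(nat \<Rightarrow> 'a \<Rightarrow> real) \<Rightarrow> (real \<Rightarrow> 'a \<Rightarrow> nat) \<Rightarrow> bool" where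
  "indep_of_process P N \<longleftrightarrow>
     indep_var (\<Pi>\<^sub>M n\<in>{1..}. borel) (\<lambda>\<omega>. \<lambda>n\<in>{1..}. P n \<omega>)
               (\<Pi>\<^sub>M t\<in>{0..}. count_space UNIV) (\<lambda>\<omega>. \<lambda>t\<in>{0..}. N t \<omega>)"

text \<open>The state at time \<open>t\<close> when the initial state is \<open>x\<close>.\<close>

definition state_process ::
  "('e::finite \<Rightarrow> 'e set) \<Rightarrow> real ^ 'e \<Rightarrow> real ^ 'e \<Rightarrow> real ^ 'e \<Rightarrow>
   (real \<Rightarrow> 'w \<Rightarrow> nat) \<Rightarrow> (nat \<Rightarrow> 'w \<Rightarrow> real) \<Rightarrow> (nat \<Rightarrow> 'w \<Rightarrow> real) \<Rightarrow>
   real \<Rightarrow> real ^ ('e + 'e) \<Rightarrow> 'w \<Rightarrow> real ^ ('e + 'e)" where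
  "state_process trib K H a N T P t x \<omega> =
     matrix_exp (t *\<^sub>R system_matrix trib K H) *v x +
     (\<Sum>n = 1..N t \<omega>. matrix_exp ((t - T n \<omega>) *\<^sub>R system_matrix trib K H) *v
        block_vector 0 (P n \<omega> *\<^sub>R (diag_matrix H *v a)))"

text \<open>
  \<open>Z t x \<omega>\<close> is the state at time \<open>t\<close> from the initial state \<open>x\<close>, driven by the noise \<open>\<omega>\<close> with
  law \<open>M\<close>. A random initial state with distribution \<open>g\<close> that is independent of the noise is the first
  coordinate on the product of \<open>g\<close> and \<open>M\<close>. Distributions live on the state space, the open
  positive orthant.
\<close>

definition invariant_distribution ::
  "'w measure \<Rightarrow> (real \<Rightarrow> real ^ 'n \<Rightarrow> 'w \<Rightarrow> real ^ 'n) \<Rightarrow> (real ^ 'n::finite) measure \<Rightarrow> bool" where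
  "invariant_distribution M Z g \<longleftrightarrow>
     prob_space g \<and> sets g = sets borel \<and> (AE x in g. \<forall>i. 0 < x $ i) \<and>
     (\<forall>t>0. distr (g \<Otimes>\<^sub>M M) borel (\<lambda>(x, \<omega>). Z t x \<omega>) = g)"


section \<open>The constant\<close>

definition root_response ::
  "'e \<Rightarrow> ('e::finite \<Rightarrow> 'e set) \<Rightarrow> real ^ 'e \<Rightarrow> real ^ 'e \<Rightarrow> real \<Rightarrow> real ^ 'e" where
  "root_response r trib K H u =
     (\<chi> e. column (Inl r)
        (scalar_matrix_powr u (- ((1 / H $ r) *\<^sub>R transpose (system_matrix trib K H)))) $ Inr e)"

definition tail_constant ::
  "'e \<Rightarrow> ('e::finite \<Rightarrow> 'e set) \<Rightarrow> real ^ 'e \<Rightarrow> real ^ 'e \<Rightarrow> real ^ 'e \<Rightarrow> real \<Rightarrow> real" where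
  "tail_constant r trib K H a \<alpha> =
     (LBINT u:{0<..1}. 1 / u *
        (\<Sum>e\<in>UNIV. H $ e / K $ r * (a $ e / (\<Sum>e'\<in>UNIV. a $ e')) * root_response r trib K H u $ e)
          powr \<alpha>)"

end

theory Submission
  imports Defs "HOL-Real_Asymp.Real_Asymp"
begin

text \<open>
  Write \<open>A\<close> for the system matrix, \<open>b(s)\<close> for the discharge that one unit of rain causes at the root
  after time \<open>s\<close>, and \<open>Q(s)\<close> for the discharge \<open>(exp (s A) X)\<^sub>r\<close>. For a bounded Lipschitz function \<open>\<psi>\<close>
  put \<open>F(s) = E\<^sub>g \<psi>(Q(s))\<close>. Invariance over a short time \<open>h\<close> gives
  \<open>F(s) - F(s + h) = lam h E[\<psi>(Q(s) + b(s) P\<^sub>1) - \<psi>(Q(s))] + o(h)\<close>. Since \<open>F(s)\<close> tends to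
  \<open>\<psi>(0)\<close>, integration expresses \<open>F(0) - \<psi>(0)\<close> by the tails of the single marks \<open>b(s) P\<^sub>1\<close>. Taking a ramp
  function at level \<open>x\<close> for \<open>\<psi>\<close>, dominated convergence yields the factor
  \<open>lam k\<^sup>\<alpha> \<integral> b(s)\<^sup>\<alpha> ds\<close>, and \<open>u = exp (- H\<^sub>r s)\<close> turns the integral into the tail constant.

  The relation \<open>indep_of_process\<close> compares two random variables of the same type, so that its index
  \<open>t\<close> is a natural number, coerced to a real one: the marks are only assumed to be independent of
  the counts at integer times. The law of \<open>P\<^sub>1\<close> given a jump in \<open>[0, h]\<close> is therefore not known
  beforehand. It is recovered from invariance: the Laplace transform of \<open>g\<close> is positive, so the
  Laplace functionals of the noise form a cocycle, which makes the first jump with its mark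
  homogeneous in time; summing over the \<open>m\<close> subintervals of \<open>[0, 1]\<close> leads back to time 1, where
  independence holds.
\<close>

section \<open>The matrix exponential\<close>

text \<open>Given full independence, the stationary discharge would have the law of the sum of all
  \<open>b(T n) * P n\<close>; this cannot be used, since the joint law of jump times and marks is
  not at hand. Invariance over a short time involves one jump, and its errors need only Poisson
  counts. The test function is applied to \<open>Q(s)\<close> and not just to \<open>Q(0)\<close>
  because rain reaches the root with a delay, \<open>b(0) = 0\<close>: varying s makes the age of a
  mark the variable of integration.

  Marks with \<open>\<alpha> < 1\<close> have no mean, so Lipschitz errors are truncated at 1 before
  expectations are taken. The mean of \<open>min 1 (y P)\<close> is of order \<open>y\<close> to the
  power \<alpha>; with the exponential decay of b this gives a majorant uniform in x and integrable
  in s.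

  For the first mark, the cocycle is applied to kernels \<open>c * b + y * \<rho>\<close>, where
  \<rho> is the normalised storage response at the root. As b vanishes at age 0 and is positive
  later, a large c silences older jumps, while a fresh jump still counts with y. This yields the
  Laplace transform of the mark, and Stone-Weierstrass in \<open>exp (- p)\<close> all continuous
  tests with a limit at infinity.\<close>

lemma matrix_power_entry_bound:
  fixes A :: "real ^ 'n ^ 'n::finite"
  shows "\<bar>matrix_power A n $ i $ j\<bar> \<le> (\<Sum>i\<in>UNIV. \<Sum>j\<in>UNIV. \<bar>A $ i $ j\<bar>) ^ n"
proof (induction n arbitrary: i j)
  case 0
  show ?case by (simp add: mat_def)
next
  case (Suc n)
  define c where "c = (\<Sum>i\<in>UNIV. \<Sum>j\<in>UNIV. \<bar>A $ i $ j\<bar>)"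
  \<comment> \<open>Every row sum of absolute values is at most \<open>c\<close>, so each further
    factor \<open>A\<close> costs at most one factor \<open>c\<close>.\<close>
  have row: "(\<Sum>j\<in>UNIV. \<bar>A $ i $ j\<bar>) \<le> c"
    unfolding c_def by (rule member_le_sum) (auto intro: sum_nonneg)
  have c0: "0 \<le> c"
    unfolding c_def by (intro sum_nonneg) auto
  have "\<bar>matrix_power A (Suc n) $ i $ j\<bar> \<le> (\<Sum>l\<in>UNIV. \<bar>A $ i $ l * matrix_power A n $ l $ j\<bar>)"
    by (simp add: matrix_matrix_mult_def)
  also have "\<dots> \<le> (\<Sum>l\<in>UNIV. \<bar>A $ i $ l\<bar> * c ^ n)"
    using Suc unfolding c_def by (intro sum_mono) (auto simp: abs_mult intro: mult_left_mono)
  also have "\<dots> \<le> c * c ^ n"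
    using row c0 by (auto simp: sum_distrib_right[symmetric] intro: mult_right_mono)
  finally show ?case by (simp add: c_def)
qed

lemma matrix_power_scaleR: "matrix_power (c *\<^sub>R A) n = c ^ n *\<^sub>R matrix_power A n"
  by (induction n)
    (simp_all add: matrix_matrix_mult_def vec_eq_iff sum_distrib_left mult_ac)

lemma matrix_power_Suc_right: "matrix_power A (Suc n) = matrix_power A n ** A"
  by (induction n) (simp, metis matrix_mul_assoc matrix_power.simps(2))

lemma matrix_power_transpose: "matrix_power (transpose A) n = transpose (matrix_power A n)"
  by (induction n)
    (simp_all add: matrix_transpose_mul[symmetric] matrix_power_Suc_right[symmetric])

lemma matrix_matrix_mult_entry: "(A ** B) $ i $ j = (\<Sum>l\<in>UNIV. A $ i $ l * B $ l $ j)"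
  by (simp add: matrix_matrix_mult_def)

lemma sums_matrixI:
  fixes f :: "nat \<Rightarrow> real ^ 'n ^ 'm"
  assumes "\<And>i j. (\<lambda>n. f n $ i $ j) sums (s $ i $ j)"
  shows "f sums s"
  using assms unfolding sums_def by (intro vec_tendstoI) simp

lemma summable_matrix_power_entry:
  "summable (\<lambda>n. matrix_power A n $ i $ j * t ^ n / fact n)"
proof (rule summable_comparison_test)
  define c where "c = (\<Sum>i\<in>UNIV. \<Sum>j\<in>UNIV. \<bar>A $ i $ j\<bar>)"
  show "summable (\<lambda>n. inverse (fact n) * (c * \<bar>t\<bar>) ^ n)"
    by (rule summable_exp)
  show "\<exists>N. \<forall>n\<ge>N. norm (matrix_power A n $ i $ j * t ^ n / fact n)
      \<le> inverse (fact n) * (c * \<bar>t\<bar>) ^ n"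
    using matrix_power_entry_bound[of A _ i j]
    by (auto simp: abs_mult power_abs divide_simps c_def
        intro!: exI[of _ 0] mult_right_mono)
qed

text \<open>Reduces the exponential to one scalar power series in \<open>t\<close> per entry, for
  which termwise differentiation is available.\<close>

lemma matrix_exp_entry:
  "matrix_exp (t *\<^sub>R A) $ i $ j = (\<Sum>n. matrix_power A n $ i $ j * t ^ n / fact n)"
proof -
  define S :: "real ^ 'a ^ 'a" where
    "S = (\<chi> i j. \<Sum>n. matrix_power A n $ i $ j * t ^ n / fact n)"
  have "(\<lambda>n. (1 / fact n) *\<^sub>R matrix_power (t *\<^sub>R A) n) sums S"
    using summable_sums[OF summable_matrix_power_entry[of A _ _ t]]
    by (intro sums_matrixI) (simp add: S_def matrix_power_scaleR mult.commute)
  then show ?thesis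
    by (simp add: matrix_exp_def sums_iff S_def)
qed

lemma matrix_exp_transpose: "matrix_exp (transpose A) = transpose (matrix_exp A)"
  using matrix_exp_entry[of 1 "transpose A"] matrix_exp_entry[of 1 A]
  by (simp add: vec_eq_iff matrix_power_transpose) (simp add: transpose_def)

lemma matrix_exp_0 [simp]: "matrix_exp 0 = mat 1"
proof -
  have "matrix_exp (0 *\<^sub>R 0) $ i $ j = (mat 1 :: real ^ 'a ^ 'a) $ i $ j" for i j :: 'a
    using powser_zero[of "\<lambda>n. matrix_power (0 :: real ^ 'a ^ 'a) n $ i $ j / fact n"]
    unfolding matrix_exp_entry by simp
  then show ?thesis by (simp add: vec_eq_iff)
qed

lemma matrix_exp_commute: "A ** matrix_exp (t *\<^sub>R A) = matrix_exp (t *\<^sub>R A) ** A"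
proof -
  have "(\<Sum>l\<in>UNIV. A $ i $ l * matrix_exp (t *\<^sub>R A) $ l $ j)
      = (\<Sum>l\<in>UNIV. matrix_exp (t *\<^sub>R A) $ i $ l * A $ l $ j)" for i j
  proof -
    have "(\<Sum>l\<in>UNIV. A $ i $ l * matrix_exp (t *\<^sub>R A) $ l $ j)
        = (\<Sum>n. \<Sum>l\<in>UNIV. A $ i $ l * (matrix_power A n $ l $ j * t ^ n / fact n))"
      unfolding matrix_exp_entry
      by (subst suminf_sum) (auto intro!: summable_mult summable_matrix_power_entry
          simp: suminf_mult[OF summable_matrix_power_entry, symmetric] simp del: times_divide_eq_right)
    also have "\<dots> = (\<Sum>n. \<Sum>l\<in>UNIV. matrix_power A n $ i $ l * t ^ n / fact n * A $ l $ j)"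
    proof (rule suminf_cong)
      fix n
      have "(A ** matrix_power A n) $ i $ j = (matrix_power A n ** A) $ i $ j"
        using matrix_power_Suc_right[of A n] by simp
      then have "(\<Sum>l\<in>UNIV. A $ i $ l * matrix_power A n $ l $ j) * (t ^ n / fact n)
          = (\<Sum>l\<in>UNIV. matrix_power A n $ i $ l * A $ l $ j) * (t ^ n / fact n)"
        by (simp add: matrix_matrix_mult_def)
      then show "(\<Sum>l\<in>UNIV. A $ i $ l * (matrix_power A n $ l $ j * t ^ n / fact n))
          = (\<Sum>l\<in>UNIV. matrix_power A n $ i $ l * t ^ n / fact n * A $ l $ j)"
        unfolding sum_distrib_right by (simp add: mult_ac)
    qed
    also have "\<dots> = (\<Sum>l\<in>UNIV. matrix_exp (t *\<^sub>R A) $ i $ l * A $ l $ j)"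
      unfolding matrix_exp_entry
      by (subst suminf_sum) (auto intro!: summable_mult2 summable_matrix_power_entry
          simp: suminf_mult2[OF summable_matrix_power_entry] simp del: times_divide_eq_left)
    finally show ?thesis .
  qed
  then show ?thesis by (simp add: matrix_matrix_mult_def vec_eq_iff)
qed

text \<open>The differentiated series has the coefficients
  \<open>matrix_power A (Suc n) / fact n\<close>, which are those of the exponential multiplied by
  \<open>A\<close>.\<close>

lemma matrix_exp_has_derivative:
  "((\<lambda>t. matrix_exp (t *\<^sub>R A) $ i $ j) has_real_derivative (A ** matrix_exp (t *\<^sub>R A)) $ i $ j) (at t)"
proof -
  define c where "c n = matrix_power A n $ i $ j / fact n" for n
  have "((\<lambda>t. \<Sum>n. c n * t ^ n) has_real_derivative (\<Sum>n. diffs c n * t ^ n)) (at t)"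
    by (rule termdiffs_strong_converges_everywhere)
      (use summable_matrix_power_entry in \<open>simp add: c_def\<close>)
  moreover have "(\<Sum>n. diffs c n * t ^ n) = (A ** matrix_exp (t *\<^sub>R A)) $ i $ j"
  proof -
    have "(A ** matrix_exp (t *\<^sub>R A)) $ i $ j
        = (\<Sum>l\<in>UNIV. A $ i $ l * (\<Sum>n. matrix_power A n $ l $ j * t ^ n / fact n))"
      by (simp add: matrix_matrix_mult_def matrix_exp_entry)
    also have "\<dots> = (\<Sum>n. \<Sum>l\<in>UNIV. A $ i $ l * (matrix_power A n $ l $ j * t ^ n / fact n))"
      by (subst suminf_sum) (auto intro!: summable_mult summable_matrix_power_entry
          simp: suminf_mult[OF summable_matrix_power_entry, symmetric] simp del: times_divide_eq_right)
    also have "\<dots> = (\<Sum>n. diffs c n * t ^ n)"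
    proof (rule suminf_cong)
      fix n
      have "diffs c n * t ^ n = (A ** matrix_power A n) $ i $ j * (t ^ n / fact n)"
        by (simp add: diffs_def c_def field_simps del: of_nat_Suc)
      then show "(\<Sum>l\<in>UNIV. A $ i $ l * (matrix_power A n $ l $ j * t ^ n / fact n)) = diffs c n * t ^ n"
        unfolding matrix_matrix_mult_entry sum_distrib_right by (simp add: mult_ac)
    qed
    finally show ?thesis ..
  qed
  ultimately show ?thesis by (simp add: matrix_exp_entry c_def)
qed

lemma matrix_exp_continuous: "continuous_on S (\<lambda>t. matrix_exp (t *\<^sub>R A) $ i $ j)"
  by (rule continuous_at_imp_continuous_on) (blast intro: DERIV_isCont matrix_exp_has_derivative)

text \<open>The two terms of the product rule cancel, since \<open>A\<close> commutes with its
  exponential. Inverse, uniqueness, group law and shift all follow by a choice of \<open>F\<close>,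
  so that no product of series is ever formed.\<close>

lemma matrix_exp_cancel_of_ode:
  assumes ode: "\<And>t i j. ((\<lambda>t. F t $ i $ j) has_real_derivative (A ** F t) $ i $ j) (at t)"
  shows "matrix_exp ((- t) *\<^sub>R A) ** F t = F 0"
proof -
  have "(matrix_exp ((- t) *\<^sub>R A) ** F t) $ i $ j = F 0 $ i $ j" for i j
  proof -
    have ex: "((\<lambda>t. matrix_exp ((- t) *\<^sub>R A) $ i $ l) has_real_derivative
        - (matrix_exp ((- t) *\<^sub>R A) ** A) $ i $ l) (at t)" for t l
      using DERIV_chain2[where f = "\<lambda>t. matrix_exp (t *\<^sub>R A) $ i $ l" and g = uminus,
          OF matrix_exp_has_derivative, of "-1" t UNIV]
        matrix_exp_commute[of A "- t"]
      by (simp add: DERIV_minus)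
    have "((\<lambda>t. (matrix_exp ((- t) *\<^sub>R A) ** F t) $ i $ j) has_real_derivative
        (\<Sum>l\<in>UNIV. - (matrix_exp ((- t) *\<^sub>R A) ** A) $ i $ l * F t $ l $ j
          + (A ** F t) $ l $ j * matrix_exp ((- t) *\<^sub>R A) $ i $ l)) (at t)" for t
      unfolding matrix_matrix_mult_entry
      by (intro DERIV_sum DERIV_mult ode[unfolded matrix_matrix_mult_entry]
          ex[unfolded matrix_matrix_mult_entry])
    moreover have "(\<Sum>l\<in>UNIV. - (matrix_exp ((- t) *\<^sub>R A) ** A) $ i $ l * F t $ l $ j
          + (A ** F t) $ l $ j * matrix_exp ((- t) *\<^sub>R A) $ i $ l) = 0" for t
    proof -
      have "((matrix_exp ((- t) *\<^sub>R A) ** A) ** F t) $ i $ j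
          = (matrix_exp ((- t) *\<^sub>R A) ** (A ** F t)) $ i $ j"
        by (simp add: matrix_mul_assoc)
      then have "(\<Sum>l\<in>UNIV. (matrix_exp ((- t) *\<^sub>R A) ** A) $ i $ l * F t $ l $ j)
          = (\<Sum>l\<in>UNIV. matrix_exp ((- t) *\<^sub>R A) $ i $ l * (A ** F t) $ l $ j)"
        by (simp only: matrix_matrix_mult_entry)
      then show ?thesis by (simp add: sum.distrib sum_negf sum_subtractf mult.commute)
    qed
    ultimately have "((\<lambda>t. (matrix_exp ((- t) *\<^sub>R A) ** F t) $ i $ j) has_real_derivative 0) (at t)"
      for t by simp
    then have "\<forall>t. ((\<lambda>t. (matrix_exp ((- t) *\<^sub>R A) ** F t) $ i $ j) has_real_derivative 0) (at t)"
      by blast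
    then have "(matrix_exp ((- t) *\<^sub>R A) ** F t) $ i $ j = (matrix_exp ((- 0) *\<^sub>R A) ** F 0) $ i $ j"
      by (rule DERIV_isconst_all)
    then show ?thesis by simp
  qed
  then show ?thesis by (simp add: vec_eq_iff)
qed

lemma matrix_exp_minus_cancel: "matrix_exp ((- t) *\<^sub>R A) ** matrix_exp (t *\<^sub>R A) = mat 1"
  using matrix_exp_cancel_of_ode[of "\<lambda>t. matrix_exp (t *\<^sub>R A)" A t, OF matrix_exp_has_derivative]
  by simp

lemma matrix_exp_unique:
  assumes "\<And>t i j. ((\<lambda>t. F t $ i $ j) has_real_derivative (A ** F t) $ i $ j) (at t)"
  shows "F t = matrix_exp (t *\<^sub>R A) ** F 0"
proof -
  have "matrix_exp (t *\<^sub>R A) ** F 0 = matrix_exp (t *\<^sub>R A) ** matrix_exp ((- t) *\<^sub>R A) ** F t"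
    using matrix_exp_cancel_of_ode[of F A t, OF assms] by (metis matrix_mul_assoc)
  then show ?thesis using matrix_exp_minus_cancel[of "- t" A] by simp
qed

text \<open>As a function of \<open>s\<close>, the left side solves the same linear equation, with
  initial value \<open>matrix_exp (t A)\<close>.\<close>

lemma matrix_exp_add:
  "matrix_exp ((s + t) *\<^sub>R A) = matrix_exp (s *\<^sub>R A) ** matrix_exp (t *\<^sub>R A)"
proof -
  have "((\<lambda>u. matrix_exp ((u + t) *\<^sub>R A) $ i $ j) has_real_derivative
      (A ** matrix_exp ((u + t) *\<^sub>R A)) $ i $ j) (at u)" for u i j
    using DERIV_shift[of "\<lambda>u. matrix_exp (u *\<^sub>R A) $ i $ j" _ u t]
      matrix_exp_has_derivative[of A i j "u + t"] by simp
  from matrix_exp_unique[of "\<lambda>u. matrix_exp ((u + t) *\<^sub>R A)" A s, OF this] show ?thesis by simp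
qed

text \<open>Serves to replace a matrix with nonnegative off-diagonal entries by an entrywise
  nonnegative one: a multiple of the identity contributes only a positive scalar factor.\<close>

lemma matrix_exp_shift:
  "matrix_exp (t *\<^sub>R A) = exp (- (\<kappa> * t)) *\<^sub>R matrix_exp (t *\<^sub>R (A + \<kappa> *\<^sub>R mat 1))"
proof -
  define B where "B = A + \<kappa> *\<^sub>R mat 1"
  define F where "F t = exp (- (\<kappa> * t)) *\<^sub>R matrix_exp (t *\<^sub>R B)" for t
  have "((\<lambda>t. F t $ i $ j) has_real_derivative (A ** F t) $ i $ j) (at t)" for t i j
  proof -
    have "((\<lambda>t. F t $ i $ j) has_real_derivative
       exp (- (\<kappa> * t)) * - \<kappa> * matrix_exp (t *\<^sub>R B) $ i $ j
        + (B ** matrix_exp (t *\<^sub>R B)) $ i $ j * exp (- (\<kappa> * t))) (at t)"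
      unfolding F_def vector_scaleR_component real_scaleR_def
      by (rule DERIV_mult[OF _ matrix_exp_has_derivative]) (auto intro!: derivative_eq_intros)
    moreover have "B ** X = A ** X + \<kappa> *\<^sub>R X" for X :: "real ^ 'a ^ 'a"
      by (simp add: B_def matrix_matrix_mult_def mat_def vec_eq_iff distrib_right sum.distrib
          if_distrib[of "\<lambda>x. x * _"] if_distrib[of "\<lambda>x. \<kappa> * x"] cong: if_cong)
    moreover have "A ** F t = exp (- (\<kappa> * t)) *\<^sub>R (A ** matrix_exp (t *\<^sub>R B))"
      by (simp add: F_def matrix_matrix_mult_def vec_eq_iff sum_distrib_left mult_ac)
    ultimately show ?thesis by (simp add: algebra_simps)
  qed
  from matrix_exp_unique[of F A t, OF this] show ?thesis by (simp add: F_def B_def)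
qed

section \<open>Positivity and decay of the linear flow\<close>

lemma matrix_power_nonneg:
  assumes "\<And>i j. 0 \<le> A $ i $ j"
  shows "0 \<le> matrix_power A n $ i $ j"
  by (induction n arbitrary: i j)
    (auto simp: mat_def matrix_matrix_mult_entry intro!: sum_nonneg mult_nonneg_nonneg assms)

text \<open>All terms of the series are nonnegative, and only the linear one is kept.\<close>

lemma matrix_exp_ge_entry:
  assumes "\<And>i j. 0 \<le> A $ i $ j" and t: "0 \<le> t"
  shows "t * A $ i $ j \<le> matrix_exp (t *\<^sub>R A) $ i $ j"
proof -
  have "(\<Sum>n\<in>{1}. matrix_power A n $ i $ j * t ^ n / fact n) \<le> matrix_exp (t *\<^sub>R A) $ i $ j"
    unfolding matrix_exp_entry
    using matrix_power_nonneg[of A, OF assms(1)] t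
    by (intro sum_le_suminf summable_matrix_power_entry) auto
  then show ?thesis by (simp add: mult.commute)
qed

lemma Metzler_shift:
  fixes A :: "real ^ 'n ^ 'n::finite"
  assumes "\<And>i j. i \<noteq> j \<Longrightarrow> 0 \<le> A $ i $ j"
  obtains \<kappa> where "\<And>i j. 0 \<le> (A + \<kappa> *\<^sub>R mat 1) $ i $ j"
proof
  fix i j
  have "\<bar>A $ i $ i\<bar> \<le> (\<Sum>i\<in>UNIV. \<bar>A $ i $ i\<bar>)"
    by (rule member_le_sum) auto
  then show "0 \<le> (A + (\<Sum>i\<in>UNIV. \<bar>A $ i $ i\<bar>) *\<^sub>R mat 1) $ i $ j"
    using assms by (cases "i = j") (auto simp: mat_def)
qed

lemma matrix_exp_Metzler_nonneg:
  assumes A: "\<And>i j. i \<noteq> j \<Longrightarrow> 0 \<le> A $ i $ j" and t: "0 \<le> t"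
  shows "0 \<le> matrix_exp (t *\<^sub>R A) $ i $ j"
proof -
  obtain \<kappa> where \<kappa>: "\<And>i j. 0 \<le> (A + \<kappa> *\<^sub>R mat 1) $ i $ j"
    using Metzler_shift[OF A] by blast
  have "0 \<le> t * (A + \<kappa> *\<^sub>R mat 1) $ i $ j"
    using \<kappa>[of i j] t by (rule mult_nonneg_nonneg[rotated])
  then show ?thesis
    using matrix_exp_ge_entry[OF \<kappa> t, of i j] by (subst matrix_exp_shift[of _ _ \<kappa>]) simp
qed

text \<open>After the shift the linear term of the series is already positive, because the shift
  leaves off-diagonal entries alone.\<close>

lemma matrix_exp_Metzler_pos:
  assumes A: "\<And>i j. i \<noteq> j \<Longrightarrow> 0 \<le> A $ i $ j" and t: "0 < t"
    and ij: "i \<noteq> j" "0 < A $ i $ j"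
  shows "0 < matrix_exp (t *\<^sub>R A) $ i $ j"
proof -
  obtain \<kappa> where \<kappa>: "\<And>i j. 0 \<le> (A + \<kappa> *\<^sub>R mat 1) $ i $ j"
    using Metzler_shift[OF A] by blast
  have "0 < t * (A + \<kappa> *\<^sub>R mat 1) $ i $ j"
    using ij t by (simp add: mat_def)
  then show ?thesis
    using matrix_exp_ge_entry[OF \<kappa>, of t i j] t by (subst matrix_exp_shift[of _ _ \<kappa>]) simp
qed

text \<open>\<open>w\<close> acts as a linear Lyapunov vector: as the exponential is nonnegative,
  \<open>exp (\<mu> t)\<close> times a component of \<open>exp (t A) w\<close> is nonincreasing in
  \<open>t\<close>. A single entry is bounded by its whole row, whose terms are nonnegative.\<close>

lemma matrix_exp_Metzler_decay:
  fixes A :: "real ^ 'n ^ 'n::finite"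
  assumes A: "\<And>i j. i \<noteq> j \<Longrightarrow> 0 \<le> A $ i $ j"
    and w: "\<And>i. 0 < w $ i" "\<And>i. (A *v w) $ i \<le> - \<mu> * w $ i" and t: "0 \<le> t"
  shows "matrix_exp (t *\<^sub>R A) $ i $ j \<le> w $ i / w $ j * exp (- (\<mu> * t))"
proof -
  define G where "G t = exp (\<mu> * t) * (\<Sum>l\<in>UNIV. matrix_exp (t *\<^sub>R A) $ i $ l * w $ l)" for t
  have "\<exists>y. (G has_real_derivative y) (at u) \<and> y \<le> 0" if "0 \<le> u" for u
  proof (intro exI conjI)
    show "(G has_real_derivative (exp (\<mu> * u) * \<mu> * (\<Sum>l\<in>UNIV. matrix_exp (u *\<^sub>R A) $ i $ l * w $ l)
        + (\<Sum>l\<in>UNIV. (A ** matrix_exp (u *\<^sub>R A)) $ i $ l * w $ l) * exp (\<mu> * u))) (at u)"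
      unfolding G_def
      by (intro DERIV_mult DERIV_sum DERIV_cmult_right matrix_exp_has_derivative)
        (auto intro!: derivative_eq_intros)
    \<comment> \<open>Commuting \<open>A\<close> past the exponential brings it next to
      \<open>w\<close>, where the hypothesis applies.\<close>
    have "(\<Sum>l\<in>UNIV. (A ** matrix_exp (u *\<^sub>R A)) $ i $ l * w $ l)
        = (matrix_exp (u *\<^sub>R A) *v (A *v w)) $ i"
      by (simp add: matrix_exp_commute matrix_vector_mul_assoc) (simp add: matrix_vector_mult_def)
    also have "\<dots> \<le> (\<Sum>l\<in>UNIV. matrix_exp (u *\<^sub>R A) $ i $ l * (- \<mu> * w $ l))"
      unfolding matrix_vector_mult_def[of "matrix_exp (u *\<^sub>R A)"] vec_lambda_beta
    proof (rule sum_mono)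
      fix l
      show "matrix_exp (u *\<^sub>R A) $ i $ l * (A *v w) $ l \<le> matrix_exp (u *\<^sub>R A) $ i $ l * (- \<mu> * w $ l)"
        using w(2) matrix_exp_Metzler_nonneg[OF A that] by (rule mult_left_mono)
    qed
    also have "\<dots> = - \<mu> * (\<Sum>l\<in>UNIV. matrix_exp (u *\<^sub>R A) $ i $ l * w $ l)"
      by (simp add: sum_distrib_left mult_ac sum_negf)
    finally have "(\<Sum>l\<in>UNIV. (A ** matrix_exp (u *\<^sub>R A)) $ i $ l * w $ l) * exp (\<mu> * u)
        \<le> (- \<mu> * (\<Sum>l\<in>UNIV. matrix_exp (u *\<^sub>R A) $ i $ l * w $ l)) * exp (\<mu> * u)"
      by (rule mult_right_mono) simp
    then show "exp (\<mu> * u) * \<mu> * (\<Sum>l\<in>UNIV. matrix_exp (u *\<^sub>R A) $ i $ l * w $ l)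
        + (\<Sum>l\<in>UNIV. (A ** matrix_exp (u *\<^sub>R A)) $ i $ l * w $ l) * exp (\<mu> * u) \<le> 0"
      by (simp add: mult_ac)
  qed
  then have "G t \<le> G 0" by (intro DERIV_nonpos_imp_nonincreasing[OF t])
  moreover have "G 0 = w $ i"
    by (simp add: G_def mat_def if_distrib[of "\<lambda>x. x * _"] cong: if_cong)
  ultimately have "(\<Sum>l\<in>UNIV. matrix_exp (t *\<^sub>R A) $ i $ l * w $ l) \<le> w $ i * exp (- (\<mu> * t))"
    by (simp add: G_def exp_minus field_simps)
  moreover have "matrix_exp (t *\<^sub>R A) $ i $ j * w $ j \<le> (\<Sum>l\<in>UNIV. matrix_exp (t *\<^sub>R A) $ i $ l * w $ l)"
    using matrix_exp_Metzler_nonneg[OF A t] w(1)[THEN less_imp_le]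
    by (intro member_le_sum mult_nonneg_nonneg) simp_all
  ultimately show ?thesis using w(1)[of j] by (simp add: field_simps)
qed

section \<open>The flow on a river network\<close>

lemma sum_UNIV_Plus:
  fixes f :: "'e::finite + 'e \<Rightarrow> real"
  shows "(\<Sum>i\<in>UNIV. f i) = (\<Sum>e\<in>UNIV. f (Inl e)) + (\<Sum>e\<in>UNIV. f (Inr e))"
  using sum.Plus[of UNIV UNIV f] by (simp add: UNIV_Plus_UNIV)

text \<open>Take the length of a shortest path from the root. Since a tributary has only one
  downstream link, every path to it passes through that link last. Besides weights for the Lyapunov
  vector, this excludes cycles.\<close>

lemma (in river_network) depth_exists:
  "\<exists>d :: 'e \<Rightarrow> nat. \<forall>e. \<forall>e'\<in>trib e. d e' = Suc (d e)"
proof -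
  define R where "R = {(d, u). u \<in> trib d}"
  define d where "d e = (LEAST n. (root, e) \<in> R ^^ n)" for e
  have ex: "\<exists>n. (root, e) \<in> R ^^ n" for e
    using upstream_of_root[of e] by (simp add: R_def rtrancl_power)
  have d: "(root, e) \<in> R ^^ d e" for e
    unfolding d_def using ex by (rule LeastI_ex)
  have "d e' = Suc (d e)" if e': "e' \<in> trib e" for e e'
  proof (rule antisym)
    have "(root, e') \<in> R ^^ Suc (d e)" using d[of e] e' by (auto simp: R_def)
    then show "d e' \<le> Suc (d e)" unfolding d_def[of e'] by (rule Least_le)
    have "d e' \<noteq> 0" using d[of e'] e' root_no_downstream by (cases "d e' = 0") auto
    then obtain n where n: "d e' = Suc n" by (cases "d e'") auto
    with d[of e'] obtain f where f: "(root, f) \<in> R ^^ n" "e' \<in> trib f" by (auto simp: R_def)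
    have "f = e" using unique_downstream[of e'] e' f(2) root_no_downstream by metis
    with f have "d e \<le> n" unfolding d_def[of e] by (intro Least_le) simp
    then show "Suc (d e) \<le> d e'" using n by simp
  qed
  then show ?thesis by blast
qed

lemma system_matrix_entry:
  "system_matrix trib K H $ Inl e $ Inl e' = - (K $ e * (if e' = e then 1 else if e' \<in> trib e then -1 else 0))"
  "system_matrix trib K H $ Inl e $ Inr e' = (if e = e' then K $ e else 0)"
  "system_matrix trib K H $ Inr e $ Inl e' = 0"
  "system_matrix trib K H $ Inr e $ Inr e' = (if e = e' then - H $ e else 0)"
  by (simp_all add: system_matrix_def block_matrix_def diag_matrix_def incidence_matrix_def
      matrix_matrix_mult_entry if_distrib[of "\<lambda>x. x * _"] cong: if_cong)

locale linear_network = river_network r trib for r :: "'e::finite" and trib :: "'e \<Rightarrow> 'e set" +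
  fixes K H a :: "real ^ 'e"
  assumes K_pos: "0 < K $ e" and H_pos: "0 < H $ e" and a_pos: "0 < a $ e"
begin

abbreviation "A \<equiv> system_matrix trib K H"

definition flow :: "real \<Rightarrow> real ^ ('e + 'e) ^ ('e + 'e)" where
  "flow s = matrix_exp (s *\<^sub>R A)"

definition input :: "real ^ ('e + 'e)" where
  "input = block_vector 0 (diag_matrix H *v a)"

text \<open>The function \<open>b(s)\<close> of the overview, in hydrology the unit hydrograph at
  the outlet.\<close>

definition response :: "real \<Rightarrow> real" where
  "response s = (flow s *v input) $ Inl r"

lemma no_self_tributary: "e \<notin> trib e"
  using depth_exists by (metis n_not_Suc_n)

lemma system_matrix_Metzler: "i \<noteq> j \<Longrightarrow> 0 \<le> A $ i $ j"
  using K_pos[THEN less_imp_le] H_pos[THEN less_imp_le]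
  by (cases i; cases j) (auto simp: system_matrix_entry)

lemma flow_nonneg: "0 \<le> s \<Longrightarrow> 0 \<le> flow s $ i $ j"
  unfolding flow_def by (intro matrix_exp_Metzler_nonneg system_matrix_Metzler)

lemma flow_0 [simp]: "flow 0 = mat 1"
  by (simp add: flow_def)

lemma flow_add: "flow (s + t) = flow s ** flow t"
  unfolding flow_def by (rule matrix_exp_add)

lemma flow_continuous: "continuous_on S (\<lambda>s. flow s $ i $ j)"
  unfolding flow_def by (rule matrix_exp_continuous)

lemma flow_vector_continuous: "continuous_on S (\<lambda>s. (flow s *v x) $ i)"
  unfolding matrix_vector_mult_def by (auto intro!: continuous_intros flow_continuous)

lemma input_Inl [simp]: "input $ Inl e = 0" and input_Inr [simp]: "input $ Inr e = H $ e * a $ e"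
  by (simp_all add: input_def block_vector_def diag_matrix_def matrix_vector_mult_def
      if_distrib[of "\<lambda>x. x * _"] cong: if_cong)

lemma input_nonneg: "0 \<le> input $ i"
  using H_pos a_pos by (cases i) (auto simp: less_imp_le)

lemma flow_vector_nonneg:
  assumes "0 \<le> s" "\<And>i. 0 \<le> x $ i"
  shows "0 \<le> (flow s *v x) $ i"
  using assms flow_nonneg unfolding matrix_vector_mult_def by (auto intro!: sum_nonneg)

lemma response_0 [simp]: "response 0 = 0"
  by (simp add: response_def)

text \<open>The storage of the root link feeds its discharge directly, at rate \<open>K $ r\<close>;
  the other links can only add to it.\<close>

lemma response_pos: "0 < s \<Longrightarrow> 0 < response s"
proof -
  assume s: "0 < s"
  have "0 < flow s $ Inl r $ Inr r"
    unfolding flow_def using s K_pos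
    by (intro matrix_exp_Metzler_pos system_matrix_Metzler) (auto simp: system_matrix_entry)
  then have "0 < flow s $ Inl r $ Inr r * input $ Inr r" using H_pos a_pos by simp
  also have "\<dots> \<le> response s"
    unfolding response_def matrix_vector_mult_def vec_lambda_beta
    by (rule member_le_sum) (use s input_nonneg flow_nonneg[of s] in auto)
  finally show ?thesis .
qed

lemma response_nonneg: "0 \<le> s \<Longrightarrow> 0 \<le> response s"
  using response_pos[of s] by (cases "s = 0") (auto simp: less_imp_le)

lemma response_continuous: "continuous_on S response"
  unfolding response_def by (rule flow_vector_continuous)

text \<open>
  A positive vector \<open>w\<close> with \<open>A w \<le> - \<mu> w\<close>: since a link has at most two tributaries, the weight
  \<open>3 ^ (- depth)\<close> on the discharges makes the tributaries lose a third.
\<close>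

lemma lyapunov_vector:
  obtains w :: "real ^ ('e + 'e)" and \<mu> where
    "0 < \<mu>" "\<And>i. 0 < w $ i" "\<And>i. (A *v w) $ i \<le> - \<mu> * w $ i"
proof -
  obtain d :: "'e \<Rightarrow> nat" where depth: "\<forall>e. \<forall>e'\<in>trib e. d e' = Suc (d e)"
    using depth_exists by (rule exE)
  have d: "\<And>e e'. e' \<in> trib e \<Longrightarrow> d e' = Suc (d e)"
    using depth by simp
  define D where "D = Max (range d)"
  \<comment> \<open>In the row of a discharge the tributaries leave a third of \<open>K $ e\<close>
    times its weight. A storage weight of one sixth of the smallest possible discharge weight uses
    up at most half of that, so that decay at rate \<open>K $ e / 6\<close> remains.\<close>
  define \<delta> :: real where "\<delta> = (1 / 3) ^ D / 6"
  define w :: "real ^ ('e + 'e)" where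
    "w = (\<chi> i. case i of Inl e \<Rightarrow> (1 / 3) ^ d e | Inr e \<Rightarrow> \<delta>)"
  define \<mu> where "\<mu> = Min (range (\<lambda>e. min (K $ e / 6) (H $ e)))"
  have \<mu>: "\<mu> \<le> K $ e / 6" "\<mu> \<le> H $ e" for e
  proof -
    have "\<mu> \<le> min (K $ e / 6) (H $ e)" unfolding \<mu>_def by (rule Min_le) auto
    then show "\<mu> \<le> K $ e / 6" "\<mu> \<le> H $ e" by auto
  qed
  have "0 < \<mu>" unfolding \<mu>_def using K_pos H_pos by (subst Min_gr_iff) auto
  moreover have "0 < w $ i" for i by (cases i) (auto simp: w_def \<delta>_def)
  moreover have "(A *v w) $ i \<le> - \<mu> * w $ i" for i
  proof (cases i)
    case (Inl e)
    have "(A *v w) $ i = (\<Sum>e'\<in>UNIV. A $ Inl e $ Inl e' * w $ Inl e')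
        + (\<Sum>e'\<in>UNIV. A $ Inl e $ Inr e' * w $ Inr e')"
      by (simp add: matrix_vector_mult_def sum_UNIV_Plus Inl)
    also have "(\<Sum>e'\<in>UNIV. A $ Inl e $ Inr e' * w $ Inr e') = K $ e * \<delta>"
      by (simp add: system_matrix_entry w_def if_distrib[of "\<lambda>x. x * _"] cong: if_cong)
    also have "(\<Sum>e'\<in>UNIV. A $ Inl e $ Inl e' * w $ Inl e')
        = (\<Sum>e'\<in>UNIV. (if e' = e then - K $ e * w $ Inl e else 0)
            + (if e' \<in> trib e then K $ e * w $ Inl e' else 0))"
      using no_self_tributary by (intro sum.cong) (auto simp: system_matrix_entry)
    also have "\<dots> = - K $ e * w $ Inl e + K $ e * (\<Sum>e'\<in>trib e. w $ Inl e')"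
      by (simp add: sum.distrib sum_distrib_left flip: sum.inter_filter)
    also have "(\<Sum>e'\<in>trib e. w $ Inl e') = card (trib e) * ((1 / 3) * w $ Inl e)"
      using d by (simp add: w_def)
    also have "\<dots> \<le> 2 * ((1 / 3) * w $ Inl e)"
      using binary[of e] \<open>\<And>i. 0 < w $ i\<close>[of "Inl e"] by (intro mult_right_mono) auto
    finally have "(A *v w) $ i \<le> - K $ e * w $ Inl e + K $ e * (2 * ((1 / 3) * w $ Inl e)) + K $ e * \<delta>"
      using K_pos[of e] by simp
    also have "\<dots> = K $ e * (\<delta> - w $ Inl e / 3)" by (simp add: algebra_simps)
    also have "\<dots> \<le> K $ e * (- (w $ Inl e / 6))"
    proof (intro mult_left_mono)
      have "(1 / 3 :: real) ^ D \<le> (1 / 3) ^ d e"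
        unfolding D_def by (intro power_decreasing Max_ge) auto
      then have "\<delta> \<le> w $ Inl e / 6" by (simp add: \<delta>_def w_def)
      then show "\<delta> - w $ Inl e / 3 \<le> - (w $ Inl e / 6)" by linarith
    qed (use K_pos[of e] in auto)
    also have "\<dots> \<le> - \<mu> * w $ Inl e"
      using mult_right_mono[OF \<mu>(1)[of e], of "w $ Inl e"] \<open>\<And>i. 0 < w $ i\<close>[of "Inl e"] by simp
    finally show ?thesis using Inl by simp
  next
    case (Inr e)
    have "(A *v w) $ i = - H $ e * \<delta>"
      by (simp add: matrix_vector_mult_def sum_UNIV_Plus Inr system_matrix_entry w_def
          if_distrib[of "\<lambda>x. x * _"] cong: if_cong)
    then show ?thesis using \<mu>(2)[of e] by (simp add: Inr w_def \<delta>_def)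
  qed
  ultimately show ?thesis using that by blast
qed

lemma flow_decay:
  obtains C \<mu> where "0 < \<mu>" "0 < C" "\<And>s i j. 0 \<le> s \<Longrightarrow> flow s $ i $ j \<le> C * exp (- (\<mu> * s))"
proof -
  obtain w :: "real ^ ('e + 'e)" and \<mu> where w:
    "0 < \<mu>" "\<And>i. 0 < w $ i" "\<And>i. (A *v w) $ i \<le> - \<mu> * w $ i" by (rule lyapunov_vector, rule that; blast)
  define C where "C = (\<Sum>i\<in>UNIV. \<Sum>j\<in>UNIV. w $ i / w $ j)"
  have nn: "0 \<le> w $ i / w $ j" for i j
    using w(2)[of i] w(2)[of j] by simp
  have le: "w $ i / w $ j \<le> C" for i j
  proof -
    have "w $ i / w $ j \<le> (\<Sum>j\<in>UNIV. w $ i / w $ j)"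
      by (rule member_le_sum) (simp_all add: nn)
    also have "\<dots> \<le> C" unfolding C_def
      by (rule member_le_sum[of i UNIV "\<lambda>i. \<Sum>j\<in>UNIV. w $ i / w $ j"]) (simp_all add: nn sum_nonneg)
    finally show ?thesis .
  qed
  have "0 < C" using le[of "Inl r" "Inl r"] w(2)[of "Inl r"] by auto
  moreover have "flow s $ i $ j \<le> C * exp (- (\<mu> * s))" if "0 \<le> s" for s i j
    using matrix_exp_Metzler_decay[OF system_matrix_Metzler w(2,3) that, of i j]
      mult_right_mono[OF le[of i j], of "exp (- (\<mu> * s))"] by (simp add: flow_def)
  ultimately show ?thesis using that[OF \<open>0 < \<mu>\<close>] by blast
qed

lemma flow_vector_decay:
  obtains C \<mu> where "0 < \<mu>" "0 < C"
    "\<And>s x i. \<lbrakk>0 \<le> s; \<And>j. 0 \<le> x $ j\<rbrakk> \<Longrightarrow> (flow s *v x) $ i \<le> C * (\<Sum>j\<in>UNIV. x $ j) * exp (- (\<mu> * s))"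
proof -
  obtain C \<mu> where C: "0 < \<mu>" "0 < C" "\<And>s i j. 0 \<le> s \<Longrightarrow> flow s $ i $ j \<le> C * exp (- (\<mu> * s))"
    by (rule flow_decay, rule that; blast)
  have "(flow s *v x) $ i \<le> C * (\<Sum>j\<in>UNIV. x $ j) * exp (- (\<mu> * s))"
    if "0 \<le> s" "\<And>j. 0 \<le> x $ j" for s x i
  proof -
    have "(flow s *v x) $ i \<le> (\<Sum>j\<in>UNIV. C * exp (- (\<mu> * s)) * x $ j)"
      unfolding matrix_vector_mult_def vec_lambda_beta by (intro sum_mono mult_right_mono C that)
    then show ?thesis by (simp add: sum_distrib_left sum_distrib_right mult_ac)
  qed
  then show ?thesis using that C by blast
qed

lemma flow_vector_tendsto_0:
  assumes "\<And>j. 0 \<le> x $ j"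
  shows "((\<lambda>s. (flow s *v x) $ i) \<longlongrightarrow> 0) at_top"
proof -
  obtain C \<mu> where C: "0 < \<mu>" "0 < C"
    "\<And>s x i. \<lbrakk>0 \<le> s; \<And>j. 0 \<le> x $ j\<rbrakk> \<Longrightarrow> (flow s *v x) $ i \<le> C * (\<Sum>j\<in>UNIV. x $ j) * exp (- (\<mu> * s))"
    by (rule flow_vector_decay, rule that; blast)
  have lim: "((\<lambda>s. C * (\<Sum>j\<in>UNIV. x $ j) * exp (- (\<mu> * s))) \<longlongrightarrow> C * (\<Sum>j\<in>UNIV. x $ j) * 0) at_top"
    using C(1)
    by (intro tendsto_intros filterlim_compose[OF exp_at_bot]
        filterlim_compose[OF filterlim_uminus_at_bot_at_top]
        filterlim_tendsto_pos_mult_at_top[OF tendsto_const] filterlim_ident)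
  show ?thesis
    by (rule tendsto_sandwich[OF _ _ tendsto_const lim[simplified]])
      (auto intro!: eventually_mono[OF eventually_ge_at_top[of 0]] C(3) flow_vector_nonneg assms)
qed

text \<open>For \<open>s = - ln u / H $ r\<close> the matrix power is the transpose of
  \<open>flow s\<close>, so its column at the root discharge is the row of \<open>flow s\<close>
  that determines this discharge. Pairing it with \<open>H $ e * a $ e\<close> gives
  \<open>response s\<close>.\<close>

lemma root_response_eq:
  assumes "0 < u"
  shows "(\<Sum>e\<in>UNIV. H $ e / K $ r * (a $ e / (\<Sum>e'\<in>UNIV. a $ e')) * root_response r trib K H u $ e)
    = response (- ln u / H $ r) / (K $ r * (\<Sum>e\<in>UNIV. a $ e))"
proof -
  have "root_response r trib K H u $ e = flow (- ln u / H $ r) $ Inl r $ Inr e" for e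
  proof -
    have "ln u *\<^sub>R (- ((1 / H $ r) *\<^sub>R transpose A)) = transpose ((- ln u / H $ r) *\<^sub>R A)"
      by (simp add: vec_eq_iff transpose_def)
    then show ?thesis
      by (simp add: root_response_def scalar_matrix_powr_def matrix_exp_transpose flow_def)
        (simp add: column_def transpose_def row_def)
  qed
  moreover have "response s = (\<Sum>e\<in>UNIV. flow s $ Inl r $ Inr e * (H $ e * a $ e))" for s
    by (simp add: response_def matrix_vector_mult_def sum_UNIV_Plus)
  ultimately show ?thesis
    by (simp add: sum_divide_distrib mult_ac)
qed

end

section \<open>Marked Poisson processes\<close>

text \<open>The marks are only bounded below here; how they relate to the jump times is left open
  until invariance is available.\<close>

locale marked_poisson = prob_space M for M :: "'w measure" +
  fixes lam k :: real and N :: "real \<Rightarrow> 'w \<Rightarrow> nat" and T P :: "nat \<Rightarrow> 'w \<Rightarrow> real"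
  assumes lam_pos: "0 < lam" and k_pos: "0 < k"
    and poisson: "poisson_process lam N T"
    and P_measurable: "1 \<le> n \<Longrightarrow> random_variable borel (P n)"
    and P_ge: "1 \<le> n \<Longrightarrow> AE \<omega> in M. k \<le> P n \<omega>"
begin

lemma N_measurable [measurable]: "0 \<le> t \<Longrightarrow> N t \<in> measurable M (count_space UNIV)"
  using poisson by (simp add: poisson_process_def)

lemma T_measurable: "1 \<le> n \<Longrightarrow> random_variable borel (T n)"
  using poisson by (simp add: poisson_process_def)

lemma N_measurable_pred:
  assumes "0 \<le> s" "0 \<le> t"
  shows "{\<omega> \<in> space M. Q (N s \<omega>) (N t \<omega>)} \<in> sets M"
proof -
  have "{\<omega> \<in> space M. Q (N s \<omega>) (N t \<omega>)}
    = (\<Union>i. \<Union>j\<in>{j. Q i j}. {\<omega> \<in> space M. N s \<omega> = i} \<inter> {\<omega> \<in> space M. N t \<omega> = j})"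
    by auto
  also have "\<dots> \<in> sets M" using assms by measurable
  finally show ?thesis .
qed

lemma increment_measurable:
  assumes "0 \<le> s" "0 \<le> t"
  shows "(\<lambda>\<omega>. N t \<omega> - N s \<omega>) \<in> measurable M (count_space UNIV)"
  using N_measurable_pred[OF assms, of "\<lambda>i j. j - i = x" for x]
  by (auto simp: measurable_count_space_eq2_countable vimage_def Int_def conj_commute)

lemma prob_increment:
  assumes "0 \<le> s" "s < t"
  shows "prob {\<omega> \<in> space M. N t \<omega> - N s \<omega> \<in> B} = measure_pmf.prob (poisson_pmf (lam * (t - s))) B"
proof -
  have "distr M (count_space UNIV) (\<lambda>\<omega>. N t \<omega> - N s \<omega>) = measure_pmf (poisson_pmf (lam * (t - s)))"
    using poisson assms by (simp add: poisson_process_def)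
  then have "measure_pmf.prob (poisson_pmf (lam * (t - s))) B
      = measure (distr M (count_space UNIV) (\<lambda>\<omega>. N t \<omega> - N s \<omega>)) B" by simp
  also have "\<dots> = prob {\<omega> \<in> space M. N t \<omega> - N s \<omega> \<in> B}"
    using increment_measurable[of s t] assms
    by (subst measure_distr) (auto simp: vimage_def Int_def conj_commute)
  finally show ?thesis by simp
qed

text \<open>Truncated subtraction makes a nonzero increment the same as \<open>N s < N t\<close>,
  even on paths that are not monotone.\<close>

lemma prob_jump:
  assumes "0 \<le> s" "s \<le> t"
  shows "prob {\<omega> \<in> space M. N s \<omega> < N t \<omega>} = 1 - exp (- (lam * (t - s)))"
proof (cases "s = t")
  case False
  have "measure_pmf.prob (poisson_pmf (lam * (t - s))) (- {0}) = 1 - exp (- (lam * (t - s)))"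
    using measure_pmf.prob_compl[of "{0}" "poisson_pmf (lam * (t - s))"] lam_pos assms False
    by (simp add: measure_pmf_single Compl_eq_Diff_UNIV pmf_poisson)
  moreover have "{\<omega> \<in> space M. N s \<omega> < N t \<omega>} = {\<omega> \<in> space M. N t \<omega> - N s \<omega> \<in> - {0}}" by auto
  ultimately show ?thesis using prob_increment[of s t "- {0}"] assms False by simp
qed simp

lemma prob_jump_le:
  assumes "0 \<le> s" "s \<le> t"
  shows "prob {\<omega> \<in> space M. N s \<omega> < N t \<omega>} \<le> lam * (t - s)"
  using prob_jump[OF assms] exp_ge_add_one_self[of "- (lam * (t - s))"] by simp

text \<open>The quadratic bound makes a second jump negligible against a first one, whose
  probability is of order \<open>t - s\<close>.\<close>

lemma prob_two_jumps_le:
  assumes "0 \<le> s" "s < t"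
  shows "prob {\<omega> \<in> space M. N s \<omega> + 2 \<le> N t \<omega>} \<le> (lam * (t - s))\<^sup>2"
proof -
  define r where "r = lam * (t - s)"
  have r: "0 < r" using lam_pos assms by (simp add: r_def)
  have "measure_pmf.prob (poisson_pmf r) (- {0, 1}) = 1 - (exp (- r) + r * exp (- r))"
    using r measure_pmf.prob_compl[of "{0, 1}" "poisson_pmf r"]
    by (simp add: measure_measure_pmf_finite Compl_eq_Diff_UNIV pmf_poisson)
  also have "\<dots> = 1 - exp (- r) * (1 + r)" by (simp add: algebra_simps)
  also have "\<dots> \<le> 1 - (1 - r) * (1 + r)"
    using exp_ge_add_one_self[of "- r"] r mult_right_mono[of "1 - r" "exp (- r)" "1 + r"] by simp
  also have "\<dots> = r\<^sup>2" by (simp add: algebra_simps power2_eq_square)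
  finally have "measure_pmf.prob (poisson_pmf r) (- {0, 1}) \<le> r\<^sup>2" .
  moreover have "{\<omega> \<in> space M. N s \<omega> + 2 \<le> N t \<omega>} = {\<omega> \<in> space M. N t \<omega> - N s \<omega> \<in> - {0, 1}}" by auto
  ultimately show ?thesis using prob_increment[of s t "- {0, 1}"] assms by (simp add: r_def)
qed

lemma prob_consecutive_jumps:
  assumes "0 \<le> s" "s < t" "t < u"
  shows "prob {\<omega> \<in> space M. N s \<omega> < N t \<omega> \<and> N t \<omega> < N u \<omega>} \<le> lam * (t - s) * (lam * (u - t))"
proof -
  \<comment> \<open>Independence of increments is stated for partitions given as sequences; this one
    runs through \<open>s\<close>, \<open>t\<close>, \<open>u\<close>.\<close>
  define tt where "tt = (\<lambda>i::nat. if i = 0 then s else if i = 1 then t else u)"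
  have "indep_vars (\<lambda>_. count_space UNIV) (\<lambda>i \<omega>. N (tt (Suc i)) \<omega> - N (tt i) \<omega>) {..<2}"
  proof -
    have all: "\<forall>m t. 0 \<le> t 0 \<and> (\<forall>i<m. t i < t (Suc i)) \<longrightarrow>
        indep_vars (\<lambda>_. count_space UNIV) (\<lambda>i \<omega>. N (t (Suc i)) \<omega> - N (t i) \<omega>) {..<(m::nat)}"
      using poisson unfolding poisson_process_def by (elim conjE)
    have tt: "0 \<le> tt 0 \<and> (\<forall>i<2. tt i < tt (Suc i))"
      using assms by (simp add: tt_def less_2_cases_iff)
    show ?thesis using all[THEN spec, of 2, THEN spec, of tt] tt by (rule mp)
  qed
  from indep_varsD[OF this, of "{0, 1}" "\<lambda>_. - {0}"]
  have "prob (\<Inter>j\<in>{0, 1}. (\<lambda>\<omega>. N (tt (Suc j)) \<omega> - N (tt j) \<omega>) -` (- {0}) \<inter> space M)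
      = (\<Prod>j\<in>{0, 1}. prob ((\<lambda>\<omega>. N (tt (Suc j)) \<omega> - N (tt j) \<omega>) -` (- {0}) \<inter> space M))"
    by auto
  moreover have "(\<lambda>\<omega>. N y \<omega> - N x \<omega>) -` (- {0}) \<inter> space M = {\<omega> \<in> space M. N x \<omega> < N y \<omega>}" for x y
    by auto
  moreover have "{\<omega> \<in> space M. N s \<omega> < N t \<omega>} \<inter> {\<omega> \<in> space M. N t \<omega> < N u \<omega>}
      = {\<omega> \<in> space M. N s \<omega> < N t \<omega> \<and> N t \<omega> < N u \<omega>}" by auto
  ultimately have "prob {\<omega> \<in> space M. N s \<omega> < N t \<omega> \<and> N t \<omega> < N u \<omega>}
      = prob {\<omega> \<in> space M. N s \<omega> < N t \<omega>} * prob {\<omega> \<in> space M. N t \<omega> < N u \<omega>}"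
    by (simp add: tt_def)
  also have "\<dots> \<le> lam * (t - s) * (lam * (u - t))"
    using prob_jump_le[of s t] prob_jump_le[of t u] assms lam_pos by (intro mult_mono) auto
  finally show ?thesis .
qed

text \<open>All later pathwise arguments rest on this duality between counts and jump times. It
  holds because increasing jump times make the jumps up to \<open>t\<close> an initial segment of
  \<open>{1..}\<close>, of cardinality \<open>N t\<close>.\<close>

lemma AE_paths:
  "AE \<omega> in M. (\<forall>n\<ge>1. \<forall>t\<ge>0. n \<le> N t \<omega> \<longleftrightarrow> T n \<omega> \<le> t) \<and> (\<forall>n\<ge>1. 0 < T n \<omega> \<and> k \<le> P n \<omega>)"
proof -
  have T: "AE \<omega> in M. 0 < T 1 \<omega> \<and> (\<forall>n\<ge>1. T n \<omega> < T (Suc n) \<omega>)"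
    and N: "AE \<omega> in M. \<forall>t\<ge>0. finite {n. 1 \<le> n \<and> T n \<omega> \<le> t} \<and> N t \<omega> = card {n. 1 \<le> n \<and> T n \<omega> \<le> t}"
    using poisson by (simp_all add: poisson_process_def)
  have P: "AE \<omega> in M. \<forall>n. 1 \<le> n \<longrightarrow> k \<le> P n \<omega>"
    using P_ge by (simp add: AE_all_countable)
  from T N P show ?thesis
  proof eventually_elim
    case (elim \<omega>)
    have mono: "T m \<omega> \<le> T n \<omega>" if "1 \<le> m" "m \<le> n" for m n
      using that(2)
    proof (induction n rule: dec_induct)
      case (step n)
      have "1 \<le> n" using that(1) step(1) by simp
      with elim(1) have "T n \<omega> < T (Suc n) \<omega>" by blast
      with step show ?case by simp
    qed simp
    have iff: "n \<le> N t \<omega> \<longleftrightarrow> T n \<omega> \<le> t" if n: "1 \<le> n" and t: "0 \<le> t" for n t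
    proof -
      define J where "J = {n. 1 \<le> n \<and> T n \<omega> \<le> t}"
      have J: "finite J" "N t \<omega> = card J" using elim(2) t by (auto simp: J_def)
      show ?thesis
      proof
        assume "T n \<omega> \<le> t"
        moreover have "T m \<omega> \<le> T n \<omega>" if "m \<in> {1..n}" for m using mono[of m n] that by simp
        ultimately have "{1..n} \<subseteq> J" by (fastforce simp: J_def)
        from card_mono[OF J(1) this] show "n \<le> N t \<omega>" by (simp add: J)
      next
        assume le: "n \<le> N t \<omega>"
        show "T n \<omega> \<le> t"
        proof (rule ccontr)
          assume "\<not> T n \<omega> \<le> t"
          moreover have "m < n" if "m \<in> J" for m
            using calculation mono[of n m] that n by (cases "m < n") (auto simp: J_def)
          ultimately have "J \<subseteq> {1..<n}" by (auto simp: J_def)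
          from card_mono[OF _ this] show False using le n by (simp add: J)
        qed
      qed
    qed
    moreover have "0 < T n \<omega>" if "1 \<le> n" for n
      using mono[of 1 n] that elim(1) by simp
    ultimately show ?case using elim(3) by auto
  qed
qed

lemma AE_N_0: "AE \<omega> in M. N 0 \<omega> = 0"
  using AE_paths
proof eventually_elim
  case (elim \<omega>)
  then have "\<not> 1 \<le> N 0 \<omega>" by (auto simp: not_le)
  then show ?case by simp
qed

lemma AE_N_mono: "AE \<omega> in M. \<forall>s t. 0 \<le> s \<longrightarrow> s \<le> t \<longrightarrow> N s \<omega> \<le> N t \<omega>"
  using AE_paths
proof eventually_elim
  case (elim \<omega>)
  show ?case
  proof (intro allI impI)
    fix s t :: real assume st: "0 \<le> s" "s \<le> t"
    show "N s \<omega> \<le> N t \<omega>"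
    proof (cases "N s \<omega> = 0")
      case False
      then have "1 \<le> N s \<omega>" by simp
      with elim st have "T (N s \<omega>) \<omega> \<le> s" by blast
      then have "T (N s \<omega>) \<omega> \<le> t" using st by simp
      moreover have "0 \<le> t" using st by simp
      ultimately show ?thesis using elim \<open>1 \<le> N s \<omega>\<close> by blast
    qed simp
  qed
qed

text \<open>The Poisson law is given for increments only; \<open>N 0 = 0\<close> has to come from
  the positivity of the jump times.\<close>

lemma prob_N_eq_0: "0 \<le> t \<Longrightarrow> prob {\<omega> \<in> space M. N t \<omega> = 0} = exp (- (lam * t))"
proof -
  assume t: "0 \<le> t"
  have "prob {\<omega> \<in> space M. N t \<omega> = 0} = prob (space M - {\<omega> \<in> space M. N 0 \<omega> < N t \<omega>})"
  proof (rule finite_measure_eq_AE)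
    show "AE \<omega> in M. (\<omega> \<in> {\<omega> \<in> space M. N t \<omega> = 0}) = (\<omega> \<in> space M - {\<omega> \<in> space M. N 0 \<omega> < N t \<omega>})"
      using AE_N_0 by eventually_elim auto
  qed (use N_measurable_pred[of 0 t "(<)"] N_measurable_pred[of t t "\<lambda>i j. i = 0"] t in auto)
  also have "\<dots> = 1 - prob {\<omega> \<in> space M. N 0 \<omega> < N t \<omega>}"
    using N_measurable_pred[of 0 t "(<)"] t by (intro prob_compl) auto
  finally show ?thesis using prob_jump[of 0 t] t by simp
qed

section \<open>Shot noise and the first jump in a short interval\<close>

definition shot :: "(real \<Rightarrow> real) \<Rightarrow> real \<Rightarrow> 'w \<Rightarrow> real" where
  "shot w t \<omega> = (\<Sum>n = 1..N t \<omega>. w (t - T n \<omega>) * P n \<omega>)"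

lemma shot_measurable:
  assumes [measurable]: "w \<in> borel_measurable borel" and "0 \<le> t"
  shows "shot w t \<in> borel_measurable M"
proof -
  \<comment> \<open>The number of summands is random: it is fixed first, and the countably many
    cases are then put together.\<close>
  have "(\<lambda>\<omega>. (\<lambda>m \<omega>. \<Sum>n = 1..m. w (t - T n \<omega>) * P n \<omega>) (N t \<omega>) \<omega>) \<in> borel_measurable M"
  proof (rule measurable_compose_countable)
    show "(\<lambda>\<omega>. \<Sum>n = 1..m. w (t - T n \<omega>) * P n \<omega>) \<in> borel_measurable M" for m
      using P_measurable T_measurable by (intro borel_measurable_sum borel_measurable_times) auto
  qed (use assms in measurable)
  then show ?thesis by (simp add: shot_def[abs_def])
qed

lemma AE_shot_nonneg:
  assumes "0 \<le> t" "\<And>u. 0 \<le> u \<Longrightarrow> 0 \<le> w u"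
  shows "AE \<omega> in M. 0 \<le> shot w t \<omega>"
  using AE_paths
proof eventually_elim
  case (elim \<omega>)
  show ?case unfolding shot_def
  proof (intro sum_nonneg mult_nonneg_nonneg)
    fix n assume "n \<in> {1..N t \<omega>}"
    then have "T n \<omega> \<le> t" "k \<le> P n \<omega>" using elim assms(1) by auto
    then show "0 \<le> w (t - T n \<omega>)" "0 \<le> P n \<omega>" using assms(2) k_pos by auto
  qed
qed

lemma integrable_bounded:
  assumes "f \<in> borel_measurable M" "AE \<omega> in M. \<bar>f \<omega>\<bar> \<le> B"
  shows "integrable M (f :: 'w \<Rightarrow> real)"
  using assms by (intro integrable_const_bound[of _ B]) auto

lemma indicator_event_measurable:
  assumes "0 \<le> s" "0 \<le> t"
  shows "(\<lambda>\<omega>. of_bool (Q (N s \<omega>) (N t \<omega>)) :: real) \<in> borel_measurable M"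
proof -
  have "(\<lambda>\<omega>. indicator {\<omega> \<in> space M. Q (N s \<omega>) (N t \<omega>)} \<omega> :: real) \<in> borel_measurable M"
    using N_measurable_pred[OF assms, of Q] by simp
  then show ?thesis by (rule subst[OF measurable_cong, rotated]) (auto simp: indicator_def)
qed

lemma expectation_of_bool:
  assumes "0 \<le> s" "0 \<le> t"
  shows "expectation (\<lambda>\<omega>. of_bool (Q (N s \<omega>) (N t \<omega>)) :: real) = prob {\<omega> \<in> space M. Q (N s \<omega>) (N t \<omega>)}"
proof -
  have "expectation (\<lambda>\<omega>. of_bool (Q (N s \<omega>) (N t \<omega>)) :: real) = expectation (indicator {\<omega> \<in> space M. Q (N s \<omega>) (N t \<omega>)})"
    by (intro Bochner_Integration.integral_cong) (auto simp: indicator_def)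
  then show ?thesis using N_measurable_pred[OF assms, of Q] by simp
qed

text \<open>Demanding no jump up to \<open>t\<close> ensures that the first jump after
  \<open>t\<close> is jump number 1, so that only the mark \<open>P 1\<close> is ever
  involved.\<close>

definition first :: "real \<Rightarrow> real \<Rightarrow> (real \<Rightarrow> real) \<Rightarrow> real" where
  "first t h q = expectation (\<lambda>\<omega>. of_bool (N t \<omega> = 0 \<and> N t \<omega> < N (t + h) \<omega>) * q (P 1 \<omega>))"

lemma first_integrable:
  fixes q :: "real \<Rightarrow> real"
  assumes "q \<in> borel_measurable borel" "\<And>p. k \<le> p \<Longrightarrow> \<bar>q p\<bar> \<le> C" "0 \<le> t" "0 \<le> h"
  shows "integrable M (\<lambda>\<omega>. of_bool (N t \<omega> = 0 \<and> N t \<omega> < N (t + h) \<omega>) * q (P 1 \<omega>))"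
proof (rule integrable_bounded)
  show "(\<lambda>\<omega>. of_bool (N t \<omega> = 0 \<and> N t \<omega> < N (t + h) \<omega>) * q (P 1 \<omega>)) \<in> borel_measurable M"
    using assms indicator_event_measurable[of t "t + h" "\<lambda>i j. i = 0 \<and> i < j"]
      measurable_compose[OF P_measurable[of 1], of q borel] by auto
  show "AE \<omega> in M. \<bar>of_bool (N t \<omega> = 0 \<and> N t \<omega> < N (t + h) \<omega>) * q (P 1 \<omega>)\<bar> \<le> C"
    using P_ge[of 1, simplified]
  proof eventually_elim
    case (elim \<omega>)
    then have "\<bar>q (P 1 \<omega>)\<bar> \<le> C" using assms(2) by simp
    then show ?case by (auto simp: abs_mult)
  qed
qed

text \<open>The exact jump probability is kept as a factor because \<open>first\<close> will be
  divided by it.\<close>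

lemma first_abs_le:
  assumes "q \<in> borel_measurable borel" "\<And>p. k \<le> p \<Longrightarrow> \<bar>q p\<bar> \<le> C" "0 \<le> t" "0 \<le> h"
  shows "\<bar>first t h q\<bar> \<le> C * (1 - exp (- (lam * h)))"
proof -
  have C: "0 \<le> C" using assms(2)[of k] by simp
  have "\<bar>first t h q\<bar> \<le> expectation (\<lambda>\<omega>. \<bar>of_bool (N t \<omega> = 0 \<and> N t \<omega> < N (t + h) \<omega>) * q (P 1 \<omega>)\<bar>)"
    unfolding first_def by (rule integral_abs_bound)
  also have "\<dots> \<le> expectation (\<lambda>\<omega>. C * of_bool (N t \<omega> < N (t + h) \<omega>))"
  proof (rule integral_mono_AE)
    show "AE \<omega> in M. \<bar>of_bool (N t \<omega> = 0 \<and> N t \<omega> < N (t + h) \<omega>) * q (P 1 \<omega>)\<bar> \<le> C * of_bool (N t \<omega> < N (t + h) \<omega>)"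
      using P_ge[of 1, simplified]
    proof eventually_elim
      case (elim \<omega>)
      then have "\<bar>q (P 1 \<omega>)\<bar> \<le> C" using assms(2) by simp
      then show ?case using C by (auto simp: abs_mult)
    qed
    show "integrable M (\<lambda>\<omega>. C * of_bool (N t \<omega> < N (t + h) \<omega>))"
      using assms indicator_event_measurable[of t "t + h" "\<lambda>i j. i < j"] C
      by (intro integrable_bounded[of _ C] borel_measurable_times) auto
  qed (use first_integrable[OF assms] in auto)
  also have "\<dots> = C * prob {\<omega> \<in> space M. N t \<omega> < N (t + h) \<omega>}"
    using expectation_of_bool[of t "t + h" "\<lambda>i j. i < j"] assms by simp
  finally show ?thesis using prob_jump[of t "t + h"] assms by simp
qed

lemma first_bound:
  assumes "q \<in> borel_measurable borel" "\<And>p. k \<le> p \<Longrightarrow> \<bar>q p\<bar> \<le> C" "0 \<le> t" "0 \<le> h"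
  shows "\<bar>first t h q\<bar> \<le> C * (lam * h)"
proof -
  have "0 \<le> C" using assms(2)[of k] by simp
  then have "C * (1 - exp (- (lam * h))) \<le> C * (lam * h)"
    using exp_ge_add_one_self[of "- (lam * h)"] by (intro mult_left_mono) auto
  then show ?thesis using first_abs_le[OF assms] by simp
qed

text \<open>
  Up to an error of order \<open>h\<^sup>2\<close> only one jump falls into an interval of length \<open>h\<close>, and its response
  has not yet changed.
\<close>

lemma shot_first_jump:
  assumes [measurable]: "w \<in> borel_measurable borel" "q \<in> borel_measurable borel" "\<eta> \<in> borel_measurable borel"
    and w: "\<And>u. 0 \<le> u \<Longrightarrow> 0 \<le> w u" "0 \<le> c"
    and q: "\<And>x. 0 \<le> x \<Longrightarrow> \<bar>q x\<bar> \<le> C" "q 0 = 0"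
    and \<eta>: "\<And>u p. 0 \<le> u \<Longrightarrow> u \<le> h \<Longrightarrow> k \<le> p \<Longrightarrow> \<bar>q (w u * p) - q (c * p)\<bar> \<le> \<eta> p"
      "\<And>p. k \<le> p \<Longrightarrow> \<eta> p \<le> B"
    and t: "0 \<le> t" "0 < h"
  shows "\<bar>expectation (\<lambda>\<omega>. of_bool (N t \<omega> = 0) * q (shot w (t + h) \<omega>)) - first t h (\<lambda>p. q (c * p))\<bar>
    \<le> first t h \<eta> + 2 * C * (lam * h)\<^sup>2"
proof -
  define J where "J \<omega> = (of_bool (N t \<omega> = 0 \<and> N t \<omega> < N (t + h) \<omega>) :: real)" for \<omega>
  have C: "0 \<le> C" using q(1)[of 0] by simp
  have \<eta>0: "0 \<le> \<eta> p" if "k \<le> p" for p using \<eta>(1)[of 0 p] that t by linarith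
  have int1: "integrable M (\<lambda>\<omega>. of_bool (N t \<omega> = 0) * q (shot w (t + h) \<omega>))"
  proof (rule integrable_bounded)
    show "(\<lambda>\<omega>. of_bool (N t \<omega> = 0) * q (shot w (t + h) \<omega>)) \<in> borel_measurable M"
      using t shot_measurable[of w "t + h"] indicator_event_measurable[of t t "\<lambda>i j. i = 0"] by simp
    show "AE \<omega> in M. \<bar>of_bool (N t \<omega> = 0) * q (shot w (t + h) \<omega>)\<bar> \<le> C"
      using AE_shot_nonneg[of "t + h" w, OF _ w(1)] t
      by (auto elim!: eventually_mono simp: C q(1))
  qed
  have int2: "integrable M (\<lambda>\<omega>. J \<omega> * q (c * P 1 \<omega>))"
    unfolding J_def using w(2) k_pos t
    by (intro first_integrable[of "\<lambda>p. q (c * p)" C] q) auto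
  have int3: "integrable M (\<lambda>\<omega>. J \<omega> * \<eta> (P 1 \<omega>))"
    unfolding J_def using t \<eta>(2) \<eta>0 by (intro first_integrable[of \<eta> B]) (simp_all add: abs_of_nonneg)
  have int4: "integrable M (\<lambda>\<omega>. 2 * C * of_bool (N t \<omega> + 2 \<le> N (t + h) \<omega>))"
    using t indicator_event_measurable[of t "t + h" "\<lambda>i j. i + 2 \<le> j"] C
    by (intro integrable_bounded[of _ "2 * C"] borel_measurable_times) auto
  have S0: "AE \<omega> in M. 0 \<le> shot w (t + h) \<omega>"
    using t w(1) by (intro AE_shot_nonneg) auto
  have "\<bar>expectation (\<lambda>\<omega>. of_bool (N t \<omega> = 0) * q (shot w (t + h) \<omega>)) - first t h (\<lambda>p. q (c * p))\<bar>
      = \<bar>expectation (\<lambda>\<omega>. of_bool (N t \<omega> = 0) * q (shot w (t + h) \<omega>) - J \<omega> * q (c * P 1 \<omega>))\<bar>"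
    unfolding first_def J_def[symmetric] using int1 int2 by simp
  also have "\<dots> \<le> expectation (\<lambda>\<omega>. \<bar>of_bool (N t \<omega> = 0) * q (shot w (t + h) \<omega>) - J \<omega> * q (c * P 1 \<omega>)\<bar>)"
    by (rule integral_abs_bound)
  also have "\<dots> \<le> expectation (\<lambda>\<omega>. J \<omega> * \<eta> (P 1 \<omega>) + 2 * C * of_bool (N t \<omega> + 2 \<le> N (t + h) \<omega>))"
  proof (rule integral_mono_AE)
    show "AE \<omega> in M. \<bar>of_bool (N t \<omega> = 0) * q (shot w (t + h) \<omega>) - J \<omega> * q (c * P 1 \<omega>)\<bar>
        \<le> J \<omega> * \<eta> (P 1 \<omega>) + 2 * C * of_bool (N t \<omega> + 2 \<le> N (t + h) \<omega>)"
      using AE_paths S0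
    proof eventually_elim
      case (elim \<omega>)
      then have paths: "\<And>n s. 1 \<le> n \<Longrightarrow> 0 \<le> s \<Longrightarrow> n \<le> N s \<omega> \<longleftrightarrow> T n \<omega> \<le> s"
        and P: "k \<le> P 1 \<omega>" and S: "0 \<le> shot w (t + h) \<omega>" by auto
      have P\<eta>: "0 \<le> \<eta> (P 1 \<omega>)" using \<eta>0 P .
      have qP: "\<bar>q (c * P 1 \<omega>)\<bar> \<le> C" using P k_pos w(2) by (intro q) auto
      \<comment> \<open>Only one jump in (t, t + h] makes a true comparison of the two test values,
        at the price \<open>\<eta>\<close>. Two or more jumps cost \<open>2 * C\<close>. In the
        other cases both terms vanish, for an empty noise because \<open>q 0 = 0\<close>.\<close>
      consider "N t \<omega> \<noteq> 0" | "N t \<omega> = 0" "N (t + h) \<omega> = 0" | "N t \<omega> = 0" "N (t + h) \<omega> = 1"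
        | "N t \<omega> = 0" "2 \<le> N (t + h) \<omega>" by linarith
      then show ?case
      proof cases
        case 1
        then show ?thesis using C by (simp add: J_def)
      next
        case 2
        then show ?thesis using C by (simp add: J_def shot_def q)
      next
        case 3
        then have "t < T 1 \<omega>" "T 1 \<omega> \<le> t + h" using paths[of 1 t] paths[of 1 "t + h"] t by auto
        then show ?thesis using 3 P t \<eta>(1)[of "t + h - T 1 \<omega>" "P 1 \<omega>"] by (simp add: J_def shot_def)
      next
        case 4
        have "\<bar>q (shot w (t + h) \<omega>) - q (c * P 1 \<omega>)\<bar> \<le> 2 * C" using qP q(1)[OF S] by linarith
        then show ?thesis using 4 P\<eta> by (simp add: J_def)
      qed
    qed
  qed (use int1 int2 int3 int4 in auto)
  also have "\<dots> = first t h \<eta> + 2 * C * prob {\<omega> \<in> space M. N t \<omega> + 2 \<le> N (t + h) \<omega>}"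
    using int3 int4 expectation_of_bool[of t "t + h" "\<lambda>i j. i + 2 \<le> j"] t
    by (simp add: first_def J_def)
  also have "\<dots> \<le> first t h \<eta> + 2 * C * (lam * h)\<^sup>2"
    using prob_two_jumps_le[of t "t + h"] t C by (intro add_left_mono mult_left_mono) auto
  finally show ?thesis .
qed

end

section \<open>The first mark under a cocycle condition\<close>

context marked_poisson
begin

lemma exp_shot_integrable:
  assumes "w \<in> borel_measurable borel" "\<And>u. 0 \<le> u \<Longrightarrow> 0 \<le> w u" "0 \<le> t"
  shows "integrable M (\<lambda>\<omega>. exp (- shot w t \<omega>))"
  using assms shot_measurable[of w t] AE_shot_nonneg[of t w]
  by (intro integrable_bounded[of _ 1]) (auto elim!: eventually_mono)

lemma of_bool_integrable:
  assumes "0 \<le> s" "0 \<le> t"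
  shows "integrable M (\<lambda>\<omega>. of_bool (Q (N s \<omega>) (N t \<omega>)) :: real)"
  using indicator_event_measurable[OF assms, of Q] by (intro integrable_bounded[of _ 1]) auto

text \<open>
  The jumps that occurred before \<open>t - \<delta>\<close> are suppressed by a large weight \<open>\<beta>\<close>, so that the cocycle
  identity compares the first jump after time \<open>t\<close> with the first jump after time 0.
\<close>

lemma first_shift_estimate:
  assumes w [measurable]: "w \<in> borel_measurable borel" and w0: "\<And>u. 0 \<le> u \<Longrightarrow> 0 \<le> w u"
    and \<delta>: "0 < \<delta>" and \<beta>: "0 \<le> \<beta>" "\<And>u. \<delta> \<le> u \<Longrightarrow> u \<le> 2 \<Longrightarrow> \<beta> \<le> w u"
    and y: "0 < y" "0 \<le> \<epsilon>" "\<epsilon> \<le> 1 / 2" "\<And>u. 0 \<le> u \<Longrightarrow> u \<le> h \<Longrightarrow> \<bar>w u - y\<bar> \<le> \<epsilon> * y"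
    and t: "0 \<le> t" "t \<le> 1" "0 < h" "h \<le> 1"
    and cocycle: "expectation (\<lambda>\<omega>. exp (- shot w (t + h) \<omega>))
      = expectation (\<lambda>\<omega>. exp (- shot w h \<omega>)) * expectation (\<lambda>\<omega>. exp (- shot (\<lambda>u. w (h + u)) t \<omega>))"
  shows "\<bar>first t h (\<lambda>p. 1 - exp (- (y * p))) - exp (- (lam * t)) * first 0 h (\<lambda>p. 1 - exp (- (y * p)))\<bar>
    \<le> 2 * (2 * \<epsilon> * (lam * h) + 2 * (lam * h)\<^sup>2) + 2 * (lam * \<delta> + exp (- (\<beta> * k))) * (lam * h)"
proof -
  define q where "q x = 1 - exp (- x)" for x :: real
  define B where "B t = first t h (\<lambda>p. q (y * p))" for t
  \<comment> \<open>\<open>U\<close> is the contribution of the jumps up to \<open>t\<close>, and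
    \<open>V\<close> that of all jumps up to \<open>t + h\<close>; both are seen at time
    \<open>t + h\<close>.\<close>
  define U where "U = shot (\<lambda>u. w (h + u)) t"
  define V where "V = shot w (t + h)"
  define D where "D t = expectation (\<lambda>\<omega>. of_bool (N t \<omega> = 0) * q (shot w (t + h) \<omega>))" for t
  define \<chi>h where "\<chi>h = expectation (\<lambda>\<omega>. exp (- shot w h \<omega>))"
  define \<chi>t where "\<chi>t = expectation (\<lambda>\<omega>. exp (- U \<omega>))"
  define s where "s = max 0 (t - \<delta>)"
  have s: "0 \<le> s" "s \<le> t" "t - s \<le> \<delta>" using \<delta> t by (auto simp: s_def)
  define err where "err = 2 * \<epsilon> * (lam * h) + 2 * (lam * h)\<^sup>2"
  define \<kappa> where "\<kappa> = lam * \<delta> + exp (- (\<beta> * k))"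
  have [measurable]: "q \<in> borel_measurable borel" unfolding q_def by measurable
  have q: "\<bar>q x\<bar> \<le> 1" "0 \<le> q x" if "0 \<le> x" for x using that by (auto simp: q_def abs_if)
  \<comment> \<open>The bound is uniform in the mark: since \<open>w u\<close> is at least
    \<open>y / 2\<close>, the difference is at most
    \<open>\<epsilon> * y * p * exp (- (y / 2 * p))\<close>, and \<open>v * exp (- v)\<close> never
    exceeds 1.\<close>
  have q_diff: "\<bar>q (w u * p) - q (y * p)\<bar> \<le> 2 * \<epsilon>" if "0 \<le> u" "u \<le> h" "k \<le> p" for u p
  proof -
    have p: "0 < p" using that k_pos by simp
    have wy: "\<bar>w u - y\<bar> \<le> \<epsilon> * y" using y(4) that by blast
    then have lower: "y / 2 \<le> w u" using mult_right_mono[OF y(3), of y] y(1) by linarith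
    have lip: "\<bar>exp (- v) - exp (- v')\<bar> \<le> \<bar>v - v'\<bar> * exp (- m)" if "m \<le> v" "m \<le> v'" for v v' m :: real
    proof -
      have *: "exp (- v) - exp (- v') \<le> (v' - v) * exp (- m) \<and> 0 \<le> exp (- v) - exp (- v')"
        if "m \<le> v" "v \<le> v'" for v v' :: real
      proof -
        have "exp (- v) - exp (- v') = exp (- v) * (1 - exp (- (v' - v)))"
          by (simp add: algebra_simps flip: exp_add)
        also have "\<dots> \<le> exp (- m) * (v' - v)"
        proof (rule mult_mono)
          show "1 - exp (- (v' - v)) \<le> v' - v"
            using exp_ge_add_one_self[of "- (v' - v)"] by linarith
        qed (use that in auto)
        finally show ?thesis using that by (simp add: mult.commute)
      qed
      show ?thesis using *[of v v'] *[of v' v] that by (cases "v \<le> v'") auto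
    qed
    have "\<bar>q (w u * p) - q (y * p)\<bar> = \<bar>exp (- (w u * p)) - exp (- (y * p))\<bar>"
      by (simp add: q_def)
    also have "\<dots> \<le> \<bar>w u * p - y * p\<bar> * exp (- (y / 2 * p))"
      using lower p y(1) by (intro lip mult_right_mono) auto
    also have "\<bar>w u * p - y * p\<bar> = \<bar>w u - y\<bar> * p" using p by (simp add: abs_mult flip: left_diff_distrib)
    also have "\<bar>w u - y\<bar> * p * exp (- (y / 2 * p)) \<le> \<epsilon> * y * p * exp (- (y / 2 * p))"
      using wy p by (intro mult_right_mono) auto
    also have "\<dots> = 2 * \<epsilon> * (y / 2 * p * exp (- (y / 2 * p)))" by simp
    also have "\<dots> \<le> 2 * \<epsilon> * 1"
      using exp_ge_add_one_self[of "y / 2 * p"] y(2)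
      by (intro mult_left_mono) (simp_all add: exp_minus divide_simps)
    finally show ?thesis by simp
  qed
  have near: "\<bar>D t - B t\<bar> \<le> err" if "0 \<le> t" for t
  proof -
    have "\<bar>D t - B t\<bar> \<le> first t h (\<lambda>_. 2 * \<epsilon>) + 2 * 1 * (lam * h)\<^sup>2"
      unfolding D_def B_def using that t q_diff y(1) w0 q
      by (intro shot_first_jump[of w q "\<lambda>_. 2 * \<epsilon>" y 1 h "2 * \<epsilon>" t]) (auto simp: q_def)
    also have "first t h (\<lambda>_. 2 * \<epsilon>) \<le> 2 * \<epsilon> * (lam * h)"
      using first_bound[of "\<lambda>_. 2 * \<epsilon>" "2 * \<epsilon>" t h] y(2) that t by simp
    finally show ?thesis by (simp add: err_def)
  qed
  have D0: "D 0 = 1 - \<chi>h"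
  proof -
    have "D 0 = expectation (\<lambda>\<omega>. 1 - exp (- shot w h \<omega>))"
      unfolding D_def
    proof (rule integral_cong_AE)
      show "AE \<omega> in M. of_bool (N 0 \<omega> = 0) * q (shot w (0 + h) \<omega>) = 1 - exp (- shot w h \<omega>)"
        using AE_N_0 by eventually_elim (simp add: q_def)
    qed (use shot_measurable[of w h] indicator_event_measurable[of 0 0 "\<lambda>i j. i = 0"] t in auto)
    then show ?thesis using exp_shot_integrable[of w h] w0 t by (simp add: \<chi>h_def prob_space)
  qed
  have wh: "(\<lambda>u. w (h + u)) \<in> borel_measurable borel" by measurable
  have intU: "integrable M (\<lambda>\<omega>. exp (- U \<omega>))"
    unfolding U_def using w0 t by (intro exp_shot_integrable wh) auto
  have intV: "integrable M (\<lambda>\<omega>. exp (- V \<omega>))"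
    unfolding V_def using w0 t by (intro exp_shot_integrable) auto
  have AE_V: "AE \<omega> in M. 0 \<le> V \<omega>" unfolding V_def using t w0 by (intro AE_shot_nonneg) auto
  have intD: "integrable M (\<lambda>\<omega>. of_bool (N t \<omega> = 0) * q (V \<omega>))"
  proof (rule integrable_bounded)
    show "AE \<omega> in M. \<bar>of_bool (N t \<omega> = 0) * q (V \<omega>)\<bar> \<le> 1"
      using AE_V by eventually_elim (use q in auto)
    show "(\<lambda>\<omega>. of_bool (N t \<omega> = 0) * q (V \<omega>)) \<in> borel_measurable M"
      using shot_measurable[of w "t + h"] indicator_event_measurable[of t t "\<lambda>i j. i = 0"] t
      by (auto simp: V_def)
  qed
  have old: "AE \<omega> in M. 0 \<le> U \<omega> \<and> (N t \<omega> = 0 \<longrightarrow> U \<omega> = 0) \<and> (N (t + h) \<omega> = N t \<omega> \<longrightarrow> V \<omega> = U \<omega>)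
      \<and> U \<omega> \<le> V \<omega> \<and> (N t \<omega> \<noteq> 0 \<and> \<not> N s \<omega> < N t \<omega> \<longrightarrow> \<beta> * k \<le> U \<omega>)"
    using AE_paths AE_N_mono
  proof eventually_elim
    case (elim \<omega>)
    have paths: "n \<le> N u \<omega> \<longleftrightarrow> T n \<omega> \<le> u" if "1 \<le> n" "0 \<le> u" for n u
      using elim(1) that by blast
    have TP: "0 < T n \<omega>" "k \<le> P n \<omega>" if "1 \<le> n" for n
      using elim(1) that by blast+
    have mono: "N u \<omega> \<le> N v \<omega>" if "0 \<le> u" "u \<le> v" for u v
      using elim(2) that by blast
    have U: "U \<omega> = (\<Sum>n = 1..N t \<omega>. w (t + h - T n \<omega>) * P n \<omega>)"
      by (simp add: U_def shot_def algebra_simps)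
    have V: "V \<omega> = (\<Sum>n = 1..N (t + h) \<omega>. w (t + h - T n \<omega>) * P n \<omega>)"
      by (simp add: V_def shot_def)
    have nonneg: "0 \<le> w (t + h - T n \<omega>) * P n \<omega>" if "n \<in> {1..N (t + h) \<omega>}" for n
    proof (rule mult_nonneg_nonneg)
      have "T n \<omega> \<le> t + h" using paths[of n "t + h"] that t by simp
      then show "0 \<le> w (t + h - T n \<omega>)" using w0 by simp
      show "0 \<le> P n \<omega>" using TP(2)[of n] that k_pos by simp
    qed
    have NN: "N t \<omega> \<le> N (t + h) \<omega>" using mono t by simp
    have "0 \<le> U \<omega>" unfolding U using NN by (intro sum_nonneg nonneg) auto
    moreover have "U \<omega> \<le> V \<omega>" unfolding U V using NN by (intro sum_mono2 nonneg) auto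
    moreover have "\<beta> * k \<le> U \<omega>" if N: "N t \<omega> \<noteq> 0" "\<not> N s \<omega> < N t \<omega>"
    proof -
      \<comment> \<open>Some jump occurred by time \<open>s\<close>. As jump times are positive,
        \<open>s\<close> is not 0, hence \<open>s = t - \<delta>\<close>; the age of that jump at
        time \<open>t + h\<close> lies between \<open>\<delta>\<close> and 2, where the kernel is at
        least \<open>\<beta>\<close>.\<close>
      have "1 \<le> N s \<omega>" using N by simp
      then have T1: "T 1 \<omega> \<le> s" using paths[of 1 s] s by simp
      with TP(1)[of 1] have "0 < s" by simp
      then have "s = t - \<delta>" by (simp add: s_def max_def split: if_splits)
      then have "\<beta> \<le> w (t + h - T 1 \<omega>)" using T1 TP(1)[of 1] t by (intro \<beta>) auto
      then have "\<beta> * k \<le> w (t + h - T 1 \<omega>) * P 1 \<omega>"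
        using TP(2)[of 1] \<beta>(1) k_pos by (intro mult_mono) auto
      also have "\<dots> \<le> U \<omega>" unfolding U using N NN
        by (intro member_le_sum[of 1 "{1..N t \<omega>}" "\<lambda>n. w (t + h - T n \<omega>) * P n \<omega>"] nonneg) auto
      finally show ?thesis .
    qed
    ultimately show ?case using U V by auto
  qed
  \<comment> \<open>The cocycle identity enters here: it splits the expectation of
    \<open>exp (- V)\<close> into \<open>\<chi>h * \<chi>t\<close>.\<close>
  have "\<chi>t * (1 - \<chi>h) = expectation (\<lambda>\<omega>. exp (- U \<omega>) - exp (- V \<omega>))"
    using cocycle intU intV by (simp add: \<chi>t_def \<chi>h_def U_def V_def algebra_simps)
  \<comment> \<open>With no jump up to \<open>t\<close> the integrands agree, and with none in (t, t
    + h] both vanish. The rest requires a jump in (t, t + h] together with either a jump in (s, t]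
    or the small factor \<open>exp (- (\<beta> * k))\<close>.\<close>
  have DX: "\<bar>\<chi>t * (1 - \<chi>h) - D t\<bar> \<le> \<kappa> * (lam * h)"
  proof -
    have "\<bar>\<chi>t * (1 - \<chi>h) - D t\<bar>
        = \<bar>expectation (\<lambda>\<omega>. exp (- U \<omega>) - exp (- V \<omega>) - of_bool (N t \<omega> = 0) * q (V \<omega>))\<bar>"
      using intU intV intD \<open>\<chi>t * (1 - \<chi>h) = _\<close> by (simp add: D_def V_def)
    also have "\<dots> \<le> expectation (\<lambda>\<omega>. \<bar>exp (- U \<omega>) - exp (- V \<omega>) - of_bool (N t \<omega> = 0) * q (V \<omega>)\<bar>)"
      by (rule integral_abs_bound)
    also have "\<dots> \<le> expectation (\<lambda>\<omega>. of_bool (N s \<omega> < N t \<omega>) * of_bool (N t \<omega> < N (t + h) \<omega>)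
        + exp (- (\<beta> * k)) * of_bool (N t \<omega> < N (t + h) \<omega>))"
    proof (rule integral_mono_AE)
      show "integrable M (\<lambda>\<omega>. of_bool (N s \<omega> < N t \<omega>) * of_bool (N t \<omega> < N (t + h) \<omega>)
          + exp (- (\<beta> * k)) * of_bool (N t \<omega> < N (t + h) \<omega>))"
        using indicator_event_measurable[of s t "(<)"] indicator_event_measurable[of t "t + h" "(<)"] s t
        by (intro integrable_bounded[of _ "1 + exp (- (\<beta> * k))"]) (auto intro!: AE_I2)
      show "AE \<omega> in M. \<bar>exp (- U \<omega>) - exp (- V \<omega>) - of_bool (N t \<omega> = 0) * q (V \<omega>)\<bar>
          \<le> of_bool (N s \<omega> < N t \<omega>) * of_bool (N t \<omega> < N (t + h) \<omega>)
            + exp (- (\<beta> * k)) * of_bool (N t \<omega> < N (t + h) \<omega>)"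
        using old AE_N_mono
      proof eventually_elim
        case (elim \<omega>)
        then have mono: "N t \<omega> \<le> N (t + h) \<omega>" using t by simp
        have e: "0 \<le> exp (- U \<omega>) - exp (- V \<omega>)" "exp (- U \<omega>) - exp (- V \<omega>) \<le> exp (- U \<omega>)" "exp (- U \<omega>) \<le> 1"
          using elim(1) by auto
        consider "N t \<omega> = 0" | "N t \<omega> = N (t + h) \<omega>" "N t \<omega> \<noteq> 0"
          | "N t \<omega> \<noteq> 0" "N t \<omega> < N (t + h) \<omega>" "N s \<omega> < N t \<omega>"
          | "N t \<omega> \<noteq> 0" "N t \<omega> < N (t + h) \<omega>" "\<not> N s \<omega> < N t \<omega>" using mono by linarith
        then show ?case
        proof cases
          case 1
          then show ?thesis using elim(1) by (simp add: q_def)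
        next
          case 2
          then show ?thesis using elim(1) by simp
        next
          case 3
          moreover have "exp (- U \<omega>) - exp (- V \<omega>) \<le> 1 + exp (- (\<beta> * k))"
            using e exp_gt_zero[of "- (\<beta> * k)"] by linarith
          ultimately show ?thesis using e by simp
        next
          case 4
          then have "exp (- U \<omega>) \<le> exp (- (\<beta> * k))" using elim(1) by simp
          then have "exp (- U \<omega>) - exp (- V \<omega>) \<le> exp (- (\<beta> * k))" using e by linarith
          then show ?thesis using 4 e by simp
        qed
      qed
    qed (use intU intV intD in auto)
    also have "\<dots> = prob {\<omega> \<in> space M. N s \<omega> < N t \<omega> \<and> N t \<omega> < N (t + h) \<omega>}
        + exp (- (\<beta> * k)) * prob {\<omega> \<in> space M. N t \<omega> < N (t + h) \<omega>}"
    proof -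
      have E: "{\<omega> \<in> space M. N s \<omega> < N t \<omega> \<and> N t \<omega> < N (t + h) \<omega>}
          = {\<omega> \<in> space M. N s \<omega> < N t \<omega>} \<inter> {\<omega> \<in> space M. N t \<omega> < N (t + h) \<omega>}" by auto
      have E': "{\<omega> \<in> space M. N s \<omega> < N t \<omega> \<and> N t \<omega> < N (t + h) \<omega>} \<in> sets M"
        unfolding E using N_measurable_pred[of s t "(<)"] N_measurable_pred[of t "t + h" "(<)"] s t by auto
      have "expectation (\<lambda>\<omega>. of_bool (N s \<omega> < N t \<omega>) * of_bool (N t \<omega> < N (t + h) \<omega>) :: real)
          = expectation (indicator {\<omega> \<in> space M. N s \<omega> < N t \<omega> \<and> N t \<omega> < N (t + h) \<omega>})"
        by (intro Bochner_Integration.integral_cong) (auto simp: indicator_def)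
      moreover have "integrable M (\<lambda>\<omega>. of_bool (N s \<omega> < N t \<omega>) * of_bool (N t \<omega> < N (t + h) \<omega>) :: real)"
        using indicator_event_measurable[of s t "(<)"] indicator_event_measurable[of t "t + h" "(<)"] s t
        by (intro integrable_bounded[of _ 1]) (auto intro!: AE_I2)
      ultimately show ?thesis
        using E' of_bool_integrable[of t "t + h" "(<)"] expectation_of_bool[of t "t + h" "(<)"] t by simp
    qed
    also have "\<dots> \<le> lam * \<delta> * (lam * h) + exp (- (\<beta> * k)) * (lam * h)"
    proof (intro add_mono mult_left_mono)
      show "prob {\<omega> \<in> space M. N s \<omega> < N t \<omega> \<and> N t \<omega> < N (t + h) \<omega>} \<le> lam * \<delta> * (lam * h)"
      proof (cases "s < t")
        case True
        then have "prob {\<omega> \<in> space M. N s \<omega> < N t \<omega> \<and> N t \<omega> < N (t + h) \<omega>} \<le> lam * (t - s) * (lam * h)"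
          using prob_consecutive_jumps[of s t "t + h"] s t by simp
        also have "\<dots> \<le> lam * \<delta> * (lam * h)"
          using s lam_pos t by (intro mult_right_mono mult_left_mono) auto
        finally show ?thesis .
      next
        case False
        then show ?thesis using s lam_pos \<delta> t by simp
      qed
      show "prob {\<omega> \<in> space M. N t \<omega> < N (t + h) \<omega>} \<le> lam * h"
        using prob_jump_le[of t "t + h"] t by simp
    qed auto
    finally show ?thesis by (simp add: \<kappa>_def algebra_simps)
  qed
  have \<chi>t: "0 \<le> \<chi>t" "\<chi>t \<le> 1"
  proof -
    show "0 \<le> \<chi>t" unfolding \<chi>t_def by (rule integral_nonneg_AE) auto
    have "\<chi>t \<le> expectation (\<lambda>_. 1)"
      unfolding \<chi>t_def
    proof (rule integral_mono_AE[OF intU])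
      show "AE \<omega> in M. exp (- U \<omega>) \<le> 1" using old by eventually_elim auto
    qed auto
    then show "\<chi>t \<le> 1" by (simp add: prob_space)
  qed
  \<comment> \<open>Up to the same two effects, \<open>exp (- U)\<close> is the indicator of no jump
    up to \<open>t\<close>.\<close>
  have \<chi>t_lim: "\<bar>\<chi>t - exp (- (lam * t))\<bar> \<le> \<kappa>"
  proof -
    have "exp (- (lam * t)) = expectation (\<lambda>\<omega>. of_bool (N t \<omega> = 0))"
      using expectation_of_bool[of t t "\<lambda>i j. i = 0"] prob_N_eq_0 t by simp
    then have "\<bar>\<chi>t - exp (- (lam * t))\<bar> = \<bar>expectation (\<lambda>\<omega>. exp (- U \<omega>) - of_bool (N t \<omega> = 0))\<bar>"
      using intU of_bool_integrable[of t t "\<lambda>i j. i = 0"] t by (simp add: \<chi>t_def)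
    also have "\<dots> \<le> expectation (\<lambda>\<omega>. \<bar>exp (- U \<omega>) - of_bool (N t \<omega> = 0)\<bar>)"
      by (rule integral_abs_bound)
    also have "\<dots> \<le> expectation (\<lambda>\<omega>. of_bool (N s \<omega> < N t \<omega>) + exp (- (\<beta> * k)))"
    proof (rule integral_mono_AE)
      show "AE \<omega> in M. \<bar>exp (- U \<omega>) - of_bool (N t \<omega> = 0)\<bar> \<le> of_bool (N s \<omega> < N t \<omega>) + exp (- (\<beta> * k))"
        using old
      proof eventually_elim
        case (elim \<omega>)
        have "\<bar>exp (- U \<omega>)\<bar> \<le> 1" using elim by simp
        moreover have "exp (- U \<omega>) \<le> exp (- (\<beta> * k))" if "N t \<omega> \<noteq> 0" "\<not> N s \<omega> < N t \<omega>"
          using elim that by simp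
        ultimately show ?case using elim by (cases "N t \<omega> = 0"; cases "N s \<omega> < N t \<omega>") (auto intro: add_increasing2)
      qed
    qed (use intU of_bool_integrable[of t t "\<lambda>i j. i = 0"] of_bool_integrable[of s t "(<)"] s t in auto)
    also have "\<dots> = prob {\<omega> \<in> space M. N s \<omega> < N t \<omega>} + exp (- (\<beta> * k))"
      using of_bool_integrable[of s t "(<)"] expectation_of_bool[of s t "(<)"] s t by (simp add: prob_space)
    also have "\<dots> \<le> \<kappa>"
    proof -
      have "lam * (t - s) \<le> lam * \<delta>" using s(3) lam_pos by (intro mult_left_mono) auto
      then show ?thesis using prob_jump_le[OF s(1,2)] unfolding \<kappa>_def by linarith
    qed
    finally show ?thesis .
  qed
  have \<kappa>0: "0 \<le> \<kappa>" using lam_pos \<delta> by (simp add: \<kappa>_def add_nonneg_nonneg)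
  have B0: "\<bar>B 0\<bar> \<le> lam * h"
    unfolding B_def using first_bound[of "\<lambda>p. q (y * p)" 1 0 h] q y(1) k_pos t by simp
  have "\<bar>\<chi>t * (1 - \<chi>h) - \<chi>t * B 0\<bar> = \<chi>t * \<bar>D 0 - B 0\<bar>"
    using \<chi>t by (simp add: D0 abs_mult flip: right_diff_distrib)
  also have "\<dots> \<le> 1 * err" using \<chi>t near[of 0] by (intro mult_mono) auto
  finally have c: "\<bar>\<chi>t * (1 - \<chi>h) - \<chi>t * B 0\<bar> \<le> err" by simp
  have "\<bar>\<chi>t * B 0 - exp (- (lam * t)) * B 0\<bar> = \<bar>\<chi>t - exp (- (lam * t))\<bar> * \<bar>B 0\<bar>"
    by (simp add: abs_mult flip: left_diff_distrib)
  also have "\<dots> \<le> \<kappa> * (lam * h)" using \<chi>t_lim B0 \<kappa>0 by (intro mult_mono) auto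
  finally have d: "\<bar>\<chi>t * B 0 - exp (- (lam * t)) * B 0\<bar> \<le> \<kappa> * (lam * h)" .
  \<comment> \<open>The chain runs from \<open>B t\<close> over \<open>D t\<close>,
    \<open>\<chi>t * (1 - \<chi>h) = \<chi>t * D 0\<close> and \<open>\<chi>t * B 0\<close> to
    \<open>exp (- (lam * t)) * B 0\<close>: two steps cost \<open>err\<close>, two cost
    \<open>\<kappa> * (lam * h)\<close>.\<close>
  have "\<bar>B t - exp (- (lam * t)) * B 0\<bar> \<le> 2 * err + 2 * \<kappa> * (lam * h)"
    using near[OF t(1)] DX c d by linarith
  then show ?thesis by (simp add: B_def q_def err_def \<kappa>_def)
qed

end

section \<open>Homogeneity of the first jump and the law of its mark\<close>

context marked_poisson
begin

text \<open>The kernel \<open>c * b + y * \<rho>\<close> equals \<open>y\<close> at age 0 whatever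
  \<open>c\<close> is, because \<open>b 0 = 0\<close>; beyond age \<open>\<delta>\<close> it can be
  made as large as desired through \<open>c\<close>. Hence both requirements of
  \<open>first_shift_estimate\<close> can be met at once.\<close>

lemma first_shift_limit:
  assumes b: "continuous_on UNIV b" "b 0 = 0" "\<And>u. 0 < u \<Longrightarrow> 0 < b u"
    and \<rho>: "continuous_on UNIV \<rho>" "\<rho> 0 = 1" "\<And>u. 0 \<le> u \<Longrightarrow> 0 \<le> \<rho> u"
    and y: "0 < y" and \<epsilon>: "0 < \<epsilon>"
    and cocycle: "\<And>c t h. 0 \<le> c \<Longrightarrow> 0 \<le> t \<Longrightarrow> 0 < h \<Longrightarrow>
      expectation (\<lambda>\<omega>. exp (- shot (\<lambda>u. c * b u + y * \<rho> u) (t + h) \<omega>))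
      = expectation (\<lambda>\<omega>. exp (- shot (\<lambda>u. c * b u + y * \<rho> u) h \<omega>))
        * expectation (\<lambda>\<omega>. exp (- shot (\<lambda>u. c * b (h + u) + y * \<rho> (h + u)) t \<omega>))"
  shows "\<exists>h0>0. \<forall>h t. 0 < h \<longrightarrow> h \<le> h0 \<longrightarrow> 0 \<le> t \<longrightarrow> t \<le> 1 \<longrightarrow>
    \<bar>first t h (\<lambda>p. 1 - exp (- (y * p))) - exp (- (lam * t)) * first 0 h (\<lambda>p. 1 - exp (- (y * p)))\<bar> \<le> \<epsilon> * h"
proof -
  \<comment> \<open>The four error terms get \<open>\<epsilon> * h / 4\<close> each. The order
    matters: \<open>c\<close> depends on the minimum of \<open>b\<close> over [\<delta>, 2], and
    \<open>h0\<close> on the modulus of continuity of the kernel, hence on \<open>c\<close>.\<close>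
  define \<delta> where "\<delta> = min 1 (\<epsilon> / (8 * lam\<^sup>2))"
  have \<delta>: "0 < \<delta>" "\<delta> \<le> 1" "\<delta> \<le> \<epsilon> / (8 * lam\<^sup>2)" using \<epsilon> lam_pos by (auto simp: \<delta>_def)
  obtain u0 where u0: "u0 \<in> {\<delta>..2}" "\<And>u. u \<in> {\<delta>..2} \<Longrightarrow> b u0 \<le> b u"
    using continuous_attains_inf[of "{\<delta>..2}" b] continuous_on_subset[OF b(1)] \<delta> by auto
  have b0: "0 < b u0" using u0 \<delta> by (intro b) auto
  \<comment> \<open>Makes \<open>exp (- (c * b u0 * k))\<close> at most
    \<open>\<epsilon> / (8 * lam)\<close>; the absolute value keeps \<open>c\<close> nonnegative
    when \<open>\<epsilon>\<close> is large.\<close>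
  define c where "c = \<bar>ln (\<epsilon> / (8 * lam))\<bar> / (b u0 * k)"
  have c: "0 \<le> c" using b0 k_pos by (simp add: c_def)
  have "exp (- (c * b u0 * k)) \<le> exp (ln (\<epsilon> / (8 * lam)))"
    using b0 k_pos by (simp add: c_def)
  then have ec: "exp (- (c * b u0 * k)) \<le> \<epsilon> / (8 * lam)" using \<epsilon> lam_pos by simp
  define \<epsilon>' where "\<epsilon>' = min (1 / 2) (\<epsilon> / (16 * lam))"
  have \<epsilon>': "0 < \<epsilon>'" "\<epsilon>' \<le> 1 / 2" "\<epsilon>' \<le> \<epsilon> / (16 * lam)" using \<epsilon> lam_pos by (auto simp: \<epsilon>'_def)
  define w where "w u = c * b u + y * \<rho> u" for u
  have w_cont: "continuous_on UNIV w"
    unfolding w_def using b(1) \<rho>(1) by (intro continuous_intros)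
  then have w_meas: "w \<in> borel_measurable borel" by (rule borel_measurable_continuous_onI)
  have b_nonneg: "0 \<le> b u" if "0 \<le> u" for u using b(2) b(3)[of u] that by (cases "u = 0") auto
  have w0: "0 \<le> w u" if "0 \<le> u" for u using b_nonneg[OF that] \<rho>(3)[OF that] c y by (simp add: w_def)
  have "\<exists>d>0. \<forall>u. dist u 0 < d \<longrightarrow> dist (w u) (w 0) < \<epsilon>' * y"
    using w_cont[unfolded continuous_on_iff, rule_format, of 0 "\<epsilon>' * y"] \<epsilon>' y by simp
  then obtain d where d: "0 < d" "\<And>u. \<bar>u\<bar> < d \<Longrightarrow> \<bar>w u - y\<bar> < \<epsilon>' * y"
    by (auto simp: dist_real_def w_def b(2) \<rho>(2))
  define h0 where "h0 = min (min 1 (d / 2)) (\<epsilon> / (16 * lam\<^sup>2))"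
  have h0: "0 < h0" "h0 \<le> 1" "h0 < d" "h0 \<le> \<epsilon> / (16 * lam\<^sup>2)" using d \<epsilon> lam_pos by (auto simp: h0_def)
  have "\<bar>first t h (\<lambda>p. 1 - exp (- (y * p))) - exp (- (lam * t)) * first 0 h (\<lambda>p. 1 - exp (- (y * p)))\<bar> \<le> \<epsilon> * h"
    if h: "0 < h" "h \<le> h0" and t: "0 \<le> t" "t \<le> 1" for h t
  proof -
    have "\<bar>first t h (\<lambda>p. 1 - exp (- (y * p))) - exp (- (lam * t)) * first 0 h (\<lambda>p. 1 - exp (- (y * p)))\<bar>
        \<le> 2 * (2 * \<epsilon>' * (lam * h) + 2 * (lam * h)\<^sup>2) + 2 * (lam * \<delta> + exp (- (c * b u0 * k))) * (lam * h)"
    proof (rule first_shift_estimate[OF w_meas w0 \<delta>(1)])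
      show "c * b u0 \<le> w u" if "\<delta> \<le> u" "u \<le> 2" for u
      proof -
        have "b u0 \<le> b u" using u0 that by simp
        then have "c * b u0 \<le> c * b u" using c by (rule mult_left_mono)
        moreover have "0 \<le> y * \<rho> u" using \<rho>(3)[of u] y \<delta> that by simp
        ultimately show ?thesis by (simp add: w_def)
      qed
      show "\<bar>w u - y\<bar> \<le> \<epsilon>' * y" if "0 \<le> u" "u \<le> h" for u using d(2)[of u] that h h0 by simp
      show "expectation (\<lambda>\<omega>. exp (- shot w (t + h) \<omega>))
          = expectation (\<lambda>\<omega>. exp (- shot w h \<omega>)) * expectation (\<lambda>\<omega>. exp (- shot (\<lambda>u. w (h + u)) t \<omega>))"
        using cocycle[OF c t(1) h(1)] by (simp add: w_def[abs_def])
    qed (use c b0 y \<epsilon>' t h h0 in auto)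
    also have "\<dots> = h * (4 * (\<epsilon>' * lam) + 4 * (lam\<^sup>2 * h) + 2 * (lam\<^sup>2 * \<delta>) + 2 * (exp (- (c * b u0 * k)) * lam))"
      by (simp add: algebra_simps power2_eq_square)
    also have "\<dots> \<le> h * (4 * (\<epsilon> / 16) + 4 * (\<epsilon> / 16) + 2 * (\<epsilon> / 8) + 2 * (\<epsilon> / 8))"
    proof -
      have "\<epsilon>' * lam \<le> \<epsilon> / 16" using \<epsilon>'(3) lam_pos by (simp add: field_simps)
      moreover have "lam\<^sup>2 * h \<le> \<epsilon> / 16"
      proof -
        have "h \<le> \<epsilon> / (16 * lam\<^sup>2)" using h h0 by simp
        then show ?thesis using lam_pos by (simp add: field_simps)
      qed
      moreover have "lam\<^sup>2 * \<delta> \<le> \<epsilon> / 8" using \<delta>(3) lam_pos by (simp add: field_simps)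
      moreover have "exp (- (c * b u0 * k)) * lam \<le> \<epsilon> / 8" using ec lam_pos by (simp add: field_simps)
      ultimately show ?thesis using h by (intro mult_left_mono) linarith+
    qed
    also have "\<dots> = \<epsilon> * h" by simp
    finally show ?thesis .
  qed
  then show ?thesis using h0(1) by blast
qed

text \<open>The first jump before time 1 falls into exactly one subinterval: each indicator is a
  difference of successive indicators of no jump so far.\<close>

lemma first_jump_telescope:
  assumes q: "q \<in> borel_measurable borel" "\<And>p. k \<le> p \<Longrightarrow> \<bar>q p\<bar> \<le> C" and m: "0 < m"
  shows "(\<Sum>i<m. first (real i / real m) (1 / real m) q) = expectation (\<lambda>\<omega>. of_bool (0 < N 1 \<omega>) * q (P 1 \<omega>))"
proof -
  have step: "real i / real m + 1 / real m = real (Suc i) / real m" for i by (simp add: add_divide_distrib)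
  have "(\<Sum>i<m. first (real i / real m) (1 / real m) q)
      = expectation (\<lambda>\<omega>. \<Sum>i<m. of_bool (N (real i / real m) \<omega> = 0
          \<and> N (real i / real m) \<omega> < N (real i / real m + 1 / real m) \<omega>) * q (P 1 \<omega>))"
    unfolding first_def
    by (intro Bochner_Integration.integral_sum[symmetric] first_integrable[OF q]) auto
  also have "\<dots> = expectation (\<lambda>\<omega>. of_bool (0 < N 1 \<omega>) * q (P 1 \<omega>))"
  proof (rule integral_cong_AE)
    show "AE \<omega> in M. (\<Sum>i<m. of_bool (N (real i / real m) \<omega> = 0
          \<and> N (real i / real m) \<omega> < N (real i / real m + 1 / real m) \<omega>) * q (P 1 \<omega>))
        = of_bool (0 < N 1 \<omega>) * q (P 1 \<omega>)"
      using AE_N_mono AE_N_0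
    proof eventually_elim
      case (elim \<omega>)
      have "of_bool (N (real i / real m) \<omega> = 0 \<and> N (real i / real m) \<omega> < N (real i / real m + 1 / real m) \<omega>)
          = (of_bool (N (real i / real m) \<omega> = 0) - of_bool (N (real (Suc i) / real m) \<omega> = 0) :: real)" for i
      proof -
        have "N (real i / real m) \<omega> \<le> N (real (Suc i) / real m) \<omega>"
          using elim(1) by (simp add: divide_right_mono)
        then show ?thesis unfolding step by auto
      qed
      then have "(\<Sum>i<m. of_bool (N (real i / real m) \<omega> = 0
          \<and> N (real i / real m) \<omega> < N (real i / real m + 1 / real m) \<omega>) * q (P 1 \<omega>))
        = (\<Sum>i<m. of_bool (N (real i / real m) \<omega> = 0) - of_bool (N (real (Suc i) / real m) \<omega> = 0)) * q (P 1 \<omega>)"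
        by (simp add: sum_distrib_right)
      also have "\<dots> = (of_bool (N 0 \<omega> = 0) - of_bool (N 1 \<omega> = 0)) * q (P 1 \<omega>)"
        using sum_lessThan_telescope'[of "\<lambda>i. of_bool (N (real i / real m) \<omega> = 0) :: real" m] m by simp
      finally show ?case using elim(2) by (auto simp: of_bool_def)
    qed
    show "(\<lambda>\<omega>. \<Sum>i<m. of_bool (N (real i / real m) \<omega> = 0
          \<and> N (real i / real m) \<omega> < N (real i / real m + 1 / real m) \<omega>) * q (P 1 \<omega>)) \<in> borel_measurable M"
      using first_integrable[OF q] by (intro borel_measurable_sum borel_measurable_integrable) auto
    show "(\<lambda>\<omega>. of_bool (0 < N 1 \<omega>) * q (P 1 \<omega>)) \<in> borel_measurable M"
      using indicator_event_measurable[of 1 1 "\<lambda>i j. 0 < i"] measurable_compose[OF P_measurable[of 1] q(1)]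
      by auto
  qed
  finally show ?thesis .
qed

text \<open>Homogeneity turns the \<open>m\<close> terms of the telescope into a geometric sum times
  the first one, while independence at time 1 evaluates the total. Each term is off by at most a
  multiple of \<open>1 / m\<close>, so the sum of the errors stays small.\<close>

lemma first_mark_Laplace:
  assumes b: "continuous_on UNIV b" "b 0 = 0" "\<And>u. 0 < u \<Longrightarrow> 0 < b u"
    and \<rho>: "continuous_on UNIV \<rho>" "\<rho> 0 = 1" "\<And>u. 0 \<le> u \<Longrightarrow> 0 \<le> \<rho> u"
    and y: "0 < y"
    and cocycle: "\<And>c t h. 0 \<le> c \<Longrightarrow> 0 \<le> t \<Longrightarrow> 0 < h \<Longrightarrow>
      expectation (\<lambda>\<omega>. exp (- shot (\<lambda>u. c * b u + y * \<rho> u) (t + h) \<omega>))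
      = expectation (\<lambda>\<omega>. exp (- shot (\<lambda>u. c * b u + y * \<rho> u) h \<omega>))
        * expectation (\<lambda>\<omega>. exp (- shot (\<lambda>u. c * b (h + u) + y * \<rho> (h + u)) t \<omega>))"
    and indep: "expectation (\<lambda>\<omega>. of_bool (0 < N 1 \<omega>) * (1 - exp (- (y * P 1 \<omega>))))
      = (1 - exp (- lam)) * expectation (\<lambda>\<omega>. 1 - exp (- (y * P 1 \<omega>)))"
  shows "(\<lambda>m. first 0 (1 / real m) (\<lambda>p. 1 - exp (- (y * p))) / (1 - exp (- (lam * (1 / real m)))))
    \<longlonglongrightarrow> expectation (\<lambda>\<omega>. 1 - exp (- (y * P 1 \<omega>)))"
proof -
  define q where "q p = 1 - exp (- (y * p))" for p :: real
  define p1 where "p1 = 1 - exp (- lam)"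
  define L where "L m = first 0 (1 / real m) q / (1 - exp (- (lam * (1 / real m))))" for m :: nat
  define E where "E = expectation (\<lambda>\<omega>. q (P 1 \<omega>))"
  have p1: "0 < p1" using lam_pos by (simp add: p1_def)
  have q: "q \<in> borel_measurable borel" "\<And>p. k \<le> p \<Longrightarrow> \<bar>q p\<bar> \<le> 1"
    using y k_pos by (auto simp: q_def[abs_def])
  have indep': "expectation (\<lambda>\<omega>. of_bool (0 < N 1 \<omega>) * q (P 1 \<omega>)) = p1 * E"
    using indep by (simp add: p1_def E_def q_def)
  have "(\<lambda>m. p1 * L m) \<longlonglongrightarrow> p1 * E"
  proof (rule LIMSEQ_I)
    fix e :: real assume "0 < e"
    then obtain h0 where h0: "0 < h0" "\<And>h t. 0 < h \<Longrightarrow> h \<le> h0 \<Longrightarrow> 0 \<le> t \<Longrightarrow> t \<le> 1 \<Longrightarrow>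
        \<bar>first t h q - exp (- (lam * t)) * first 0 h q\<bar> \<le> e / 2 * h"
      using first_shift_limit[OF b \<rho> y _ cocycle, of "e / 2"] unfolding q_def[symmetric] by auto
    obtain m0 :: nat where m0: "1 / h0 < real m0" using reals_Archimedean2 by blast
    have "norm (p1 * L m - p1 * E) < e" if "m0 \<le> m" for m
    proof -
      have "1 / h0 < real m" using m0 that by linarith
      then have m': "0 < m" using h0(1) by (intro Nat.gr0I) auto
      have "1 / real m \<le> h0" using \<open>1 / h0 < real m\<close> h0(1) m' by (simp add: field_simps)
      note m = m' this
      define r where "r = exp (- (lam * (1 / real m)))"
      have r: "r < 1" using lam_pos m by (simp add: r_def)
      \<comment> \<open>The geometric sum is P(jump in [0, 1]) over P(jump in [0, 1 / m]), which is
        exactly the normalisation in \<open>L\<close>.\<close>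
      have "r ^ m = exp (- lam)" using m by (simp add: r_def flip: exp_of_nat_mult)
      then have geo: "(\<Sum>i<m. r ^ i) = p1 / (1 - r)" using r by (simp add: sum_gp_strict p1_def)
      have ri: "exp (- (lam * (real i / real m))) = r ^ i" for i
        by (simp add: r_def flip: exp_of_nat_mult)
      have "p1 * L m = (\<Sum>i<m. r ^ i) * first 0 (1 / real m) q"
        unfolding geo by (simp add: L_def r_def)
      then have eq: "p1 * E - p1 * L m = (\<Sum>i<m. first (real i / real m) (1 / real m) q - r ^ i * first 0 (1 / real m) q)"
        using first_jump_telescope[OF q m(1), unfolded indep'] by (simp only: sum_distrib_right sum_subtractf)
      have "\<bar>p1 * E - p1 * L m\<bar> \<le> (\<Sum>i<m. e / 2 * (1 / real m))"
        unfolding eq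
      proof (rule order_trans[OF sum_abs sum_mono])
        fix i assume i: "i \<in> {..<m}"
        then have "real i / real m \<le> 1" by simp
        then show "\<bar>first (real i / real m) (1 / real m) q - r ^ i * first 0 (1 / real m) q\<bar> \<le> e / 2 * (1 / real m)"
          using h0(2)[of "1 / real m" "real i / real m"] m unfolding ri by simp
      qed
      also have "\<dots> = e / 2" using m by simp
      finally show ?thesis using \<open>0 < e\<close> unfolding real_norm_def by linarith
    qed
    then show "\<exists>m0. \<forall>m\<ge>m0. norm (p1 * L m - p1 * E) < e" by blast
  qed
  from tendsto_divide[OF this tendsto_const[of p1]] p1 have "L \<longlonglongrightarrow> E" by simp
  then show ?thesis unfolding L_def[abs_def] E_def q_def[abs_def] .
qed

lemma first_const: "0 \<le> h \<Longrightarrow> first 0 h (\<lambda>_. 1) = 1 - exp (- (lam * h))"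
proof -
  assume h: "0 \<le> h"
  have "first 0 h (\<lambda>_. 1) = expectation (\<lambda>\<omega>. of_bool (N 0 \<omega> < N (0 + h) \<omega>))"
    unfolding first_def
  proof (rule integral_cong_AE)
    show "AE \<omega> in M. of_bool (N 0 \<omega> = 0 \<and> N 0 \<omega> < N (0 + h) \<omega>) * 1 = (of_bool (N 0 \<omega> < N (0 + h) \<omega>) :: real)"
      using AE_N_0 by eventually_elim simp
  qed (use h indicator_event_measurable[of 0 "0 + h" "\<lambda>i j. i = 0 \<and> i < j"]
      indicator_event_measurable[of 0 "0 + h" "(<)"] in auto)
  then show ?thesis using expectation_of_bool[of 0 h "(<)"] prob_jump[of 0 h] h by simp
qed

lemma first_diff:
  assumes "q \<in> borel_measurable borel" "\<And>p. k \<le> p \<Longrightarrow> \<bar>q p\<bar> \<le> C"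
    and "q' \<in> borel_measurable borel" "\<And>p. k \<le> p \<Longrightarrow> \<bar>q' p\<bar> \<le> C'" and "0 \<le> t" "0 \<le> h"
  shows "first t h (\<lambda>p. q p - q' p) = first t h q - first t h q'"
  using first_integrable[OF assms(1,2,5,6)] first_integrable[OF assms(3-6)]
  by (simp add: first_def right_diff_distrib)

lemma mark_integrable:
  fixes q :: "real \<Rightarrow> real"
  assumes "q \<in> borel_measurable borel" "\<And>p. k \<le> p \<Longrightarrow> \<bar>q p\<bar> \<le> C"
  shows "integrable M (\<lambda>\<omega>. q (P 1 \<omega>))"
proof (rule integrable_bounded)
  show "AE \<omega> in M. \<bar>q (P 1 \<omega>)\<bar> \<le> C"
    using P_ge[OF order_refl] by eventually_elim (rule assms(2))
qed (use measurable_compose[OF P_measurable[of 1] assms(1)] in simp)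

lemma mark_expectation_abs_le:
  fixes q :: "real \<Rightarrow> real"
  assumes "q \<in> borel_measurable borel" "\<And>p. k \<le> p \<Longrightarrow> \<bar>q p\<bar> \<le> C"
  shows "\<bar>expectation (\<lambda>\<omega>. q (P 1 \<omega>))\<bar> \<le> C"
proof -
  have "\<bar>expectation (\<lambda>\<omega>. q (P 1 \<omega>))\<bar> \<le> expectation (\<lambda>\<omega>. \<bar>q (P 1 \<omega>)\<bar>)"
    by (rule integral_abs_bound)
  also have "\<dots> \<le> expectation (\<lambda>_. C)"
  proof (rule integral_mono_AE)
    show "AE \<omega> in M. \<bar>q (P 1 \<omega>)\<bar> \<le> C"
      using P_ge[OF order_refl] by eventually_elim (rule assms(2))
  qed (use mark_integrable[OF assms] in auto)
  finally show ?thesis by (simp add: prob_space)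
qed

text \<open>The substitution \<open>z = exp (- p)\<close> maps the half-line with its point at
  infinity onto [0, 1]; the limit \<open>l\<close> becomes the value at 0, and Stone-Weierstrass
  applies.\<close>

lemma exp_polynomial_approx:
  fixes q :: "real \<Rightarrow> real"
  assumes q: "continuous_on UNIV q" "(q \<longlongrightarrow> l) at_top" and \<epsilon>: "0 < \<epsilon>"
  shows "\<exists>a n. \<forall>p\<ge>0. \<bar>q p - (\<Sum>i\<le>n. a i * exp (- p) ^ i)\<bar> < \<epsilon>"
proof -
  define Q where "Q z = (if z \<le> 0 then l else q (- ln z))" for z :: real
  have pos: "isCont Q z" if "0 < z" for z
  proof -
    have "isCont (\<lambda>z. q (- ln z)) z"
      using that q(1) by (intro isCont_o2[of _ "\<lambda>z. - ln z" q] continuous_intros)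
        (auto simp: continuous_on_eq_continuous_at)
    moreover have "\<forall>\<^sub>F z in nhds z. Q z = q (- ln z)"
      using that eventually_nhds_in_open[of "{0<..}" z] by (auto simp: Q_def elim: eventually_mono)
    ultimately show ?thesis using isCont_cong[of Q "\<lambda>z. q (- ln z)" z] by simp
  qed
  have "(Q \<longlongrightarrow> l) (at_right 0)"
  proof (rule Lim_transform_eventually)
    have "filterlim (\<lambda>z::real. - ln z) at_top (at_right 0)"
      using ln_at_0 by (simp add: filterlim_uminus_at_bot)
    from filterlim_compose[OF q(2) this] show "((\<lambda>z. q (- ln z)) \<longlongrightarrow> l) (at_right 0)" .
    show "\<forall>\<^sub>F z in at_right 0. q (- ln z) = Q z"
      by (auto simp: Q_def eventually_at_right_field intro: exI[of _ 1])
  qed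
  moreover have "Q 0 = l" by (simp add: Q_def)
  ultimately have zero: "continuous (at 0 within {0..1}) Q"
    by (simp add: continuous_within at_within_Icc_at_right)
  have "continuous_on {0..1} Q"
    unfolding continuous_on_eq_continuous_within
  proof
    fix z :: real assume "z \<in> {0..1}"
    then show "continuous (at z within {0..1}) Q"
      using zero pos[of z] by (cases "z = 0") (auto intro: continuous_at_imp_continuous_at_within)
  qed
  from Stone_Weierstrass_real_polynomial_function[OF compact_Icc this \<epsilon>]
  obtain G where G: "real_polynomial_function G" "\<forall>z\<in>{0..1}. \<bar>Q z - G z\<bar> < \<epsilon>"
    by (metis)
  then obtain a n where an: "G = (\<lambda>x. \<Sum>i\<le>n. a i * x ^ i)"
    using real_polynomial_function_iff_sum by blast
  have approx: "\<bar>q p - (\<Sum>i\<le>n. a i * exp (- p) ^ i)\<bar> < \<epsilon>" if "0 \<le> p" for p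
    using bspec[OF G(2), of "exp (- p)"] that by (simp add: Q_def an)
  show ?thesis
    by (rule exI[where x = a], rule exI[where x = n], rule allI, rule impI, erule approx)
qed

text \<open>Convergence of Laplace transforms at the natural numbers suffices: polynomials in
  \<open>exp (- p)\<close> are uniformly dense, and both sides are contractive for the supremum norm
  over marks of size at least \<open>k\<close>.\<close>

lemma first_mark_law:
  assumes Laplace: "\<And>y. 0 < y \<Longrightarrow>
      (\<lambda>m. first 0 (1 / real m) (\<lambda>p. 1 - exp (- (y * p))) / (1 - exp (- (lam * (1 / real m)))))
        \<longlonglongrightarrow> expectation (\<lambda>\<omega>. 1 - exp (- (y * P 1 \<omega>)))"
    and q: "continuous_on UNIV q" "(q \<longlongrightarrow> l) at_top"
  shows "(\<lambda>m. first 0 (1 / real m) q / (1 - exp (- (lam * (1 / real m)))))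
    \<longlonglongrightarrow> expectation (\<lambda>\<omega>. q (P 1 \<omega>))"
proof (rule LIMSEQ_I)
  fix e :: real assume "0 < e"
  then have e3: "0 < e / 3" by simp
  obtain a n where approx: "\<forall>p\<ge>0. \<bar>q p - (\<Sum>i\<le>n. a i * exp (- p) ^ i)\<bar> < e / 3"
    using exp_polynomial_approx[OF q e3] by (elim exE)
  note an = approx[rule_format]
  define G where "G p = (\<Sum>i\<le>n. a i * exp (- p) ^ i)" for p :: real
  define pm where "pm m = 1 - exp (- (lam * (1 / real m)))" for m :: nat
  have pm: "0 < pm m" if "0 < m" for m using lam_pos that by (simp add: pm_def)
  have q_meas: "q \<in> borel_measurable borel" using q(1) by (rule borel_measurable_continuous_onI)
  have G_meas: "G \<in> borel_measurable borel" unfolding G_def by measurable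
  have ei: "\<bar>exp (- p) ^ i\<bar> \<le> 1" if "k \<le> p" for p i using that k_pos by (simp add: power_le_one)
  have G_bound: "\<bar>G p\<bar> \<le> (\<Sum>i\<le>n. \<bar>a i\<bar>)" if "k \<le> p" for p
    unfolding G_def
    using ei[OF that] by (intro order_trans[OF sum_abs] sum_mono) (simp add: abs_mult mult_left_le)
  have qG: "\<bar>q p - G p\<bar> \<le> e / 3" if "k \<le> p" for p using an[of p] that k_pos by (simp add: G_def)
  have q_bound: "\<bar>q p\<bar> \<le> (\<Sum>i\<le>n. \<bar>a i\<bar>) + e / 3" if "k \<le> p" for p
    using G_bound[OF that] qG[OF that] by linarith
  \<comment> \<open>Power \<open>i\<close> is the Laplace transform at \<open>i\<close>. The
    exponent 0, which \<open>Laplace\<close> excludes, is the normalised jump probability and equals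
    1.\<close>
  have powers: "(\<lambda>m. first 0 (1 / real m) (\<lambda>p. exp (- p) ^ i) / pm m) \<longlonglongrightarrow> expectation (\<lambda>\<omega>. exp (- P 1 \<omega>) ^ i)" for i
  proof (cases "i = 0")
    case True
    have "\<forall>\<^sub>F m in sequentially. first 0 (1 / real m) (\<lambda>p. exp (- p) ^ i) / pm m = 1"
      using eventually_gt_at_top[of "0::nat"]
    proof eventually_elim
      case (elim m)
      have "first 0 (1 / real m) (\<lambda>_. 1) = pm m" using first_const[of "1 / real m"] by (simp add: pm_def)
      then show ?case using pm[OF elim] True by simp
    qed
    then have "(\<lambda>m. first 0 (1 / real m) (\<lambda>p. exp (- p) ^ i) / pm m) \<longlonglongrightarrow> 1"
      by (rule tendsto_eventually)
    then show ?thesis using True by (simp add: prob_space)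
  next
    case False
    then have i: "0 < real i" by simp
    have pow: "exp (- p) ^ i = exp (- (real i * p))" for p :: real by (simp flip: exp_of_nat_mult)
    have c: "expectation (\<lambda>\<omega>. exp (- P 1 \<omega>) ^ i) = 1 - expectation (\<lambda>\<omega>. 1 - exp (- (real i * P 1 \<omega>)))"
    proof -
      have "integrable M (\<lambda>\<omega>. exp (- P 1 \<omega>) ^ i)"
        by (rule mark_integrable[of "\<lambda>p. exp (- p) ^ i" 1]) (use ei in auto)
      then show ?thesis unfolding pow by (simp add: prob_space)
    qed
    have "\<forall>\<^sub>F m in sequentially. 1 - first 0 (1 / real m) (\<lambda>p. 1 - exp (- (real i * p))) / pm m
        = first 0 (1 / real m) (\<lambda>p. exp (- p) ^ i) / pm m"
      using eventually_gt_at_top[of "0::nat"]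
    proof eventually_elim
      case (elim m)
      have "first 0 (1 / real m) (\<lambda>p. 1 - exp (- p) ^ i) = pm m - first 0 (1 / real m) (\<lambda>p. exp (- p) ^ i)"
        using first_diff[of "\<lambda>_. 1" 1 "\<lambda>p. exp (- p) ^ i" 1 0 "1 / real m"] ei first_const[of "1 / real m"]
        by (simp add: pm_def)
      then show ?case using pm[OF elim] by (simp add: pow field_simps)
    qed
    moreover have "(\<lambda>m. 1 - first 0 (1 / real m) (\<lambda>p. 1 - exp (- (real i * p))) / pm m)
        \<longlonglongrightarrow> 1 - expectation (\<lambda>\<omega>. 1 - exp (- (real i * P 1 \<omega>)))"
      unfolding pm_def by (intro tendsto_diff tendsto_const Laplace i)
    ultimately show ?thesis unfolding c by (rule Lim_transform_eventually[rotated])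
  qed
  have first_G: "first 0 (1 / real m) G = (\<Sum>i\<le>n. a i * first 0 (1 / real m) (\<lambda>p. exp (- p) ^ i))" for m
  proof -
    have "first 0 (1 / real m) G = expectation (\<lambda>\<omega>. \<Sum>i\<le>n. a i *
        (of_bool (N 0 \<omega> = 0 \<and> N 0 \<omega> < N (0 + 1 / real m) \<omega>) * exp (- P 1 \<omega>) ^ i))"
      unfolding first_def G_def sum_distrib_left
      by (intro Bochner_Integration.integral_cong sum.cong) (simp_all only: mult.left_commute)
    also have "\<dots> = (\<Sum>i\<le>n. a i * first 0 (1 / real m) (\<lambda>p. exp (- p) ^ i))"
    proof -
      have "integrable M (\<lambda>\<omega>. of_bool (N 0 \<omega> = 0 \<and> N 0 \<omega> < N (0 + 1 / real m) \<omega>) * exp (- P 1 \<omega>) ^ i)" for i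
        by (rule first_integrable[of "\<lambda>p. exp (- p) ^ i" 1]) (use ei in auto)
      then have "expectation (\<lambda>\<omega>. \<Sum>i\<le>n. a i *
            (of_bool (N 0 \<omega> = 0 \<and> N 0 \<omega> < N (0 + 1 / real m) \<omega>) * exp (- P 1 \<omega>) ^ i))
          = (\<Sum>i\<le>n. expectation (\<lambda>\<omega>. a i *
            (of_bool (N 0 \<omega> = 0 \<and> N 0 \<omega> < N (0 + 1 / real m) \<omega>) * exp (- P 1 \<omega>) ^ i)))"
        by (intro Bochner_Integration.integral_sum integrable_mult_right)
      then show ?thesis unfolding first_def integral_mult_right_zero .
    qed
    finally show ?thesis .
  qed
  have exp_G: "expectation (\<lambda>\<omega>. G (P 1 \<omega>)) = (\<Sum>i\<le>n. a i * expectation (\<lambda>\<omega>. exp (- P 1 \<omega>) ^ i))"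
  proof -
    have "integrable M (\<lambda>\<omega>. exp (- P 1 \<omega>) ^ i)" for i
      by (rule mark_integrable[of "\<lambda>p. exp (- p) ^ i" 1]) (use ei in auto)
    then have "expectation (\<lambda>\<omega>. \<Sum>i\<le>n. a i * exp (- P 1 \<omega>) ^ i) = (\<Sum>i\<le>n. expectation (\<lambda>\<omega>. a i * exp (- P 1 \<omega>) ^ i))"
      by (intro Bochner_Integration.integral_sum integrable_mult_right)
    then show ?thesis unfolding G_def integral_mult_right_zero .
  qed
  have "(\<lambda>m. \<Sum>i\<le>n. a i * (first 0 (1 / real m) (\<lambda>p. exp (- p) ^ i) / pm m)) \<longlonglongrightarrow> expectation (\<lambda>\<omega>. G (P 1 \<omega>))"
    unfolding exp_G by (intro tendsto_intros powers)
  then have "(\<lambda>m. first 0 (1 / real m) G / pm m) \<longlonglongrightarrow> expectation (\<lambda>\<omega>. G (P 1 \<omega>))"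
    by (simp add: first_G sum_divide_distrib)
  from LIMSEQ_D[OF this e3] obtain m0 where
    m0: "\<And>m. m0 \<le> m \<Longrightarrow> \<bar>first 0 (1 / real m) G / pm m - expectation (\<lambda>\<omega>. G (P 1 \<omega>))\<bar> < e / 3" by auto
  have "norm (first 0 (1 / real m) q / pm m - expectation (\<lambda>\<omega>. q (P 1 \<omega>))) < e" if "max 1 m0 \<le> m" for m
  proof -
    have m: "0 < m" "m0 \<le> m" using that by auto
    have "\<bar>first 0 (1 / real m) (\<lambda>p. q p - G p)\<bar> \<le> e / 3 * pm m"
      unfolding pm_def using qG q_meas G_meas by (intro first_abs_le) auto
    then have "\<bar>first 0 (1 / real m) q / pm m - first 0 (1 / real m) G / pm m\<bar> \<le> e / 3"
      using pm[OF m(1)] first_diff[OF q_meas q_bound G_meas G_bound, of 0 "1 / real m"]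
      by (simp add: field_simps flip: diff_divide_distrib)
    moreover have "\<bar>expectation (\<lambda>\<omega>. q (P 1 \<omega>)) - expectation (\<lambda>\<omega>. G (P 1 \<omega>))\<bar> \<le> e / 3"
      using mark_expectation_abs_le[of "\<lambda>p. q p - G p" "e / 3"] qG q_meas G_meas
        mark_integrable[OF q_meas q_bound] mark_integrable[OF G_meas G_bound] by simp
    moreover have triangle: "\<bar>u - v\<bar> < e"
      if "\<bar>u - u'\<bar> \<le> e / 3" "\<bar>v - v'\<bar> \<le> e / 3" "\<bar>u' - v'\<bar> < e / 3" for u u' v v' :: real
      using that by linarith
    ultimately show ?thesis unfolding real_norm_def by (intro triangle[OF _ _ m0[OF m(2)]])
  qed
  then show "\<exists>m0. \<forall>m\<ge>m0. norm (first 0 (1 / real m) q / (1 - exp (- (lam * (1 / real m)))) - expectation (\<lambda>\<omega>. q (P 1 \<omega>))) < e"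
    unfolding pm_def by blast
qed

end

section \<open>The stationary network\<close>

locale stationary_network =
  linear_network r trib K H a + marked_poisson M lam k N T P
  for r :: "'e::finite" and trib :: "'e \<Rightarrow> 'e set" and K H a :: "real ^ 'e"
    and M :: "'w measure" and lam k :: real
    and N :: "real \<Rightarrow> 'w \<Rightarrow> nat" and T P :: "nat \<Rightarrow> 'w \<Rightarrow> real" +
  fixes g :: "(real ^ ('e + 'e)) measure"
  assumes invariant: "invariant_distribution M (state_process trib K H a N T P) g"
    and indep_unit_time: "indep_var borel (P 1) borel (\<lambda>\<omega>. real (N 1 \<omega>))"
begin

sublocale g: prob_space g
  using invariant by (simp add: invariant_distribution_def)

sublocale gM: pair_prob_space g M ..

lemma sets_g [measurable_cong]: "sets g = sets borel"
  using invariant by (simp add: invariant_distribution_def)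

lemma AE_g_pos: "AE x in g. \<forall>i. 0 < x $ i"
  using invariant by (simp add: invariant_distribution_def)

text \<open>The kernel with which the linear functional \<theta> of the state sees a unit mark of
  age \<open>u\<close>; the root coordinate gives \<open>response\<close>.\<close>

definition weight :: "real ^ ('e + 'e) \<Rightarrow> real \<Rightarrow> real" where
  "weight \<theta> u = \<theta> \<bullet> (flow u *v input)"

lemma flow_mult_continuous: "continuous_on S (\<lambda>u. flow u *v x)"
  using flow_vector_continuous[of S x] by (intro continuous_on_vec_lambda[of S "\<lambda>i u. (flow u *v x) $ i", simplified])

lemma weight_continuous: "continuous_on S (weight \<theta>)"
  unfolding weight_def by (intro continuous_intros flow_mult_continuous)

lemma weight_measurable [measurable]: "weight \<theta> \<in> borel_measurable borel"
  by (rule borel_measurable_continuous_onI) (rule weight_continuous)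

lemma matrix_vector_mult_continuous: "continuous_on S ((*v) (F :: real ^ 'n ^ 'm))"
  by (intro linear_continuous_on linear_conv_bounded_linear[THEN iffD1] matrix_vector_mul_linear)

lemma state_process_eq:
  "state_process trib K H a N T P t x \<omega>
    = flow t *v x + (\<Sum>n = 1..N t \<omega>. P n \<omega> *\<^sub>R (flow (t - T n \<omega>) *v input))"
proof -
  have "block_vector 0 (c *\<^sub>R v) = c *\<^sub>R block_vector 0 v" for c and v :: "real ^ 'e"
    by (simp add: block_vector_def vec_eq_iff split: sum.split)
  moreover have "F *v (c *\<^sub>R v) = c *\<^sub>R (F *v v)" for F :: "real ^ ('e + 'e) ^ ('e + 'e)" and c v
    by (simp add: matrix_vector_mult_def vec_eq_iff sum_distrib_left mult_ac)
  ultimately show ?thesis by (simp add: state_process_def flow_def input_def)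
qed

text \<open>By the semigroup law, letting the state flow on for time \<open>s\<close> without rain
  merely adds \<open>s\<close> to all ages.\<close>

lemma inner_flow_state:
  "\<theta> \<bullet> (flow s *v state_process trib K H a N T P t x \<omega>)
    = \<theta> \<bullet> (flow (s + t) *v x) + shot (\<lambda>u. weight \<theta> (s + u)) t \<omega>"
proof -
  interpret lin: linear "(*v) (flow s)" by (rule matrix_vector_mul_linear)
  show ?thesis
    by (simp add: state_process_eq lin.add lin.sum lin.scaleR matrix_vector_mul_assoc inner_add_right
        inner_sum_right shot_def weight_def mult.commute add_diff_eq flip: flow_add)
qed

lemma state_process_measurable:
  assumes "0 \<le> t"
  shows "(\<lambda>(x, \<omega>). state_process trib K H a N T P t x \<omega>) \<in> borel_measurable (g \<Otimes>\<^sub>M M)"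
proof -
  have [measurable]: "(\<lambda>u. flow u *v input) \<in> borel_measurable borel"
    by (rule borel_measurable_continuous_onI) (rule flow_mult_continuous)
  have mv [measurable]: "(*v) (flow t) \<in> borel_measurable borel"
    by (rule borel_measurable_continuous_onI) (rule matrix_vector_mult_continuous)
  have [measurable]: "(\<lambda>x. flow t *v x) \<in> borel_measurable g"
    using mv by (simp add: measurable_cong_sets[OF sets_g])
  have S: "(\<lambda>\<omega>. \<Sum>n = 1..N t \<omega>. P n \<omega> *\<^sub>R (flow (t - T n \<omega>) *v input)) \<in> borel_measurable M"
  proof -
    have "(\<lambda>\<omega>. (\<lambda>m \<omega>. \<Sum>n = 1..m. P n \<omega> *\<^sub>R (flow (t - T n \<omega>) *v input)) (N t \<omega>) \<omega>) \<in> borel_measurable M"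
    proof (rule measurable_compose_countable)
      show "(\<lambda>\<omega>. \<Sum>n = 1..m. P n \<omega> *\<^sub>R (flow (t - T n \<omega>) *v input)) \<in> borel_measurable M" for m
      proof (rule borel_measurable_sum)
        fix n assume "n \<in> {1..m}"
        then have [measurable]: "random_variable borel (P n)" "random_variable borel (T n)"
          using P_measurable T_measurable by auto
        show "(\<lambda>\<omega>. P n \<omega> *\<^sub>R (flow (t - T n \<omega>) *v input)) \<in> borel_measurable M" by measurable
      qed
    qed (use assms in measurable)
    then show ?thesis by simp
  qed
  note [measurable] = S
  show ?thesis unfolding state_process_eq by measurable
qed

text \<open>Invariance over the time \<open>t\<close>, tested on the state that flows on for a
  further time \<open>s\<close>. Fubini separates the initial state from the noise.\<close>

lemma stationarity:
  assumes \<psi>: "\<psi> \<in> borel_measurable borel" "\<And>v. \<bar>\<psi> v\<bar> \<le> (C :: real)" and t: "0 < t"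
  shows "(\<integral>x. \<psi> (\<theta> \<bullet> (flow s *v x)) \<partial>g)
    = (\<integral>x. expectation (\<lambda>\<omega>. \<psi> (\<theta> \<bullet> (flow (s + t) *v x) + shot (\<lambda>u. weight \<theta> (s + u)) t \<omega>)) \<partial>g)"
proof -
  have mv: "(\<lambda>x. \<psi> (\<theta> \<bullet> (flow s *v x))) \<in> borel_measurable borel"
  proof (rule measurable_compose[OF _ \<psi>(1)])
    show "(\<lambda>x. \<theta> \<bullet> (flow s *v x)) \<in> borel_measurable borel"
      by (intro borel_measurable_continuous_onI continuous_intros matrix_vector_mult_continuous)
  qed
  note Z = state_process_measurable[OF less_imp_le[OF t]]
  have dist: "distr (g \<Otimes>\<^sub>M M) borel (\<lambda>(x, \<omega>). state_process trib K H a N T P t x \<omega>) = g"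
    using invariant t by (simp add: invariant_distribution_def)
  have "(\<integral>x. \<psi> (\<theta> \<bullet> (flow s *v x)) \<partial>g)
      = (\<integral>z. \<psi> (\<theta> \<bullet> (flow s *v (case z of (x, \<omega>) \<Rightarrow> state_process trib K H a N T P t x \<omega>))) \<partial>(g \<Otimes>\<^sub>M M))"
    by (subst dist[symmetric]) (rule integral_distr[OF Z mv])
  also have "\<dots> = (\<integral>x. expectation (\<lambda>\<omega>. \<psi> (\<theta> \<bullet> (flow s *v state_process trib K H a N T P t x \<omega>))) \<partial>g)"
  proof (subst gM.integral_fst'[symmetric])
    show "integrable (g \<Otimes>\<^sub>M M)
        (\<lambda>z. \<psi> (\<theta> \<bullet> (flow s *v (case z of (x, \<omega>) \<Rightarrow> state_process trib K H a N T P t x \<omega>))))"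
      using measurable_compose[OF Z mv] \<psi>(2) by (intro gM.P.integrable_const_bound[of _ C]) auto
  qed simp
  finally show ?thesis by (simp add: inner_flow_state)
qed

lemma weight_nonneg:
  assumes "\<And>i. 0 \<le> \<theta> $ i" "0 \<le> u"
  shows "0 \<le> weight \<theta> u"
  unfolding weight_def inner_vec_def
  using assms flow_vector_nonneg[OF assms(2), of input] input_nonneg by (auto intro!: sum_nonneg)

section \<open>Laplace functionals and the cocycle identity\<close>

definition Laplace :: "real ^ ('e + 'e) \<Rightarrow> real \<Rightarrow> real" where
  "Laplace \<theta> s = (\<integral>x. exp (- (\<theta> \<bullet> (flow s *v x))) \<partial>g)"

lemma AE_inner_flow_nonneg:
  assumes "\<And>i. 0 \<le> \<theta> $ i" "0 \<le> s"
  shows "AE x in g. 0 \<le> \<theta> \<bullet> (flow s *v x)"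
  using AE_g_pos
proof eventually_elim
  case (elim x)
  then show ?case unfolding inner_vec_def
    using assms flow_vector_nonneg[OF assms(2), of x] by (auto intro!: sum_nonneg simp: less_imp_le)
qed

lemma inner_flow_measurable: "(\<lambda>x. \<theta> \<bullet> (flow s *v x)) \<in> borel_measurable g"
proof -
  have "(\<lambda>x. \<theta> \<bullet> (flow s *v x)) \<in> borel_measurable borel"
    by (intro borel_measurable_continuous_onI continuous_intros matrix_vector_mult_continuous)
  then show ?thesis by (simp add: measurable_cong_sets[OF sets_g])
qed

text \<open>Needed to cancel: positivity of the transform of \<open>g\<close> is what transfers
  information from \<open>g\<close> to the noise.\<close>

lemma Laplace_pos:
  assumes "\<And>i. 0 \<le> \<theta> $ i" "0 \<le> s"
  shows "0 < Laplace \<theta> s"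
proof -
  have "integrable g (\<lambda>x. exp (- (\<theta> \<bullet> (flow s *v x))))"
  proof (rule g.integrable_const_bound[of _ 1])
    show "AE x in g. norm (exp (- (\<theta> \<bullet> (flow s *v x)))) \<le> 1"
      using AE_inner_flow_nonneg[OF assms] by eventually_elim simp
    show "(\<lambda>x. exp (- (\<theta> \<bullet> (flow s *v x)))) \<in> borel_measurable g"
      using inner_flow_measurable by measurable
  qed
  then have "(\<integral>x. 0 \<partial>g) < Laplace \<theta> s"
    unfolding Laplace_def by (intro g.integral_less_AE_space) (auto simp: g.emeasure_space_1)
  then show ?thesis by simp
qed

lemma Laplace_factor:
  assumes \<theta>: "\<And>i. 0 \<le> \<theta> $ i" and s: "0 \<le> s" and t: "0 < t"
  shows "Laplace \<theta> s = Laplace \<theta> (s + t) * expectation (\<lambda>\<omega>. exp (- shot (\<lambda>u. weight \<theta> (s + u)) t \<omega>))"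
proof -
  \<comment> \<open>\<open>stationarity\<close> demands a bounded function on all reals; the cut at
    0 changes nothing, since flow and noise are almost surely nonnegative.\<close>
  define \<psi> where "\<psi> v = exp (- max 0 v)" for v :: real
  have \<psi>: "\<psi> \<in> borel_measurable borel" "\<And>v. \<bar>\<psi> v\<bar> \<le> 1"
    by (auto simp: \<psi>_def[abs_def])
  have wm: "(\<lambda>u. weight \<theta> (s + u)) \<in> borel_measurable borel" by measurable
  have S: "AE \<omega> in M. 0 \<le> shot (\<lambda>u. weight \<theta> (s + u)) t \<omega>"
    using t s by (intro AE_shot_nonneg weight_nonneg \<theta>) auto
  have "Laplace \<theta> s = (\<integral>x. \<psi> (\<theta> \<bullet> (flow s *v x)) \<partial>g)"
    unfolding Laplace_def
  proof (rule integral_cong_AE)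
    show "AE x in g. exp (- (\<theta> \<bullet> (flow s *v x))) = \<psi> (\<theta> \<bullet> (flow s *v x))"
      using AE_inner_flow_nonneg[OF \<theta> s] by eventually_elim (simp add: \<psi>_def)
  qed (use inner_flow_measurable[of \<theta> s] \<psi>(1) in measurable)
  also have "\<dots> = (\<integral>x. expectation (\<lambda>\<omega>. \<psi> (\<theta> \<bullet> (flow (s + t) *v x) + shot (\<lambda>u. weight \<theta> (s + u)) t \<omega>)) \<partial>g)"
    by (rule stationarity[OF \<psi> t])
  also have "\<dots> = (\<integral>x. exp (- (\<theta> \<bullet> (flow (s + t) *v x))) * expectation (\<lambda>\<omega>. exp (- shot (\<lambda>u. weight \<theta> (s + u)) t \<omega>)) \<partial>g)"
  proof (rule integral_cong_AE)
    show "AE x in g. expectation (\<lambda>\<omega>. \<psi> (\<theta> \<bullet> (flow (s + t) *v x) + shot (\<lambda>u. weight \<theta> (s + u)) t \<omega>))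
        = exp (- (\<theta> \<bullet> (flow (s + t) *v x))) * expectation (\<lambda>\<omega>. exp (- shot (\<lambda>u. weight \<theta> (s + u)) t \<omega>))"
      using AE_inner_flow_nonneg[OF \<theta> add_nonneg_nonneg[OF s less_imp_le[OF t]]]
    proof eventually_elim
      case (elim x)
      have "expectation (\<lambda>\<omega>. \<psi> (\<theta> \<bullet> (flow (s + t) *v x) + shot (\<lambda>u. weight \<theta> (s + u)) t \<omega>))
          = expectation (\<lambda>\<omega>. exp (- (\<theta> \<bullet> (flow (s + t) *v x))) * exp (- shot (\<lambda>u. weight \<theta> (s + u)) t \<omega>))"
      proof (rule integral_cong_AE)
        show "AE \<omega> in M. \<psi> (\<theta> \<bullet> (flow (s + t) *v x) + shot (\<lambda>u. weight \<theta> (s + u)) t \<omega>)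
            = exp (- (\<theta> \<bullet> (flow (s + t) *v x))) * exp (- shot (\<lambda>u. weight \<theta> (s + u)) t \<omega>)"
          using S by eventually_elim (use elim in \<open>simp add: \<psi>_def max_def flip: exp_add\<close>)
      qed (use shot_measurable[OF wm less_imp_le[OF t]] \<psi>(1) in measurable)
      then show ?case by simp
    qed
    show "(\<lambda>x. expectation (\<lambda>\<omega>. \<psi> (\<theta> \<bullet> (flow (s + t) *v x) + shot (\<lambda>u. weight \<theta> (s + u)) t \<omega>)))
        \<in> borel_measurable g"
      using shot_measurable[OF wm less_imp_le[OF t]] \<psi>(1) inner_flow_measurable[of \<theta> "s + t"] by measurable
    show "(\<lambda>x. exp (- (\<theta> \<bullet> (flow (s + t) *v x))) * expectation (\<lambda>\<omega>. exp (- shot (\<lambda>u. weight \<theta> (s + u)) t \<omega>)))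
        \<in> borel_measurable g"
      using inner_flow_measurable[of \<theta> "s + t"] by measurable
  qed
  finally show ?thesis by (simp add: Laplace_def)
qed

text \<open>Factor \<open>Laplace \<theta> 0\<close> once over the time \<open>t + h\<close>, and
  once over \<open>h\<close> and then over \<open>t\<close>; the common factor
  \<open>Laplace \<theta> (t + h)\<close> is positive and cancels. The identity is what independent
  marked increments would give.\<close>

lemma shot_cocycle:
  assumes \<theta>: "\<And>i. 0 \<le> \<theta> $ i" and t: "0 \<le> t" "0 < h"
  shows "expectation (\<lambda>\<omega>. exp (- shot (weight \<theta>) (t + h) \<omega>))
    = expectation (\<lambda>\<omega>. exp (- shot (weight \<theta>) h \<omega>))
      * expectation (\<lambda>\<omega>. exp (- shot (\<lambda>u. weight \<theta> (h + u)) t \<omega>))"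
proof (cases "t = 0")
  case True
  \<comment> \<open>\<open>Laplace_factor\<close> needs a positive time, but at time 0 there is
    almost surely no noise.\<close>
  have "expectation (\<lambda>\<omega>. exp (- shot (\<lambda>u. weight \<theta> (h + u)) 0 \<omega>)) = expectation (\<lambda>\<omega>. 1)"
  proof (rule integral_cong_AE)
    show "AE \<omega> in M. exp (- shot (\<lambda>u. weight \<theta> (h + u)) 0 \<omega>) = 1"
      using AE_N_0 by eventually_elim (simp add: shot_def)
  qed (use shot_measurable[of "\<lambda>u. weight \<theta> (h + u)" 0] in measurable)
  then show ?thesis using True by (simp add: prob_space)
next
  case False
  then have t0: "0 < t" using t by simp
  have "Laplace \<theta> (t + h) * expectation (\<lambda>\<omega>. exp (- shot (weight \<theta>) (t + h) \<omega>)) = Laplace \<theta> 0"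
    using Laplace_factor[OF \<theta> order_refl, of "t + h"] t by simp
  also have "\<dots> = Laplace \<theta> h * expectation (\<lambda>\<omega>. exp (- shot (weight \<theta>) h \<omega>))"
    using Laplace_factor[OF \<theta> order_refl, of h] t by simp
  also have "Laplace \<theta> h = Laplace \<theta> (t + h) * expectation (\<lambda>\<omega>. exp (- shot (\<lambda>u. weight \<theta> (h + u)) t \<omega>))"
    using Laplace_factor[OF \<theta> _ t0, of h] t by (simp add: add.commute)
  finally show ?thesis using Laplace_pos[OF \<theta>, of "t + h"] t by (simp add: mult_ac)
qed

lemma mark_jump_indep:
  assumes q: "q \<in> borel_measurable borel" "\<And>p. k \<le> p \<Longrightarrow> \<bar>q p\<bar> \<le> C"
  shows "expectation (\<lambda>\<omega>. of_bool (0 < N 1 \<omega>) * q (P 1 \<omega>)) = (1 - exp (- lam)) * expectation (\<lambda>\<omega>. q (P 1 \<omega>))"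
proof -
  define f where "f x = (of_bool (0 < x) :: real)" for x :: real
  have f: "f \<in> borel_measurable borel"
  proof -
    have "f = indicator {0<..}" by (auto simp: f_def indicator_def)
    then show ?thesis by simp
  qed
  have "indep_var borel (q \<circ> P 1) borel (f \<circ> (\<lambda>\<omega>. real (N 1 \<omega>)))"
    by (rule indep_var_compose[OF indep_unit_time q(1) f])
  moreover have "integrable M (q \<circ> P 1)" using mark_integrable[OF q] by (simp add: comp_def)
  moreover have "integrable M (f \<circ> (\<lambda>\<omega>. real (N 1 \<omega>)))"
    using of_bool_integrable[of 1 1 "\<lambda>i j. 0 < i"] by (simp add: comp_def f_def)
  ultimately have "expectation (\<lambda>\<omega>. (q \<circ> P 1) \<omega> * (f \<circ> (\<lambda>\<omega>. real (N 1 \<omega>))) \<omega>)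
      = expectation (q \<circ> P 1) * expectation (f \<circ> (\<lambda>\<omega>. real (N 1 \<omega>)))"
    by (intro indep_var_lebesgue_integral)
  moreover have "expectation (f \<circ> (\<lambda>\<omega>. real (N 1 \<omega>))) = 1 - exp (- lam)"
  proof -
    have "expectation (\<lambda>\<omega>. of_bool (0 < N 1 \<omega>)) = expectation (\<lambda>\<omega>. 1 - of_bool (N 1 \<omega> = 0))"
      by (intro Bochner_Integration.integral_cong) auto
    also have "\<dots> = 1 - prob {\<omega> \<in> space M. N 1 \<omega> = 0}"
      using of_bool_integrable[of 1 1 "\<lambda>i j. i = 0"] expectation_of_bool[of 1 1 "\<lambda>i j. i = 0"]
      by (simp add: prob_space)
    finally show ?thesis using prob_N_eq_0[of 1] by (simp add: comp_def f_def)
  qed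
  ultimately show ?thesis by (simp add: comp_def f_def mult.commute)
qed

lemma first_mark_limit:
  assumes "continuous_on UNIV q" "(q \<longlongrightarrow> l) at_top"
  shows "(\<lambda>m. first 0 (1 / real m) q / (1 - exp (- (lam * (1 / real m))))) \<longlonglongrightarrow> expectation (\<lambda>\<omega>. q (P 1 \<omega>))"
proof (rule first_mark_law[OF _ assms])
  fix y :: real assume y: "0 < y"
  \<comment> \<open>Rain fills the storage of the root link at once, whereas its discharge starts
    from 0. So the normalised storage response serves as the part of the kernel with value 1 at age
    0, and \<open>response\<close> as the part that vanishes there.\<close>
  define \<rho> where "\<rho> u = (flow u *v input) $ Inr r / (H $ r * a $ r)" for u
  have Ha: "0 < H $ r * a $ r" using H_pos a_pos by simp
  show "(\<lambda>m. first 0 (1 / real m) (\<lambda>p. 1 - exp (- (y * p))) / (1 - exp (- (lam * (1 / real m)))))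
      \<longlonglongrightarrow> expectation (\<lambda>\<omega>. 1 - exp (- (y * P 1 \<omega>)))"
  proof (rule first_mark_Laplace[OF response_continuous response_0 response_pos _ _ _ y])
    show "continuous_on UNIV \<rho>" unfolding \<rho>_def
      by (intro continuous_on_divide flow_vector_continuous continuous_on_const) (use H_pos[of r] a_pos[of r] in auto)
    show "\<rho> 0 = 1" using H_pos[of r] a_pos[of r] by (simp add: \<rho>_def)
    show "0 \<le> \<rho> u" if "0 \<le> u" for u
      using flow_vector_nonneg[OF that input_nonneg] Ha by (simp add: \<rho>_def)
    show "expectation (\<lambda>\<omega>. of_bool (0 < N 1 \<omega>) * (1 - exp (- (y * P 1 \<omega>))))
        = (1 - exp (- lam)) * expectation (\<lambda>\<omega>. 1 - exp (- (y * P 1 \<omega>)))"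
      using y k_pos by (intro mark_jump_indep[of "\<lambda>p. 1 - exp (- (y * p))" 1]) auto
    fix c t h :: real assume c: "0 \<le> c" and th: "0 \<le> t" "0 < h"
    define \<theta> where "\<theta> = axis (Inl r) c + (axis (Inr r) (y / (H $ r * a $ r)) :: real ^ ('e + 'e))"
    have "0 \<le> \<theta> $ i" for i using c y Ha by (auto simp: \<theta>_def axis_def)
    from shot_cocycle[OF this th]
    show "expectation (\<lambda>\<omega>. exp (- shot (\<lambda>u. c * response u + y * \<rho> u) (t + h) \<omega>))
        = expectation (\<lambda>\<omega>. exp (- shot (\<lambda>u. c * response u + y * \<rho> u) h \<omega>))
        * expectation (\<lambda>\<omega>. exp (- shot (\<lambda>u. c * response (h + u) + y * \<rho> (h + u)) t \<omega>))"
    proof -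
      have "weight \<theta> = (\<lambda>u. c * response u + y * \<rho> u)"
        by (simp add: fun_eq_iff weight_def \<theta>_def inner_add_left inner_axis' response_def \<rho>_def)
      then show ?thesis using shot_cocycle[OF \<open>\<And>i. 0 \<le> \<theta> $ i\<close> th] by simp
    qed
  qed
qed

end

section \<open>The short-time equation for the stationary discharge\<close>

context stationary_network
begin

definition root_flow :: "real \<Rightarrow> real ^ ('e + 'e) \<Rightarrow> real" where
  "root_flow s x = (flow s *v x) $ Inl r"

lemma inner_axis_flow: "axis (Inl r) 1 \<bullet> (flow s *v x) = root_flow s x"
  by (simp add: inner_axis' root_flow_def)

lemma weight_root: "weight (axis (Inl r) 1) = response"
  by (simp add: fun_eq_iff weight_def inner_axis' response_def)

lemma root_flow_measurable [measurable]: "root_flow s \<in> borel_measurable g"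
  using inner_flow_measurable[of "axis (Inl r) 1" s] by (simp add: inner_axis_flow)

lemma root_flow_continuous: "continuous_on S (\<lambda>s. root_flow s x)"
  unfolding root_flow_def by (rule flow_vector_continuous)

lemma response_measurable [measurable]: "response \<in> borel_measurable borel"
  by (rule borel_measurable_continuous_onI) (rule response_continuous)

definition mean_of :: "(real \<Rightarrow> real) \<Rightarrow> real \<Rightarrow> real" where
  "mean_of \<psi> s = (\<integral>x. \<psi> (root_flow s x) \<partial>g)"

definition jump_mean :: "(real \<Rightarrow> real) \<Rightarrow> real \<Rightarrow> real ^ ('e + 'e) \<Rightarrow> real" where
  "jump_mean \<psi> s x = expectation (\<lambda>\<omega>. \<psi> (root_flow s x + response s * P 1 \<omega>) - \<psi> (root_flow s x))"

text \<open>Both terms refer to time \<open>s + h\<close>, so the dry flow drops out and only the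
  rain of the step is left.\<close>

definition step_mean :: "(real \<Rightarrow> real) \<Rightarrow> real \<Rightarrow> real \<Rightarrow> real ^ ('e + 'e) \<Rightarrow> real" where
  "step_mean \<psi> s h x = expectation (\<lambda>\<omega>. \<psi> (root_flow (s + h) x + shot (\<lambda>u. response (s + u)) h \<omega>)
      - \<psi> (root_flow (s + h) x))"

lemma P_1_measurable [measurable]: "P 1 \<in> borel_measurable M" "P (Suc 0) \<in> borel_measurable M"
  using P_measurable[of 1] by simp_all

text \<open>The limit at infinity is what \<open>first_mark_limit\<close> asks of test functions;
  the Lipschitz bound absorbs small changes of the flow and the response.\<close>

context
  fixes \<psi> :: "real \<Rightarrow> real" and L l :: real
  assumes \<psi>_bound: "\<And>v. 0 \<le> \<psi> v" "\<And>v. \<psi> v \<le> 1"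
    and \<psi>_Lipschitz: "\<And>u v. \<bar>\<psi> u - \<psi> v\<bar> \<le> L * \<bar>u - v\<bar>" and L_pos: "0 < L"
    and \<psi>_lim: "(\<psi> \<longlongrightarrow> l) at_top"
begin

lemma \<psi>_continuous: "continuous_on UNIV \<psi>"
proof (rule continuous_onI)
  fix x e :: real assume e: "0 < e"
  show "\<exists>d>0. \<forall>x'\<in>UNIV. dist x' x < d \<longrightarrow> dist (\<psi> x') (\<psi> x) \<le> e"
  proof (intro exI[of _ "e / L"] conjI ballI impI)
    fix x' assume "dist x' x < e / L"
    then have "L * \<bar>x' - x\<bar> \<le> e" using L_pos by (simp add: dist_real_def field_simps)
    then show "dist (\<psi> x') (\<psi> x) \<le> e" using \<psi>_Lipschitz[of x' x] by (simp add: dist_real_def)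
  qed (use e L_pos in auto)
qed

lemma \<psi>_measurable [measurable]: "\<psi> \<in> borel_measurable borel"
  by (rule borel_measurable_continuous_onI) (rule \<psi>_continuous)

lemma \<psi>_diff_le: "\<bar>\<psi> u - \<psi> v\<bar> \<le> 1"
  using \<psi>_bound(1)[of u] \<psi>_bound(2)[of u] \<psi>_bound(1)[of v] \<psi>_bound(2)[of v] by linarith

lemma shifted_shot_measurable:
  assumes "0 \<le> h"
  shows "shot (\<lambda>u. response (s + u)) h \<in> borel_measurable M"
  using assms by (intro shot_measurable) measurable

lemma step_mean_measurable: "0 \<le> h \<Longrightarrow> step_mean \<psi> s h \<in> borel_measurable g"
  using shifted_shot_measurable[of h s] unfolding step_mean_def by measurable

lemma jump_mean_measurable: "jump_mean \<psi> s \<in> borel_measurable g"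
  unfolding jump_mean_def by measurable

text \<open>By invariance \<open>mean_of \<psi> s\<close> may be computed from the state reached
  after time \<open>h\<close>; without the rain of that time it would be
  \<open>mean_of \<psi> (s + h)\<close>.\<close>

lemma mean_of_diff:
  assumes h: "0 < h"
  shows "mean_of \<psi> s - mean_of \<psi> (s + h) = (\<integral>x. step_mean \<psi> s h x \<partial>g)"
proof -
  have S [measurable]: "shot (\<lambda>u. response (s + u)) h \<in> borel_measurable M"
    using h by (intro shifted_shot_measurable) simp
  have i1: "integrable g (\<lambda>x. \<psi> (root_flow (s + h) x))"
    using \<psi>_bound by (intro g.integrable_const_bound[of _ 1]) auto
  have m2: "(\<lambda>x. expectation (\<lambda>\<omega>. \<psi> (root_flow (s + h) x + shot (\<lambda>u. response (s + u)) h \<omega>)))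
      \<in> borel_measurable g" by measurable
  have iM: "integrable M (\<lambda>\<omega>. \<psi> (root_flow (s + h) x + shot (\<lambda>u. response (s + u)) h \<omega>))" for x
    using \<psi>_bound by (intro integrable_bounded[of _ 1]) auto
  have i2: "integrable g (\<lambda>x. expectation (\<lambda>\<omega>. \<psi> (root_flow (s + h) x + shot (\<lambda>u. response (s + u)) h \<omega>)))"
  proof (rule g.integrable_const_bound[of _ 1])
    have "\<bar>expectation (\<lambda>\<omega>. \<psi> (root_flow (s + h) x + shot (\<lambda>u. response (s + u)) h \<omega>))\<bar> \<le> 1" for x
    proof -
      have "0 \<le> expectation (\<lambda>\<omega>. \<psi> (root_flow (s + h) x + shot (\<lambda>u. response (s + u)) h \<omega>))"
        using \<psi>_bound by (intro integral_nonneg_AE) auto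
      moreover have "expectation (\<lambda>\<omega>. \<psi> (root_flow (s + h) x + shot (\<lambda>u. response (s + u)) h \<omega>)) \<le> expectation (\<lambda>_. 1)"
        using \<psi>_bound iM by (intro integral_mono) auto
      ultimately show ?thesis by (simp add: prob_space)
    qed
    then show "AE x in g. norm (expectation (\<lambda>\<omega>. \<psi> (root_flow (s + h) x + shot (\<lambda>u. response (s + u)) h \<omega>))) \<le> 1"
      by simp
  qed (rule m2)
  have "mean_of \<psi> s = (\<integral>x. expectation (\<lambda>\<omega>. \<psi> (root_flow (s + h) x + shot (\<lambda>u. response (s + u)) h \<omega>)) \<partial>g)"
    unfolding mean_of_def
    using stationarity[of \<psi> 1 h "axis (Inl r) 1" s] \<psi>_bound h
    by (simp add: inner_axis_flow weight_root abs_of_nonneg)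
  then have "mean_of \<psi> s - mean_of \<psi> (s + h)
      = (\<integral>x. expectation (\<lambda>\<omega>. \<psi> (root_flow (s + h) x + shot (\<lambda>u. response (s + u)) h \<omega>))
          - \<psi> (root_flow (s + h) x) \<partial>g)"
    using i1 i2 by (simp add: mean_of_def)
  also have "\<dots> = (\<integral>x. step_mean \<psi> s h x \<partial>g)"
    using iM by (simp add: step_mean_def prob_space)
  finally show ?thesis .
qed

text \<open>Without a jump nothing changes, and \<psi> varies by at most 1. The bound is the
  majorant for difference quotients and the Lipschitz constant of
  \<open>mean_of \<psi>\<close>.\<close>

lemma step_mean_le:
  assumes h: "0 \<le> h"
  shows "\<bar>step_mean \<psi> s h x\<bar> \<le> lam * h"
proof -
  have S [measurable]: "shot (\<lambda>u. response (s + u)) h \<in> borel_measurable M"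
    using h by (rule shifted_shot_measurable)
  have "\<bar>step_mean \<psi> s h x\<bar> \<le> expectation (\<lambda>\<omega>. \<bar>\<psi> (root_flow (s + h) x + shot (\<lambda>u. response (s + u)) h \<omega>)
      - \<psi> (root_flow (s + h) x)\<bar>)"
    unfolding step_mean_def by (rule integral_abs_bound)
  also have "\<dots> \<le> expectation (\<lambda>\<omega>. of_bool (N 0 \<omega> < N h \<omega>))"
  proof (rule integral_mono_AE)
    show "AE \<omega> in M. \<bar>\<psi> (root_flow (s + h) x + shot (\<lambda>u. response (s + u)) h \<omega>) - \<psi> (root_flow (s + h) x)\<bar>
        \<le> of_bool (N 0 \<omega> < N h \<omega>)"
      using AE_N_0
    proof eventually_elim
      case (elim \<omega>)
      show ?case
        using \<psi>_diff_le elim by (cases "N h \<omega> = 0") (auto simp: shot_def)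
    qed
    show "integrable M (\<lambda>\<omega>. \<bar>\<psi> (root_flow (s + h) x + shot (\<lambda>u. response (s + u)) h \<omega>) - \<psi> (root_flow (s + h) x)\<bar>)"
      using \<psi>_diff_le by (intro integrable_bounded[of _ 1]) auto
    show "integrable M (\<lambda>\<omega>. of_bool (N 0 \<omega> < N h \<omega>) :: real)"
      using h by (intro of_bool_integrable[of 0 h "(<)"]) auto
  qed
  also have "\<dots> \<le> lam * h"
    using expectation_of_bool[of 0 h "(<)"] prob_jump_le[of 0 h] h by simp
  finally show ?thesis .
qed

lemma mean_of_Lipschitz:
  assumes "0 < h"
  shows "\<bar>mean_of \<psi> s - mean_of \<psi> (s + h)\<bar> \<le> lam * h"
proof -
  have "\<bar>mean_of \<psi> s - mean_of \<psi> (s + h)\<bar> \<le> (\<integral>x. \<bar>step_mean \<psi> s h x\<bar> \<partial>g)"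
    unfolding mean_of_diff[OF assms] by (rule integral_abs_bound)
  also have "\<dots> \<le> (\<integral>x. lam * h \<partial>g)"
    using step_mean_le[of h s] step_mean_measurable[of h s] assms lam_pos
    by (intro integral_mono g.integrable_const_bound[of _ "lam * h"]) auto
  finally show ?thesis by (simp add: g.prob_space)
qed

lemma scaled_first_mark_limit:
  assumes "continuous_on UNIV q" "(q \<longlongrightarrow> l') at_top"
  shows "(\<lambda>m. real m * first 0 (1 / real m) q) \<longlonglongrightarrow> lam * expectation (\<lambda>\<omega>. q (P 1 \<omega>))"
proof -
  have "(\<lambda>m. real m * (1 - exp (- (lam * (1 / real m))))) \<longlonglongrightarrow> lam"
    using lam_pos by real_asymp
  from tendsto_mult[OF this first_mark_limit[OF assms]]
  have "(\<lambda>m. real m * (1 - exp (- (lam * (1 / real m)))) * (first 0 (1 / real m) q / (1 - exp (- (lam * (1 / real m))))))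
    \<longlonglongrightarrow> lam * expectation (\<lambda>\<omega>. q (P 1 \<omega>))" .
  moreover have "\<forall>\<^sub>F m in sequentially. real m * (1 - exp (- (lam * (1 / real m))))
      * (first 0 (1 / real m) q / (1 - exp (- (lam * (1 / real m))))) = real m * first 0 (1 / real m) q"
    using eventually_gt_at_top[of "0::nat"] by eventually_elim (use lam_pos in auto)
  ultimately show ?thesis by (rule Lim_transform_eventually)
qed

text \<open>A Lipschitz bound alone would give \<open>L * \<delta>\<close> times the mean of a mark,
  which may be infinite; truncation at 1 makes dominated convergence possible.\<close>

lemma small_mark_error:
  assumes "0 < e"
  obtains \<delta> where "0 < \<delta>" "expectation (\<lambda>\<omega>. min 1 (L * \<delta> * P 1 \<omega>)) < e"
proof -
  have "(\<lambda>n. expectation (\<lambda>\<omega>. min 1 (L * (1 / real (Suc n)) * P 1 \<omega>))) \<longlonglongrightarrow> expectation (\<lambda>\<omega>. min 1 (L * 0 * P 1 \<omega>))"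
  proof (rule integral_dominated_convergence[where w = "\<lambda>_. 1"])
    show "AE \<omega> in M. (\<lambda>n. min 1 (L * (1 / real (Suc n)) * P 1 \<omega>)) \<longlonglongrightarrow> min 1 (L * 0 * P 1 \<omega>)"
      by (intro AE_I2 tendsto_intros LIMSEQ_inverse_real_of_nat[unfolded inverse_eq_divide])
    show "AE \<omega> in M. norm (min 1 (L * (1 / real (Suc n)) * P 1 \<omega>)) \<le> 1" for n
      using P_ge[OF order_refl] by eventually_elim (use k_pos L_pos in \<open>auto simp: abs_le_iff min_def\<close>)
  qed auto
  then have "(\<lambda>n. expectation (\<lambda>\<omega>. min 1 (L * (1 / real (Suc n)) * P 1 \<omega>))) \<longlonglongrightarrow> 0" by simp
  from LIMSEQ_D[OF this assms] obtain n where "\<bar>expectation (\<lambda>\<omega>. min 1 (L * (1 / real (Suc n)) * P 1 \<omega>))\<bar> < e"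
    by auto
  then show ?thesis using that[of "1 / real (Suc n)"] by simp
qed

text \<open>Three replacements are made: the response during the step by its value at
  \<open>s\<close> (truncated error \<open>\<eta>\<close>), the flow at \<open>s + h\<close> by that
  at \<open>s\<close> (Lipschitz bound), and the mark of a jump within the step by an unconditioned
  one (\<open>scaled_first_mark_limit\<close>).\<close>

lemma step_mean_limit:
  assumes s: "0 < s"
  shows "(\<lambda>m. real m * step_mean \<psi> s (1 / real m) x) \<longlonglongrightarrow> lam * jump_mean \<psi> s x"
proof (rule LIMSEQ_I)
  fix e :: real assume "0 < e"
  then have e: "0 < e / 5" "0 < e / (5 * lam)" using lam_pos by auto
  obtain \<delta> where \<delta>: "0 < \<delta>" "expectation (\<lambda>\<omega>. min 1 (L * \<delta> * P 1 \<omega>)) < e / (5 * lam)"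
    by (rule small_mark_error[OF e(2)])
  define \<eta> where "\<eta> p = min 1 (L * \<delta> * p)" for p :: real
  define z where "z = root_flow s x"
  define zm where "zm m = root_flow (s + 1 / real m) x" for m :: nat
  define q where "q y v = \<psi> (y + v) - \<psi> y" for y v :: real
  define c where "c = response s"
  have c: "0 < c" using s by (simp add: c_def response_pos)
  have \<eta>_lim: "(\<lambda>m. real m * first 0 (1 / real m) \<eta>) \<longlonglongrightarrow> lam * expectation (\<lambda>\<omega>. \<eta> (P 1 \<omega>))"
  proof (rule scaled_first_mark_limit)
    show "continuous_on UNIV \<eta>" unfolding \<eta>_def by (intro continuous_intros)
    show "(\<eta> \<longlongrightarrow> 1) at_top"
    proof (rule tendsto_eventually)
      show "\<forall>\<^sub>F p in at_top. \<eta> p = 1"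
        using eventually_ge_at_top[of "1 / (L * \<delta>)"]
        by eventually_elim (use \<delta> L_pos in \<open>auto simp: \<eta>_def min_def field_simps\<close>)
    qed
  qed
  have q_lim: "(\<lambda>m. real m * first 0 (1 / real m) (\<lambda>p. q z (c * p))) \<longlonglongrightarrow> lam * expectation (\<lambda>\<omega>. q z (c * P 1 \<omega>))"
  proof (rule scaled_first_mark_limit)
    show "continuous_on UNIV (\<lambda>p. q z (c * p))" unfolding q_def
      by (intro continuous_intros continuous_on_compose2[OF \<psi>_continuous]) auto
    have "filterlim (\<lambda>p. z + c * p) at_top at_top"
      using c by (intro filterlim_tendsto_add_at_top[OF tendsto_const]
          filterlim_tendsto_pos_mult_at_top[OF tendsto_const] filterlim_ident) auto
    from filterlim_compose[OF \<psi>_lim this]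
    show "((\<lambda>p. q z (c * p)) \<longlongrightarrow> l - \<psi> z) at_top" unfolding q_def by (intro tendsto_diff tendsto_const)
  qed
  have jm: "expectation (\<lambda>\<omega>. q z (c * P 1 \<omega>)) = jump_mean \<psi> s x"
    by (simp add: jump_mean_def q_def z_def c_def)
  have zm_lim: "zm \<longlonglongrightarrow> z"
  proof -
    have "isCont (\<lambda>s. root_flow s x) s"
      using root_flow_continuous[of UNIV x] by (simp add: continuous_on_eq_continuous_at)
    moreover have "(\<lambda>m. s + 1 / real m) \<longlonglongrightarrow> s" by real_asymp
    ultimately show ?thesis unfolding zm_def z_def by (rule isCont_tendsto_compose)
  qed
  have "\<exists>d>0. \<forall>u. dist u s < d \<longrightarrow> dist (response u) (response s) < \<delta>"
    using response_continuous[of UNIV, unfolded continuous_on_iff, rule_format, of s \<delta>] \<delta> by simp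
  then obtain d where d: "0 < d" "\<And>u. \<bar>u - s\<bar> < d \<Longrightarrow> \<bar>response u - c\<bar> < \<delta>"
    by (auto simp: dist_real_def c_def)
  have ev1: "\<forall>\<^sub>F m in sequentially. 1 / real m < d"
    using d(1) by real_asymp
  have ev2: "\<forall>\<^sub>F m in sequentially. real m * first 0 (1 / real m) \<eta> < e / 5"
  proof (rule order_tendstoD(2)[OF \<eta>_lim])
    show "lam * expectation (\<lambda>\<omega>. \<eta> (P 1 \<omega>)) < e / 5"
      using \<delta>(2) lam_pos by (simp add: \<eta>_def field_simps)
  qed
  have ev3: "\<forall>\<^sub>F m in sequentially. \<bar>real m * first 0 (1 / real m) (\<lambda>p. q z (c * p)) - lam * jump_mean \<psi> s x\<bar> < e / 5"
    using tendstoD[OF q_lim[unfolded jm] e(1)] by (simp add: dist_real_def)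
  have ev4: "\<forall>\<^sub>F m in sequentially. 2 * lam\<^sup>2 * (1 / real m) < e / 5"
    using e(1) by real_asymp
  have ev5: "\<forall>\<^sub>F m in sequentially. 2 * L * \<bar>zm m - z\<bar> * lam < e / 5"
  proof (rule order_tendstoD(2))
    show "(\<lambda>m. 2 * L * \<bar>zm m - z\<bar> * lam) \<longlonglongrightarrow> 2 * L * \<bar>z - z\<bar> * lam"
      by (intro tendsto_intros zm_lim)
  qed (use e in simp)
  have "\<forall>\<^sub>F m in sequentially. norm (real m * step_mean \<psi> s (1 / real m) x - lam * jump_mean \<psi> s x) < e"
    using ev1 ev2 ev3 ev4 ev5 eventually_gt_at_top[of "0::nat"]
  proof eventually_elim
    case (elim m)
    define h where "h = 1 / real m"
    have h: "0 < h" "real m * h = 1" using elim by (auto simp: h_def)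
    \<comment> \<open>The almost sure event \<open>N 0 = 0\<close> is inserted to match
      \<open>shot_first_jump\<close> at time 0.\<close>
    have sm: "step_mean \<psi> s h x = expectation (\<lambda>\<omega>. of_bool (N 0 \<omega> = 0) * q (zm m) (shot (\<lambda>u. response (s + u)) (0 + h) \<omega>))"
      unfolding step_mean_def
    proof (rule integral_cong_AE)
      show "AE \<omega> in M. \<psi> (root_flow (s + h) x + shot (\<lambda>u. response (s + u)) h \<omega>) - \<psi> (root_flow (s + h) x)
          = of_bool (N 0 \<omega> = 0) * q (zm m) (shot (\<lambda>u. response (s + u)) (0 + h) \<omega>)"
        using AE_N_0 by eventually_elim (simp add: q_def zm_def h_def)
    qed (use shifted_shot_measurable[of h s] indicator_event_measurable[of 0 0 "\<lambda>i j. i = 0"] h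
        in \<open>auto simp: q_def\<close>)
    have qm [measurable]: "q y \<in> borel_measurable borel" for y unfolding q_def by measurable
    have \<eta>m: "\<eta> \<in> borel_measurable borel" unfolding \<eta>_def by measurable
    have "\<bar>step_mean \<psi> s h x - first 0 h (\<lambda>p. q (zm m) (c * p))\<bar> \<le> first 0 h \<eta> + 2 * 1 * (lam * h)\<^sup>2"
      unfolding sm
    proof (rule shot_first_jump[where B = 1])
      show "\<bar>q (zm m) (response (s + u) * p) - q (zm m) (c * p)\<bar> \<le> \<eta> p" if "0 \<le> u" "u \<le> h" "k \<le> p" for u p
      proof -
        have p: "0 < p" using that k_pos by simp
        have eq: "q (zm m) (response (s + u) * p) - q (zm m) (c * p) = \<psi> (zm m + response (s + u) * p) - \<psi> (zm m + c * p)"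
          by (simp add: q_def)
        have "\<bar>response (s + u) - c\<bar> \<le> \<delta>" using d(2)[of "s + u"] that elim(1) by (simp add: h_def)
        then have "L * (\<bar>response (s + u) - c\<bar> * p) \<le> L * (\<delta> * p)"
          using L_pos p by (intro mult_left_mono mult_right_mono) auto
        moreover have "\<bar>response (s + u) - c\<bar> * p = \<bar>(zm m + response (s + u) * p) - (zm m + c * p)\<bar>"
          using p by (simp add: abs_mult flip: left_diff_distrib)
        ultimately have "\<bar>\<psi> (zm m + response (s + u) * p) - \<psi> (zm m + c * p)\<bar> \<le> L * \<delta> * p"
          using \<psi>_Lipschitz[of "zm m + response (s + u) * p" "zm m + c * p"] by simp
        then show ?thesis unfolding eq using \<psi>_diff_le by (simp add: \<eta>_def)
      qed
      show "\<bar>q (zm m) v\<bar> \<le> 1" for v using \<psi>_diff_le by (simp add: q_def)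
      show "0 \<le> response (s + u)" if "0 \<le> u" for u using response_nonneg s that by simp
    qed (use qm \<eta>m c h in \<open>auto simp: q_def \<eta>_def\<close>)
    then have A: "\<bar>real m * step_mean \<psi> s h x - real m * first 0 h (\<lambda>p. q (zm m) (c * p))\<bar>
        \<le> real m * first 0 h \<eta> + 2 * lam\<^sup>2 * h"
    proof -
      assume le: "\<bar>step_mean \<psi> s h x - first 0 h (\<lambda>p. q (zm m) (c * p))\<bar> \<le> first 0 h \<eta> + 2 * 1 * (lam * h)\<^sup>2"
      have "\<bar>real m * step_mean \<psi> s h x - real m * first 0 h (\<lambda>p. q (zm m) (c * p))\<bar>
          = real m * \<bar>step_mean \<psi> s h x - first 0 h (\<lambda>p. q (zm m) (c * p))\<bar>"
        by (simp add: abs_mult flip: right_diff_distrib)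
      also have "\<dots> \<le> real m * (first 0 h \<eta> + 2 * 1 * (lam * h)\<^sup>2)"
        using le by (rule mult_left_mono) simp
      also have "\<dots> = real m * first 0 h \<eta> + 2 * lam\<^sup>2 * h * (real m * h)"
        by (simp add: algebra_simps power2_eq_square)
      finally show ?thesis by (simp add: h(2))
    qed
    \<comment> \<open>The factor 2 arises because the base point occurs in both terms of
      \<open>q\<close>.\<close>
    have qd: "\<bar>q (zm m) (c * p) - q z (c * p)\<bar> \<le> 2 * L * \<bar>zm m - z\<bar>" for p
      using \<psi>_Lipschitz[of "zm m + c * p" "z + c * p"] \<psi>_Lipschitz[of "zm m" z] by (simp add: q_def)
    have q1: "\<bar>q y v\<bar> \<le> 1" for y v using \<psi>_diff_le by (simp add: q_def)
    have qc: "(\<lambda>p. q y (c * p)) \<in> borel_measurable borel" for y by measurable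
    have eq: "first 0 h (\<lambda>p. q (zm m) (c * p)) - first 0 h (\<lambda>p. q z (c * p))
        = first 0 h (\<lambda>p. q (zm m) (c * p) - q z (c * p))"
      using h by (intro first_diff[OF qc q1 qc q1, symmetric]) auto
    have "\<bar>first 0 h (\<lambda>p. q (zm m) (c * p)) - first 0 h (\<lambda>p. q z (c * p))\<bar> \<le> 2 * L * \<bar>zm m - z\<bar> * (lam * h)"
      unfolding eq using h by (intro first_bound[OF borel_measurable_diff[OF qc qc] qd]) auto
    then have "real m * \<bar>first 0 h (\<lambda>p. q (zm m) (c * p)) - first 0 h (\<lambda>p. q z (c * p))\<bar>
        \<le> real m * (2 * L * \<bar>zm m - z\<bar> * (lam * h))"
      by (rule mult_left_mono) simp
    also have "\<dots> = 2 * L * \<bar>zm m - z\<bar> * lam * (real m * h)" by (simp only: mult_ac)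
    finally have B: "\<bar>real m * first 0 h (\<lambda>p. q (zm m) (c * p)) - real m * first 0 h (\<lambda>p. q z (c * p))\<bar>
        \<le> 2 * L * \<bar>zm m - z\<bar> * lam"
      by (simp add: h(2) abs_mult flip: right_diff_distrib)
    have "\<bar>real m * step_mean \<psi> s h x - lam * jump_mean \<psi> s x\<bar> < e"
      using A B elim(2,3,4,5) unfolding h_def[symmetric] by linarith
    then show ?case by (simp add: h_def)
  qed
  then show "\<exists>m0. \<forall>m\<ge>m0. norm (real m * step_mean \<psi> s (1 / real m) x - lam * jump_mean \<psi> s x) < e"
    by (simp add: eventually_sequentially)
qed

lemma mean_of_difference_quotient:
  assumes s: "0 < s"
  shows "(\<lambda>m. real m * (mean_of \<psi> s - mean_of \<psi> (s + 1 / real m))) \<longlonglongrightarrow> lam * (\<integral>x. jump_mean \<psi> s x \<partial>g)"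
proof -
  have "(\<lambda>m. \<integral>x. real m * step_mean \<psi> s (1 / real m) x \<partial>g) \<longlonglongrightarrow> (\<integral>x. lam * jump_mean \<psi> s x \<partial>g)"
  proof (rule integral_dominated_convergence[where w = "\<lambda>_. lam"])
    show "AE x in g. (\<lambda>m. real m * step_mean \<psi> s (1 / real m) x) \<longlonglongrightarrow> lam * jump_mean \<psi> s x"
      using step_mean_limit[OF s] by simp
    show "AE x in g. norm (real m * step_mean \<psi> s (1 / real m) x) \<le> lam" for m
    proof (rule AE_I2)
      fix x
      have "real m * \<bar>step_mean \<psi> s (1 / real m) x\<bar> \<le> real m * (lam * (1 / real m))"
        by (intro mult_left_mono step_mean_le) auto
      also have "\<dots> \<le> lam" using lam_pos by (cases "m = 0") auto
      finally show "norm (real m * step_mean \<psi> s (1 / real m) x) \<le> lam" by (simp add: abs_mult)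
    qed
    show "(\<lambda>x. real m * step_mean \<psi> s (1 / real m) x) \<in> borel_measurable g" for m
      using step_mean_measurable[of "1 / real m" s] by measurable
    show "(\<lambda>x. lam * jump_mean \<psi> s x) \<in> borel_measurable g"
      using jump_mean_measurable[of s] by measurable
  qed auto
  moreover have "\<forall>\<^sub>F m in sequentially. (\<integral>x. real m * step_mean \<psi> s (1 / real m) x \<partial>g)
      = real m * (mean_of \<psi> s - mean_of \<psi> (s + 1 / real m))"
    using eventually_gt_at_top[of "0::nat"]
  proof eventually_elim
    case (elim m)
    then show ?case using mean_of_diff[of "1 / real m" s] by simp
  qed
  ultimately show ?thesis by (simp add: Lim_transform_eventually)
qed

lemma mean_of_continuous: "continuous_on S (mean_of \<psi>)"
proof (rule continuous_onI)
  fix s e :: real assume e: "0 < e"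
  show "\<exists>d>0. \<forall>t\<in>S. dist t s < d \<longrightarrow> dist (mean_of \<psi> t) (mean_of \<psi> s) \<le> e"
  proof (intro exI[of _ "e / lam"] conjI ballI impI)
    fix t assume "dist t s < e / lam"
    then have d: "lam * \<bar>t - s\<bar> \<le> e" using lam_pos by (simp add: dist_real_def field_simps)
    have "\<bar>mean_of \<psi> t - mean_of \<psi> s\<bar> \<le> lam * \<bar>t - s\<bar>"
      using mean_of_Lipschitz[of "t - s" s] mean_of_Lipschitz[of "s - t" t]
      by (cases s t rule: linorder_cases) auto
    then show "dist (mean_of \<psi> t) (mean_of \<psi> s) \<le> e" using d by (simp add: dist_real_def)
  qed (use e lam_pos in auto)
qed

text \<open>The derivative of \<open>mean_of \<psi>\<close> is known only from the right and along
  the steps \<open>1 / m\<close>, which the fundamental theorem does not accept. So the difference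
  quotients are integrated instead: exactly through an antiderivative \<Phi> of the continuous
  \<open>mean_of \<psi>\<close>, and in the limit by dominated convergence.\<close>

lemma mean_of_integral:
  assumes t: "0 < t"
  shows "((\<lambda>s. \<integral>x. jump_mean \<psi> s x \<partial>g) has_integral (mean_of \<psi> 0 - mean_of \<psi> t) / lam) {0<..<t}"
proof -
  define F where "F = mean_of \<psi>"
  \<comment> \<open>The larger interval makes the derivatives of \<Phi> two-sided at 0 and up to
    \<open>t + 1\<close>, which is as far as the steps \<open>1 / m\<close> reach.\<close>
  obtain \<Phi> where \<Phi>': "\<And>x. x \<in> {-1..t + 2} \<Longrightarrow> (\<Phi> has_vector_derivative F x) (at x within {-1..t + 2})"
    by (rule antiderivative_continuous[of "-1" "t + 2" F]) (use mean_of_continuous in \<open>auto simp: F_def\<close>)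
  have \<Phi>: "(\<Phi> has_real_derivative F x) (at x)" if "-1 < x" "x < t + 2" for x
    using \<Phi>'[of x] that by (simp add: at_within_Icc_at has_real_derivative_iff_has_vector_derivative)
  define G where "G m s = real m * (F s - F (s + 1 / real m))" for m :: nat and s
  have small: "0 \<le> 1 / real m" "1 / real m \<le> 1" for m :: nat by (cases "m = 0"; simp)+
  have G_int: "(G m has_integral real m * (\<Phi> t - \<Phi> (t + 1 / real m)) - real m * (\<Phi> 0 - \<Phi> (0 + 1 / real m))) {0<..<t}" for m
  proof -
    have "(G m has_integral real m * (\<Phi> t - \<Phi> (t + 1 / real m)) - real m * (\<Phi> 0 - \<Phi> (0 + 1 / real m))) {0..t}"
    proof (rule fundamental_theorem_of_calculus)
      fix s assume s: "s \<in> {0..t}"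
      have "((\<lambda>s. \<Phi> (s + 1 / real m)) has_real_derivative F (s + 1 / real m)) (at s)"
      proof -
        have "-1 < s + 1 / real m" "s + 1 / real m < t + 2"
          using s small[of m] unfolding atLeastAtMost_iff by linarith+
        from \<Phi>[OF this] show ?thesis by (simp add: DERIV_shift)
      qed
      then have "((\<lambda>s. real m * (\<Phi> s - \<Phi> (s + 1 / real m))) has_real_derivative G m s) (at s)"
        unfolding G_def using s by (intro DERIV_cmult DERIV_diff \<Phi>) auto
      then show "((\<lambda>s. real m * (\<Phi> s - \<Phi> (s + 1 / real m))) has_vector_derivative G m s) (at s within {0..t})"
        by (simp add: has_real_derivative_iff_has_vector_derivative has_vector_derivative_at_within)
    qed (use t in simp)
    then show ?thesis by (simp add: has_integral_Icc_iff_Ioo)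
  qed
  have quot: "(\<lambda>m. real m * (\<Phi> x - \<Phi> (x + 1 / real m))) \<longlonglongrightarrow> - F x" if "-1 < x" "x < t + 2" for x
  proof -
    have "((\<lambda>h. (\<Phi> (x + h) - \<Phi> x) / h) \<longlongrightarrow> F x) (at 0)" using \<Phi>[OF that] by (simp add: DERIV_def)
    moreover have "filterlim (\<lambda>m. 1 / real m) (at 0) sequentially"
    proof (rule filterlim_atI)
      show "(\<lambda>m. 1 / real m) \<longlonglongrightarrow> 0" by real_asymp
      show "\<forall>\<^sub>F m in sequentially. 1 / real m \<noteq> 0" using eventually_gt_at_top[of "0::nat"] by eventually_elim auto
    qed
    ultimately have "(\<lambda>m. (\<Phi> (x + 1 / real m) - \<Phi> x) / (1 / real m)) \<longlonglongrightarrow> F x"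
      by (rule filterlim_compose)
    from tendsto_minus[OF this] show ?thesis by (simp add: algebra_simps)
  qed
  have bound: "norm (G m s) \<le> lam" for m s
  proof (cases "m = 0")
    case False
    then have "real m * \<bar>F s - F (s + 1 / real m)\<bar> \<le> real m * (lam * (1 / real m))"
      unfolding F_def by (intro mult_left_mono mean_of_Lipschitz) auto
    then show ?thesis using False by (simp add: G_def abs_mult)
  qed (use lam_pos in \<open>simp add: G_def\<close>)
  define D where "D s = lam * (\<integral>x. jump_mean \<psi> s x \<partial>g)" for s
  have conv: "(\<lambda>m. G m s) \<longlonglongrightarrow> D s" if "s \<in> {0<..<t}" for s
    using mean_of_difference_quotient[of s] that by (simp add: G_def F_def D_def)
  have G_on: "G m integrable_on {0<..<t}" for m using G_int by (rule has_integral_integrable)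
  have c_on: "(\<lambda>_. lam) integrable_on {0<..<t}" using integrable_const_ivl[of lam 0 t] by (simp add: integrable_on_Icc_iff_Ioo)
  have D_on: "D integrable_on {0<..<t}" and lim: "(\<lambda>m. integral {0<..<t} (G m)) \<longlonglongrightarrow> integral {0<..<t} D"
    using dominated_convergence[OF G_on c_on bound conv] by auto
  have "(\<lambda>m. integral {0<..<t} (G m)) \<longlonglongrightarrow> - F t - (- F 0)"
    using tendsto_diff[OF quot[of t] quot[of 0]] t by (simp add: integral_unique[OF G_int])
  with lim have "integral {0<..<t} D = - F t - (- F 0)" by (rule LIMSEQ_unique)
  with D_on have "(D has_integral F 0 - F t) {0<..<t}" by (metis has_integral_integral minus_diff_minus minus_diff_eq)
  from has_integral_mult_right[OF this, of "1 / lam"] show ?thesis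
    using lam_pos by (simp add: D_def F_def)
qed

lemma mean_of_tendsto: "(mean_of \<psi> \<longlongrightarrow> \<psi> 0) at_top"
proof -
  have "((\<lambda>t. \<integral>x. \<psi> (root_flow t x) \<partial>g) \<longlongrightarrow> (\<integral>x. \<psi> 0 \<partial>g)) at_top"
  proof (rule integral_dominated_convergence_at_top[where w = "\<lambda>_. 1"])
    show "AE x in g. ((\<lambda>t. \<psi> (root_flow t x)) \<longlongrightarrow> \<psi> 0) at_top"
      using AE_g_pos
    proof eventually_elim
      case (elim x)
      then have "((\<lambda>t. root_flow t x) \<longlongrightarrow> 0) at_top"
        unfolding root_flow_def by (intro flow_vector_tendsto_0) (simp add: less_imp_le)
      moreover have "isCont \<psi> 0" using \<psi>_continuous by (simp add: continuous_on_eq_continuous_at)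
      ultimately show ?case by (metis isCont_tendsto_compose)
    qed
    show "\<forall>\<^sub>F t in at_top. AE x in g. norm (\<psi> (root_flow t x)) \<le> 1"
      using \<psi>_bound by (intro always_eventually allI AE_I2) simp
  qed auto
  then show ?thesis by (simp add: mean_of_def[abs_def] g.prob_space)
qed

end

declare \<psi>_measurable [measurable del]

end

section \<open>Ramp functions and Pareto marks\<close>

definition ramp :: "real \<Rightarrow> real \<Rightarrow> real \<Rightarrow> real" where
  "ramp c d v = min 1 (max 0 ((v - c) / (d - c)))"

lemma ramp_nonneg: "0 \<le> ramp c d v" and ramp_le_1: "ramp c d v \<le> 1"
  by (auto simp: ramp_def)

lemma ramp_eq_0: "c < d \<Longrightarrow> v \<le> c \<Longrightarrow> ramp c d v = 0"
  by (auto simp: ramp_def divide_nonpos_pos)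

lemma ramp_eq_1: "c < d \<Longrightarrow> d \<le> v \<Longrightarrow> ramp c d v = 1"
  by (auto simp: ramp_def min_def max_def field_simps)

lemma ramp_mono: "c < d \<Longrightarrow> u \<le> v \<Longrightarrow> ramp c d u \<le> ramp c d v"
  unfolding ramp_def by (intro min.mono max.mono divide_right_mono) auto

lemma ramp_diff_le: "c < d \<Longrightarrow> \<bar>ramp c d u - ramp c d v\<bar> \<le> 1 / (d - c) * \<bar>u - v\<bar>"
proof -
  assume cd: "c < d"
  have "\<bar>min 1 (max 0 x) - min 1 (max 0 y)\<bar> \<le> \<bar>x - y\<bar>" for x y :: real
    by (auto simp: min_def max_def)
  from this[of "(u - c) / (d - c)" "(v - c) / (d - c)"] have
    "\<bar>ramp c d u - ramp c d v\<bar> \<le> \<bar>(u - c) / (d - c) - (v - c) / (d - c)\<bar>" by (simp add: ramp_def)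
  also have "(u - c) / (d - c) - (v - c) / (d - c) = (u - v) / (d - c)"
    by (simp flip: diff_divide_distrib)
  finally show ?thesis using cd by (simp add: abs_divide)
qed

lemma ramp_measurable [measurable]: "ramp c d \<in> borel_measurable borel"
  unfolding ramp_def by measurable

lemma prob_space_uniform_Icc: "c < d \<Longrightarrow> prob_space (uniform_measure lborel {c..d::real})"
  by (rule prob_space_uniform_measure) auto

lemma AE_uniform_Icc: "AE u in uniform_measure lborel {c..d::real}. u \<in> {c..d}"
  by (rule AE_uniform_measureI) auto

text \<open>A ramp is the distribution function of a uniform threshold. This trades continuous test
  functions for averages of tail probabilities, the quantities that the Pareto law supplies.\<close>

lemma ramp_eq_measure:
  assumes "c < d"
  shows "ramp c d v = measure (uniform_measure lborel {c..d}) {u. u < v}"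
proof -
  have "measure (uniform_measure lborel {c..d}) {..<v} = measure lborel ({c..d} \<inter> {..<v}) / measure lborel {c..d}"
    using assms by (intro measure_uniform_measure) auto
  moreover have "{c..d} \<inter> {..<v} = (if v \<le> c then {} else if d < v then {c..d} else {c..<v})" by auto
  ultimately have "measure (uniform_measure lborel {c..d}) {..<v} = ramp c d v"
    using assms by (auto simp: ramp_def min_def max_def field_simps)
  then show ?thesis by (simp add: lessThan_def)
qed

lemma (in prob_space) expectation_ramp:
  assumes cd: "c < d" and [measurable]: "Y \<in> borel_measurable M"
  shows "expectation (\<lambda>\<omega>. ramp c d (Y \<omega>)) = (\<integral>u. prob {\<omega> \<in> space M. u < Y \<omega>} \<partial>uniform_measure lborel {c..d})"
proof -
  define \<nu> where "\<nu> = uniform_measure lborel {c..d}"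
  interpret \<nu>: prob_space \<nu> unfolding \<nu>_def by (rule prob_space_uniform_Icc[OF cd])
  have [measurable_cong]: "sets \<nu> = sets borel" by (simp add: \<nu>_def)
  interpret pair: pair_prob_space M \<nu> ..
  define f where "f \<omega> u = (if u < Y \<omega> then 1 else 0 :: real)" for \<omega> u
  have int: "integrable (M \<Otimes>\<^sub>M \<nu>) (case_prod f)"
  proof (rule pair.P.integrable_const_bound[of _ 1])
    show "case_prod f \<in> borel_measurable (M \<Otimes>\<^sub>M \<nu>)" unfolding f_def by measurable
  qed (auto simp: f_def)
  have "(\<integral>u. f \<omega> u \<partial>\<nu>) = ramp c d (Y \<omega>)" for \<omega>
  proof -
    have "(\<integral>u. f \<omega> u \<partial>\<nu>) = (\<integral>u. indicator {..<Y \<omega>} u \<partial>\<nu>)"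
      by (intro Bochner_Integration.integral_cong) (auto simp: f_def)
    also have "\<dots> = measure \<nu> {..<Y \<omega>}" by simp
    finally show ?thesis using ramp_eq_measure[OF cd, of "Y \<omega>"] by (simp add: \<nu>_def lessThan_def)
  qed
  moreover have "(\<integral>\<omega>. f \<omega> u \<partial>M) = prob {\<omega> \<in> space M. u < Y \<omega>}" for u
  proof -
    have "(\<integral>\<omega>. f \<omega> u \<partial>M) = (\<integral>\<omega>. indicator {\<omega> \<in> space M. u < Y \<omega>} \<omega> \<partial>M)"
      by (intro Bochner_Integration.integral_cong) (auto simp: f_def)
    then show ?thesis by simp
  qed
  ultimately show ?thesis using pair.Fubini_integral[OF int] by (simp add: \<nu>_def)
qed

text \<open>The singularity at 0 is integrable because \<open>\<alpha> < 1\<close>.\<close>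

lemma powr_integrable_uniform:
  assumes "\<alpha> < 1"
  shows "integrable (uniform_measure lborel {0..1::real}) (\<lambda>u. u powr (- \<alpha>))"
proof -
  have "((\<lambda>u. u powr (- \<alpha>)) has_integral (1 powr (- \<alpha> + 1) / (- \<alpha> + 1))) {0..1}"
    using assms by (intro has_integral_powr_from_0) auto
  then have "(\<lambda>u. u powr (- \<alpha>)) absolutely_integrable_on {0..1}"
    by (intro nonnegative_absolutely_integrable_1 has_integral_integrable) auto
  then have "set_integrable lborel {0..1} (\<lambda>u. u powr (- \<alpha>))"
    unfolding absolutely_integrable_on_def set_integrable_def
    by (subst (asm) integrable_completion) auto
  then have "integrable (density lborel (\<lambda>u. ennreal (indicator {0..1} u))) (\<lambda>u. u powr (- \<alpha>))"
    unfolding set_integrable_def by (subst integrable_density) auto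
  moreover have "density lborel (\<lambda>u. ennreal (indicator {0..1} u)) = uniform_measure lborel {0..1::real}"
    unfolding uniform_measure_def by (intro density_cong) (auto simp: indicator_def)
  ultimately show ?thesis by simp
qed

section \<open>Jumps of a single Pareto mark\<close>

locale pareto_network = stationary_network r trib K H a M lam k N T P g
  for r :: "'e::finite" and trib :: "'e \<Rightarrow> 'e set" and K H a :: "real ^ 'e"
    and M :: "'w measure" and lam k :: real
    and N :: "real \<Rightarrow> 'w \<Rightarrow> nat" and T P :: "nat \<Rightarrow> 'w \<Rightarrow> real"
    and g :: "(real ^ ('e + 'e)) measure" +
  fixes \<alpha> :: real
  assumes \<alpha>: "0 < \<alpha>" "\<alpha> < 1"
    and Pareto: "k \<le> x \<Longrightarrow> prob {\<omega> \<in> space M. x < P 1 \<omega>} = (k / x) powr \<alpha>"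
begin

lemma Pareto_le:
  assumes "0 < v"
  shows "prob {\<omega> \<in> space M. v < P 1 \<omega>} \<le> (k / v) powr \<alpha>"
proof (cases "k \<le> v")
  case False
  then have "1 \<le> (k / v) powr \<alpha>" using assms \<alpha> by (intro ge_one_powr_ge_zero) auto
  then show ?thesis using prob_le_1 order_trans by blast
next
  case True
  then show ?thesis using Pareto by (intro eq_refl)
qed

text \<open>Truncation at 1 is the ramp from 0 to 1. Averaging the tails at the levels
  \<open>u / y\<close> gives \<open>y powr \<alpha>\<close> times the integral of
  \<open>u powr (- \<alpha>)\<close> over [0, 1].\<close>

lemma truncated_mark_bound:
  obtains C where "0 < C" "\<And>y. 0 < y \<Longrightarrow> expectation (\<lambda>\<omega>. min 1 (y * P 1 \<omega>)) \<le> C * y powr \<alpha>"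
proof -
  define \<nu> where "\<nu> = uniform_measure lborel {0..1::real}"
  interpret \<nu>: prob_space \<nu> unfolding \<nu>_def by (rule prob_space_uniform_Icc) simp
  have int: "integrable \<nu> (\<lambda>u. u powr (- \<alpha>))"
    unfolding \<nu>_def by (rule powr_integrable_uniform[OF \<alpha>(2)])
  define C where "C = k powr \<alpha> * (\<integral>u. u powr (- \<alpha>) \<partial>\<nu>)"
  have bound: "expectation (\<lambda>\<omega>. min 1 (y * P 1 \<omega>)) \<le> C * y powr \<alpha>" if y: "0 < y" for y
  proof -
    have "expectation (\<lambda>\<omega>. min 1 (y * P 1 \<omega>)) = expectation (\<lambda>\<omega>. ramp 0 1 (y * P 1 \<omega>))"
    proof (rule integral_cong_AE)
      show "AE \<omega> in M. min 1 (y * P 1 \<omega>) = ramp 0 1 (y * P 1 \<omega>)"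
        using P_ge[OF order_refl] by eventually_elim (use y k_pos in \<open>simp add: ramp_def max_def\<close>)
    qed measurable
    also have "\<dots> = (\<integral>u. prob {\<omega> \<in> space M. u < y * P 1 \<omega>} \<partial>\<nu>)"
      unfolding \<nu>_def by (rule expectation_ramp) auto
    also have "\<dots> \<le> (\<integral>u. (k powr \<alpha> * y powr \<alpha>) * u powr (- \<alpha>) \<partial>\<nu>)"
    proof (rule integral_mono_AE)
      have "AE u in \<nu>. u \<in> {0<..1}"
        unfolding \<nu>_def using AE_lborel_singleton[of 0]
        by (intro AE_uniform_measureI) (auto elim!: eventually_mono)
      then show "AE u in \<nu>. prob {\<omega> \<in> space M. u < y * P 1 \<omega>} \<le> (k powr \<alpha> * y powr \<alpha>) * u powr (- \<alpha>)"
      proof eventually_elim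
        case (elim u)
        have "{\<omega> \<in> space M. u < y * P 1 \<omega>} = {\<omega> \<in> space M. u / y < P 1 \<omega>}"
          using y by (auto simp: field_simps)
        then have "prob {\<omega> \<in> space M. u < y * P 1 \<omega>} \<le> (k / (u / y)) powr \<alpha>"
          using Pareto_le[of "u / y"] elim y by simp
        also have "\<dots> = (k powr \<alpha> * y powr \<alpha>) * u powr (- \<alpha>)"
          using elim y k_pos by (simp add: powr_divide powr_mult powr_minus inverse_powr divide_inverse)
        finally show ?case .
      qed
      show "integrable \<nu> (\<lambda>u. prob {\<omega> \<in> space M. u < y * P 1 \<omega>})"
      proof (rule \<nu>.integrable_const_bound[of _ 1])
        show "(\<lambda>u. prob {\<omega> \<in> space M. u < y * P 1 \<omega>}) \<in> borel_measurable \<nu>"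
          unfolding \<nu>_def by measurable
      qed auto
    qed (use int in auto)
    also have "\<dots> = C * y powr \<alpha>" by (simp add: C_def)
    finally show ?thesis .
  qed
  \<comment> \<open>Enlarging the constant to \<open>\<bar>C\<bar> + 1\<close> only serves to make
    it positive.\<close>
  have "expectation (\<lambda>\<omega>. min 1 (y * P 1 \<omega>)) \<le> (\<bar>C\<bar> + 1) * y powr \<alpha>" if "0 < y" for y
  proof -
    have "C * y powr \<alpha> \<le> (\<bar>C\<bar> + 1) * y powr \<alpha>" by (intro mult_right_mono) auto
    then show ?thesis using bound[OF that] by linarith
  qed
  then show ?thesis by (intro that[of "\<bar>C\<bar> + 1"]) auto
qed

definition scaled_ramp :: "real \<Rightarrow> real \<Rightarrow> real \<Rightarrow> real \<Rightarrow> real" where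
  "scaled_ramp c d x v = ramp c d (v / x)"

text \<open>The tail factor \<open>u powr (- \<alpha>)\<close> averaged over thresholds in [c, d];
  the indicator at level 1 would give 1.\<close>

definition ramp_moment :: "real \<Rightarrow> real \<Rightarrow> real" where
  "ramp_moment c d = (\<integral>u. u powr (- \<alpha>) \<partial>uniform_measure lborel {c..d})"

lemma scaled_ramp_properties:
  assumes "c < d" "0 < x"
  shows "0 \<le> scaled_ramp c d x v" "scaled_ramp c d x v \<le> 1"
    "\<bar>scaled_ramp c d x u - scaled_ramp c d x v\<bar> \<le> 1 / ((d - c) * x) * \<bar>u - v\<bar>"
    "0 < 1 / ((d - c) * x)" "(scaled_ramp c d x \<longlongrightarrow> 1) at_top"
    "u \<le> v \<Longrightarrow> scaled_ramp c d x u \<le> scaled_ramp c d x v"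
proof -
  show "0 \<le> scaled_ramp c d x v" "scaled_ramp c d x v \<le> 1"
    by (auto simp: scaled_ramp_def ramp_nonneg ramp_le_1)
  have "\<bar>scaled_ramp c d x u - scaled_ramp c d x v\<bar> \<le> 1 / (d - c) * \<bar>u / x - v / x\<bar>"
    unfolding scaled_ramp_def by (rule ramp_diff_le[OF assms(1)])
  also have "\<bar>u / x - v / x\<bar> = \<bar>u - v\<bar> / x"
    using assms by (simp add: abs_divide flip: diff_divide_distrib)
  finally show "\<bar>scaled_ramp c d x u - scaled_ramp c d x v\<bar> \<le> 1 / ((d - c) * x) * \<bar>u - v\<bar>" by simp
  show "0 < 1 / ((d - c) * x)" using assms by simp
  show "(scaled_ramp c d x \<longlongrightarrow> 1) at_top"
  proof (rule tendsto_eventually)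
    show "\<forall>\<^sub>F v in at_top. scaled_ramp c d x v = 1"
      using eventually_ge_at_top[of "d * x"]
      by eventually_elim (use assms in \<open>simp add: scaled_ramp_def ramp_eq_1 field_simps\<close>)
  qed
  show "scaled_ramp c d x u \<le> scaled_ramp c d x v" if "u \<le> v"
    unfolding scaled_ramp_def using assms that by (intro ramp_mono divide_right_mono) auto
qed

lemma scaled_ramp_measurable [measurable]: "scaled_ramp c d x \<in> borel_measurable borel"
  unfolding scaled_ramp_def by measurable

lemma jump_mean_nonneg:
  assumes "c < d" "0 < x" "0 \<le> s"
  shows "0 \<le> jump_mean (scaled_ramp c d x) s z"
  unfolding jump_mean_def
proof (rule integral_nonneg_AE)
  show "AE \<omega> in M. 0 \<le> scaled_ramp c d x (root_flow s z + response s * P 1 \<omega>) - scaled_ramp c d x (root_flow s z)"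
    using P_ge[OF order_refl]
  proof eventually_elim
    case (elim \<omega>)
    then have "0 \<le> response s * P 1 \<omega>" using response_nonneg[OF assms(3)] k_pos by simp
    then show ?case using scaled_ramp_properties(6)[OF assms(1,2)] by simp
  qed
qed

text \<open>The ramp has Lipschitz constant \<open>1 / ((d - c) * x)\<close> and height 1, so the
  truncated mark bound applies and its power of \<open>x\<close> cancels. No dependence on
  \<open>x\<close> and the state remains, as dominated convergence requires.\<close>

lemma jump_mean_bound:
  assumes cd: "c < d"
  obtains C where "0 < C" "\<And>x s z. 0 < x \<Longrightarrow> 0 < s \<Longrightarrow>
    x powr \<alpha> * jump_mean (scaled_ramp c d x) s z \<le> C * response s powr \<alpha>"
proof -
  obtain C where C: "0 < C" "\<And>y. 0 < y \<Longrightarrow> expectation (\<lambda>\<omega>. min 1 (y * P 1 \<omega>)) \<le> C * y powr \<alpha>"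
    by (rule truncated_mark_bound, rule that; blast)
  have "x powr \<alpha> * jump_mean (scaled_ramp c d x) s z \<le> C / (d - c) powr \<alpha> * response s powr \<alpha>"
    if x: "0 < x" and s: "0 < s" for x s z
  proof -
    define y where "y = response s / ((d - c) * x)"
    have y: "0 < y" using response_pos[OF s] x cd by (simp add: y_def)
    have diff_le: "\<bar>scaled_ramp c d x u - scaled_ramp c d x v\<bar> \<le> 1" for u v
      using scaled_ramp_properties(1,2)[OF cd x, of u] scaled_ramp_properties(1,2)[OF cd x, of v] by linarith
    have "jump_mean (scaled_ramp c d x) s z \<le> expectation (\<lambda>\<omega>. min 1 (y * P 1 \<omega>))"
      unfolding jump_mean_def
    proof (rule integral_mono_AE)
      show "integrable M (\<lambda>\<omega>. scaled_ramp c d x (root_flow s z + response s * P 1 \<omega>) - scaled_ramp c d x (root_flow s z))"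
        using diff_le by (intro integrable_bounded[of _ 1] AE_I2) auto
      show "integrable M (\<lambda>\<omega>. min 1 (y * P 1 \<omega>))"
      proof (rule integrable_bounded[of _ 1])
        show "AE \<omega> in M. \<bar>min 1 (y * P 1 \<omega>)\<bar> \<le> 1"
          using P_ge[OF order_refl] by eventually_elim (use y k_pos in \<open>simp add: abs_le_iff min_def\<close>)
      qed measurable
      show "AE \<omega> in M. scaled_ramp c d x (root_flow s z + response s * P 1 \<omega>) - scaled_ramp c d x (root_flow s z)
          \<le> min 1 (y * P 1 \<omega>)"
        using P_ge[OF order_refl]
      proof eventually_elim
        case (elim \<omega>)
        have "0 \<le> response s * P 1 \<omega>" using elim response_pos[OF s] k_pos by simp
        then have "scaled_ramp c d x (root_flow s z + response s * P 1 \<omega>) - scaled_ramp c d x (root_flow s z) \<le> y * P 1 \<omega>"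
          using scaled_ramp_properties(3)[OF cd x, of "root_flow s z + response s * P 1 \<omega>" "root_flow s z"]
          by (simp add: y_def)
        moreover have "scaled_ramp c d x (root_flow s z + response s * P 1 \<omega>) - scaled_ramp c d x (root_flow s z) \<le> 1"
          using diff_le abs_le_D1 by blast
        ultimately show ?case by simp
      qed
    qed
    also have "\<dots> \<le> C * y powr \<alpha>" by (rule C(2)[OF y])
    finally have "x powr \<alpha> * jump_mean (scaled_ramp c d x) s z \<le> x powr \<alpha> * (C * y powr \<alpha>)"
      by (rule mult_left_mono) simp
    also have "y powr \<alpha> = response s powr \<alpha> / ((d - c) powr \<alpha> * x powr \<alpha>)"
      using x cd response_pos[OF s] by (simp add: y_def powr_divide powr_mult)
    also have "x powr \<alpha> * (C * (response s powr \<alpha> / ((d - c) powr \<alpha> * x powr \<alpha>)))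
        = C / (d - c) powr \<alpha> * response s powr \<alpha>"
      using x by simp
    finally show ?thesis .
  qed
  then show ?thesis using C(1) cd by (intro that[of "C / (d - c) powr \<alpha>"]) auto
qed

text \<open>The current discharge is fixed and therefore negligible against \<open>x\<close>: the
  ramp vanishes there for large \<open>x\<close>, and the tail of one mark at level
  \<open>u * x\<close> gives the limit for each threshold \<open>u\<close>.\<close>

lemma jump_mean_limit:
  assumes cd: "0 < c" "c < d" and s: "0 < s"
  shows "((\<lambda>x. x powr \<alpha> * jump_mean (scaled_ramp c d x) s z) \<longlongrightarrow> (k * response s) powr \<alpha> * ramp_moment c d) at_top"
proof -
  define b where "b = response s"
  define y where "y = root_flow s z"
  define \<nu> where "\<nu> = uniform_measure lborel {c..d}"
  interpret \<nu>: prob_space \<nu> unfolding \<nu>_def by (rule prob_space_uniform_Icc[OF cd(2)])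
  have b: "0 < b" using response_pos[OF s] by (simp add: b_def)
  define p where "p x u = x powr \<alpha> * prob {\<omega> \<in> space M. u < (y + b * P 1 \<omega>) / x}" for x u
  \<comment> \<open>The second condition puts every threshold \<open>u >= c\<close> into the range
    where the Pareto formula is exact; the third keeps \<open>u - y / x\<close> above
    \<open>c / 2\<close>, which yields the majorant.\<close>
  have large: "\<forall>\<^sub>F x in at_top. 0 < x \<and> k * b \<le> c * x - y \<and> y / x \<le> c / 2"
  proof (intro eventually_conj)
    show "\<forall>\<^sub>F x::real in at_top. 0 < x" by (rule eventually_gt_at_top)
    show "\<forall>\<^sub>F x in at_top. k * b \<le> c * x - y"
      using cd(1) by real_asymp
    show "\<forall>\<^sub>F x in at_top. y / x \<le> c / 2"
      using cd(1) by real_asymp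
  qed
  have p_eq: "p x u = (k * b) powr \<alpha> * (u - y / x) powr (- \<alpha>)"
    if x: "0 < x" "k * b \<le> c * x - y" and u: "c \<le> u" for x u
  proof -
    have "c * x \<le> u * x" using x u by simp
    then have kb: "k * b \<le> u * x - y" using x by linarith
    then have pos: "0 < u * x - y" using b k_pos by (intro less_le_trans[OF _ kb]) simp
    have "{\<omega> \<in> space M. u < (y + b * P 1 \<omega>) / x} = {\<omega> \<in> space M. (u * x - y) / b < P 1 \<omega>}"
      using x b by (auto simp: field_simps)
    moreover have "k \<le> (u * x - y) / b" using kb b by (simp add: field_simps)
    ultimately have "prob {\<omega> \<in> space M. u < (y + b * P 1 \<omega>) / x} = (k / ((u * x - y) / b)) powr \<alpha>"
      using Pareto by simp
    also have "k / ((u * x - y) / b) = (k * b) * inverse (u - y / x) / x"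
      using x pos b by (simp add: field_simps)
    also have "\<dots> powr \<alpha> = (k * b) powr \<alpha> * (u - y / x) powr (- \<alpha>) / x powr \<alpha>"
    proof -
      have "0 < u - y / x" using x pos by (simp add: field_simps)
      then show ?thesis using x b k_pos by (simp add: powr_mult powr_divide powr_minus inverse_powr)
    qed
    finally show ?thesis using x by (simp add: p_def)
  qed
  have "((\<lambda>x. \<integral>u. p x u \<partial>\<nu>) \<longlongrightarrow> (\<integral>u. (k * b) powr \<alpha> * u powr (- \<alpha>) \<partial>\<nu>)) at_top"
  proof (rule integral_dominated_convergence_at_top[where w = "\<lambda>_. (k * b) powr \<alpha> * (c / 2) powr (- \<alpha>)"])
    have \<nu>_Icc: "AE u in \<nu>. u \<in> {c..d}" unfolding \<nu>_def by (rule AE_uniform_Icc)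
    show "AE u in \<nu>. ((\<lambda>x. p x u) \<longlongrightarrow> (k * b) powr \<alpha> * u powr (- \<alpha>)) at_top"
      using \<nu>_Icc
    proof eventually_elim
      case (elim u)
      have "((\<lambda>x. y / x) \<longlongrightarrow> 0) at_top" by real_asymp
      then have "((\<lambda>x. (k * b) powr \<alpha> * (u - y / x) powr (- \<alpha>)) \<longlongrightarrow> (k * b) powr \<alpha> * (u - 0) powr (- \<alpha>)) at_top"
        using elim cd by (intro tendsto_intros) auto
      moreover have "\<forall>\<^sub>F x in at_top. (k * b) powr \<alpha> * (u - y / x) powr (- \<alpha>) = p x u"
        using large by eventually_elim (use elim in \<open>simp add: p_eq\<close>)
      ultimately show ?case by (simp add: Lim_transform_eventually)
    qed
    show "\<forall>\<^sub>F x in at_top. AE u in \<nu>. norm (p x u) \<le> (k * b) powr \<alpha> * (c / 2) powr (- \<alpha>)"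
      using large
    proof eventually_elim
      case (elim x)
      show ?case using \<nu>_Icc
      proof eventually_elim
        case (elim u)
        have "(u - y / x) powr (- \<alpha>) \<le> (c / 2) powr (- \<alpha>)"
          using \<open>0 < x \<and> k * b \<le> c * x - y \<and> y / x \<le> c / 2\<close> elim cd \<alpha> by (intro powr_mono2') auto
        then show ?case
          using \<open>0 < x \<and> k * b \<le> c * x - y \<and> y / x \<le> c / 2\<close> elim
          by (simp add: p_eq abs_mult mult_left_mono)
      qed
    qed
    show "(\<lambda>u. (k * b) powr \<alpha> * u powr - \<alpha>) \<in> borel_measurable \<nu>" unfolding \<nu>_def by measurable
    show "p x \<in> borel_measurable \<nu>" for x unfolding \<nu>_def p_def by measurable
  qed auto
  moreover have "\<forall>\<^sub>F x in at_top. (\<integral>u. p x u \<partial>\<nu>) = x powr \<alpha> * jump_mean (scaled_ramp c d x) s z"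
    using large
  proof eventually_elim
    case (elim x)
    then have "y / x \<le> c" using cd(1) by linarith
    then have "scaled_ramp c d x y = 0" using cd by (simp add: scaled_ramp_def ramp_eq_0)
    then have "jump_mean (scaled_ramp c d x) s z = expectation (\<lambda>\<omega>. ramp c d ((y + b * P 1 \<omega>) / x))"
      by (simp add: jump_mean_def y_def b_def scaled_ramp_def)
    also have "\<dots> = (\<integral>u. prob {\<omega> \<in> space M. u < (y + b * P 1 \<omega>) / x} \<partial>\<nu>)"
      unfolding \<nu>_def by (rule expectation_ramp[OF cd(2)]) measurable
    finally show ?case by (simp add: p_def)
  qed
  ultimately have "((\<lambda>x. x powr \<alpha> * jump_mean (scaled_ramp c d x) s z)
      \<longlongrightarrow> (\<integral>u. (k * b) powr \<alpha> * u powr (- \<alpha>) \<partial>\<nu>)) at_top"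
    by (rule Lim_transform_eventually)
  then show ?thesis by (simp add: ramp_moment_def b_def \<nu>_def)
qed

lemma ramp_moment_bounds:
  assumes "0 < c" "c < d"
  shows "d powr (- \<alpha>) \<le> ramp_moment c d" "ramp_moment c d \<le> c powr (- \<alpha>)"
proof -
  define \<nu> where "\<nu> = uniform_measure lborel {c..d}"
  interpret \<nu>: prob_space \<nu> unfolding \<nu>_def by (rule prob_space_uniform_Icc[OF assms(2)])
  have le: "AE u in \<nu>. d powr (- \<alpha>) \<le> u powr (- \<alpha>) \<and> u powr (- \<alpha>) \<le> c powr (- \<alpha>)"
    using AE_uniform_Icc[of c d, folded \<nu>_def]
    by eventually_elim (use assms \<alpha> in \<open>auto intro!: powr_mono2'\<close>)
  have int: "integrable \<nu> (\<lambda>u. u powr (- \<alpha>))"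
  proof (rule \<nu>.integrable_const_bound[of _ "c powr (- \<alpha>)"])
    show "AE u in \<nu>. norm (u powr (- \<alpha>)) \<le> c powr (- \<alpha>)" using le by eventually_elim simp
    show "(\<lambda>u. u powr (- \<alpha>)) \<in> borel_measurable \<nu>" unfolding \<nu>_def by measurable
  qed
  have "(\<integral>u. d powr (- \<alpha>) \<partial>\<nu>) \<le> (\<integral>u. u powr (- \<alpha>) \<partial>\<nu>)"
    by (rule integral_mono_AE) (use int le in \<open>auto elim: eventually_mono\<close>)
  then show "d powr (- \<alpha>) \<le> ramp_moment c d" by (simp add: ramp_moment_def \<nu>_def[symmetric] \<nu>.prob_space)
  have "(\<integral>u. u powr (- \<alpha>) \<partial>\<nu>) \<le> (\<integral>u. c powr (- \<alpha>) \<partial>\<nu>)"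
    by (rule integral_mono_AE) (use int le in \<open>auto elim: eventually_mono\<close>)
  then show "ramp_moment c d \<le> c powr (- \<alpha>)" by (simp add: ramp_moment_def \<nu>_def[symmetric] \<nu>.prob_space)
qed

end

section \<open>The tail of the stationary discharge and its constant\<close>

context pareto_network
begin

lemma response_powr_bound:
  obtains B \<mu> where "0 < \<mu>" "0 \<le> B" "\<And>s. 0 \<le> s \<Longrightarrow> response s powr \<alpha> \<le> B * exp (- \<mu> * s)"
proof -
  obtain C \<mu> where C: "0 < \<mu>" "0 < C"
    "\<And>s x i. \<lbrakk>0 \<le> s; \<And>j. 0 \<le> x $ j\<rbrakk> \<Longrightarrow> (flow s *v x) $ i \<le> C * (\<Sum>j\<in>UNIV. x $ j) * exp (- (\<mu> * s))"
    by (rule flow_vector_decay, rule that; blast)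
  define B where "B = (C * (\<Sum>j\<in>UNIV. input $ j)) powr \<alpha>"
  have "response s powr \<alpha> \<le> B * exp (- (\<mu> * \<alpha>) * s)" if s: "0 \<le> s" for s
  proof -
    have "0 \<le> C * (\<Sum>j\<in>UNIV. input $ j)" using C(2) input_nonneg by (simp add: sum_nonneg)
    moreover have "response s powr \<alpha> \<le> (C * (\<Sum>j\<in>UNIV. input $ j) * exp (- (\<mu> * s))) powr \<alpha>"
      using C(3)[OF s input_nonneg, of "Inl r"] response_nonneg[OF s] \<alpha>
      by (intro powr_mono2) (auto simp: response_def)
    ultimately show ?thesis by (simp add: B_def powr_mult powr_def[of "exp _"] mult_ac)
  qed
  then show ?thesis using C(1) \<alpha> by (intro that[of "\<mu> * \<alpha>" B]) (auto simp: B_def)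
qed

lemma exp_integrable_on_Ioi:
  assumes "0 < \<mu>"
  shows "(\<lambda>s. B * exp (- \<mu> * s)) integrable_on {(0::real)<..}"
proof -
  have "(\<lambda>s. exp (- \<mu> * s)) absolutely_integrable_on {0..}"
    using has_integral_exp_minus_to_infinity[OF assms, of 0]
    by (intro nonnegative_absolutely_integrable_1 has_integral_integrable) auto
  then have "(\<lambda>s. exp (- \<mu> * s)) absolutely_integrable_on {0<..}"
    by (rule set_integrable_subset) auto
  then have "(\<lambda>s. exp (- \<mu> * s)) integrable_on {0<..}"
    by (rule set_lebesgue_integral_eq_integral(1))
  then show ?thesis by (rule integrable_on_mult_right)
qed

definition response_integral :: real where
  "response_integral = integral {0<..} (\<lambda>s. response s powr \<alpha>)"

text \<open>
  The equation \<open>mean_of \<psi> 0 = lam * (integral of the mean jumps)\<close> turns the tail of the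
  stationary discharge into an integral of tails of single marks.
\<close>

lemma mean_of_ramp_limit:
  assumes cd: "0 < c" "c < d"
  shows "(\<lambda>s. response s powr \<alpha>) integrable_on {0<..}"
    and "((\<lambda>x. x powr \<alpha> * mean_of (scaled_ramp c d x) 0)
      \<longlongrightarrow> lam * k powr \<alpha> * ramp_moment c d * response_integral) at_top"
proof -
  define D where "D x s = (\<integral>z. jump_mean (scaled_ramp c d x) s z \<partial>g)" for x s
  define R where "R s = (k * response s) powr \<alpha> * ramp_moment c d" for s
  obtain C where C: "0 < C" "\<And>x s z. 0 < x \<Longrightarrow> 0 < s \<Longrightarrow>
      x powr \<alpha> * jump_mean (scaled_ramp c d x) s z \<le> C * response s powr \<alpha>"
    by (rule jump_mean_bound[OF cd(2)], rule that; blast)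
  obtain B \<mu> where B: "0 < \<mu>" "0 \<le> B" "\<And>s. 0 \<le> s \<Longrightarrow> response s powr \<alpha> \<le> B * exp (- \<mu> * s)"
    by (rule response_powr_bound, rule that; blast)
  \<comment> \<open>A majorant for the scaled jump means that is uniform in the level
    \<open>x\<close> and in the state, and integrable in \<open>s\<close>.\<close>
  define E where "E s = (C * B) * exp (- \<mu> * s)" for s
  have E_on: "E integrable_on {0<..}" unfolding E_def by (rule exp_integrable_on_Ioi[OF B(1)])
  have jm: "jump_mean (scaled_ramp c d x) s \<in> borel_measurable g" if "0 < x" for x s
    by (rule jump_mean_measurable[OF scaled_ramp_properties(1-5)[OF cd(2) that]])
  have E_nonneg: "0 \<le> E s" for s using B(2) C(1) by (simp add: E_def)
  have jm_E: "x powr \<alpha> * jump_mean (scaled_ramp c d x) s z \<le> E s" if "0 < x" "0 < s" for x s z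
  proof -
    have "C * response s powr \<alpha> \<le> C * (B * exp (- \<mu> * s))"
      using B(3)[of s] C(1) that by (intro mult_left_mono) auto
    then show ?thesis using C(2)[OF that, of z] by (simp add: E_def mult.assoc)
  qed
  have jm_norm: "norm (x powr \<alpha> * jump_mean (scaled_ramp c d x) s z) \<le> E s" if "0 < x" "0 < s" for x s z
    using jm_E[OF that, of z] jump_mean_nonneg[OF cd(2), of x s z] that by simp
  have D_E: "norm (x powr \<alpha> * D x s) \<le> E s" if "0 < x" "0 < s" for x s
  proof -
    have "norm (x powr \<alpha> * D x s) = norm (\<integral>z. x powr \<alpha> * jump_mean (scaled_ramp c d x) s z \<partial>g)"
      by (simp add: D_def)
    also have "\<dots> \<le> (\<integral>z. norm (x powr \<alpha> * jump_mean (scaled_ramp c d x) s z) \<partial>g)"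
      by (rule integral_norm_bound)
    also have "\<dots> \<le> (\<integral>z. E s \<partial>g)"
      using jm_norm[OF that] jm[OF that(1), of s] E_nonneg
      by (intro integral_mono g.integrable_const_bound[of _ "E s"]) auto
    finally show ?thesis by (simp add: g.prob_space)
  qed
  have D_lim: "((\<lambda>x. x powr \<alpha> * D x s) \<longlongrightarrow> R s) at_top" if s: "0 < s" for s
  proof -
    have "((\<lambda>x. \<integral>z. x powr \<alpha> * jump_mean (scaled_ramp c d x) s z \<partial>g) \<longlongrightarrow> (\<integral>z. R s \<partial>g)) at_top"
    proof (rule tendsto_at_topI_sequentially)
      fix X :: "nat \<Rightarrow> real" assume X: "filterlim X at_top sequentially"
      then have "\<forall>\<^sub>F n in sequentially. 1 \<le> X n" by (simp add: filterlim_at_top)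
      then obtain n0 where n0: "\<And>n. n0 \<le> n \<Longrightarrow> 1 \<le> X n" by (auto simp: eventually_sequentially)
      \<comment> \<open>The majorant holds for positive levels only, so the first \<open>n0\<close>
        terms of the sequence are dropped.\<close>
      define Y where "Y n = X (n + n0)" for n
      have Y: "filterlim Y at_top sequentially" "\<And>n. 0 < Y n"
        unfolding Y_def by (rule filterlim_compose[OF X filterlim_add_const_nat_at_top])
          (rule less_le_trans[OF zero_less_one n0], simp)
      have "(\<lambda>n. \<integral>z. Y n powr \<alpha> * jump_mean (scaled_ramp c d (Y n)) s z \<partial>g) \<longlonglongrightarrow> (\<integral>z. R s \<partial>g)"
      proof (rule integral_dominated_convergence[where w = "\<lambda>_. E s"])
        show "AE z in g. (\<lambda>n. Y n powr \<alpha> * jump_mean (scaled_ramp c d (Y n)) s z) \<longlonglongrightarrow> R s"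
          unfolding R_def by (intro AE_I2 filterlim_compose[OF jump_mean_limit[OF cd s] Y(1)])
        show "AE z in g. norm (Y n powr \<alpha> * jump_mean (scaled_ramp c d (Y n)) s z) \<le> E s" for n
          using jm_norm[OF Y(2) s] by (intro AE_I2)
      qed (use jm[OF Y(2)] in auto)
      then show "(\<lambda>n. \<integral>z. X n powr \<alpha> * jump_mean (scaled_ramp c d (X n)) s z \<partial>g) \<longlonglongrightarrow> (\<integral>z. R s \<partial>g)"
        unfolding Y_def by (rule LIMSEQ_offset)
    qed
    then show ?thesis by (simp add: D_def g.prob_space)
  qed
  have D_int: "(\<lambda>s. x powr \<alpha> * D x s) integrable_on {0<..}"
    and D_eq: "integral {0<..} (\<lambda>s. x powr \<alpha> * D x s) = x powr \<alpha> * mean_of (scaled_ramp c d x) 0 / lam"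
    if x: "0 < x" for x
  proof -
    \<comment> \<open>\<open>mean_of_integral\<close> covers bounded intervals. Cutting off at
      \<open>Suc n\<close> reaches the half-line in the limit, where the mean of the ramp at time
      \<open>Suc n\<close> tends to the ramp at 0, which is 0 because \<open>c > 0\<close>.\<close>
    define f where "f n s = (if s \<in> {0<..<real (Suc n)} then x powr \<alpha> * D x s else 0)" for n s
    have f: "(f n has_integral x powr \<alpha> * ((mean_of (scaled_ramp c d x) 0 - mean_of (scaled_ramp c d x) (real (Suc n))) / lam)) {0<..}" for n
    proof -
      have "(D x has_integral (mean_of (scaled_ramp c d x) 0 - mean_of (scaled_ramp c d x) (real (Suc n))) / lam) {0<..<real (Suc n)}"
        unfolding D_def by (rule mean_of_integral[OF scaled_ramp_properties(1-5)[OF cd(2) x]]) simp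
      from has_integral_mult_right[OF this, of "x powr \<alpha>"]
      show ?thesis unfolding f_def by (subst has_integral_restrict) auto
    qed
    have f_on: "f n integrable_on {0<..}" for n using f by (rule has_integral_integrable)
    have f_le: "norm (f n s) \<le> E s" if "s \<in> {0<..}" for n s
      using D_E[OF x, of s] that B(2) C(1) by (simp add: f_def E_def)
    have f_conv: "(\<lambda>n. f n s) \<longlonglongrightarrow> x powr \<alpha> * D x s" if "s \<in> {0<..}" for s
    proof (rule tendsto_eventually)
      obtain n0 :: nat where "s < real n0" using reals_Archimedean2 by blast
      then show "\<forall>\<^sub>F n in sequentially. f n s = x powr \<alpha> * D x s"
        using that by (intro eventually_mono[OF eventually_ge_at_top[of n0]]) (auto simp: f_def)
    qed
    note dc = dominated_convergence[OF f_on E_on f_le f_conv]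
    show "(\<lambda>s. x powr \<alpha> * D x s) integrable_on {0<..}" by (rule dc(1))
    have "(\<lambda>n. mean_of (scaled_ramp c d x) (real (Suc n))) \<longlonglongrightarrow> scaled_ramp c d x 0"
      by (intro filterlim_compose[OF mean_of_tendsto[OF scaled_ramp_properties(1-5)[OF cd(2) x]]]
          filterlim_compose[OF filterlim_real_sequentially] filterlim_Suc)
    moreover have "scaled_ramp c d x 0 = 0" using cd by (simp add: scaled_ramp_def ramp_eq_0)
    ultimately have "(\<lambda>n. x powr \<alpha> * ((mean_of (scaled_ramp c d x) 0 - mean_of (scaled_ramp c d x) (real (Suc n))) / lam))
        \<longlonglongrightarrow> x powr \<alpha> * ((mean_of (scaled_ramp c d x) 0 - 0) / lam)"
      by (intro tendsto_intros) (use lam_pos in auto)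
    moreover have "integral {0<..} (f n)
        = x powr \<alpha> * ((mean_of (scaled_ramp c d x) 0 - mean_of (scaled_ramp c d x) (real (Suc n))) / lam)" for n
      using f by (rule integral_unique)
    ultimately have "(\<lambda>n. integral {0<..} (f n)) \<longlonglongrightarrow> x powr \<alpha> * ((mean_of (scaled_ramp c d x) 0 - 0) / lam)"
      by simp
    with dc(2) have "integral {0<..} (\<lambda>s. x powr \<alpha> * D x s) = x powr \<alpha> * ((mean_of (scaled_ramp c d x) 0 - 0) / lam)"
      by (rule LIMSEQ_unique)
    then show "integral {0<..} (\<lambda>s. x powr \<alpha> * D x s) = x powr \<alpha> * mean_of (scaled_ramp c d x) 0 / lam" by simp
  qed
  have seq: "R integrable_on {0<..} \<and> (\<lambda>n. integral {0<..} (\<lambda>s. Y n powr \<alpha> * D (Y n) s)) \<longlonglongrightarrow> integral {0<..} R"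
    if Y: "filterlim Y at_top sequentially" "\<And>n. 0 < Y n" for Y :: "nat \<Rightarrow> real"
  proof -
    have le: "norm (Y n powr \<alpha> * D (Y n) s) \<le> E s" if "s \<in> {0<..}" for n s
      using D_E[OF Y(2)] that by simp
    have conv: "(\<lambda>n. Y n powr \<alpha> * D (Y n) s) \<longlonglongrightarrow> R s" if "s \<in> {0<..}" for s
      using filterlim_compose[OF D_lim Y(1)] that by simp
    show ?thesis using dominated_convergence[OF D_int[OF Y(2)] E_on le conv] by blast
  qed
  have R: "R s = (k powr \<alpha> * ramp_moment c d) * response s powr \<alpha>" if "s \<in> {0<..}" for s
    unfolding R_def by (subst powr_mult) (use k_pos response_nonneg[of s] that in auto)
  \<comment> \<open>Positivity of the moment allows division by it: dominated convergence yields
    integrability of \<open>R\<close>, which then passes to the power of the response.\<close>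
  have J: "0 < ramp_moment c d"
    using cd by (intro less_le_trans[OF _ ramp_moment_bounds(1)[OF cd]]) simp
  have "filterlim (\<lambda>n. real (Suc n)) at_top sequentially"
    by (rule filterlim_compose[OF filterlim_real_sequentially filterlim_Suc])
  from seq[OF this of_nat_0_less_iff[THEN iffD2, OF zero_less_Suc]]
  have "R integrable_on {0<..}" by (rule conjunct1)
  then have "(\<lambda>s. (k powr \<alpha> * ramp_moment c d) * response s powr \<alpha>) integrable_on {0<..}"
    using integrable_cong[of "{0<..}" R, OF R] by (simp only:)
  then show int: "(\<lambda>s. response s powr \<alpha>) integrable_on {0<..}"
    using J k_pos by (simp add: integrable_on_cmult_left_iff)
  have intR: "integral {0<..} R = k powr \<alpha> * ramp_moment c d * response_integral"
    using Henstock_Kurzweil_Integration.integral_cong[of "{0<..}" R, OF R] by (simp add: response_integral_def)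
  have "((\<lambda>x. integral {0<..} (\<lambda>s. x powr \<alpha> * D x s)) \<longlongrightarrow> integral {0<..} R) at_top"
  proof (rule tendsto_at_topI_sequentially)
    fix X :: "nat \<Rightarrow> real" assume X: "filterlim X at_top sequentially"
    then have "\<forall>\<^sub>F n in sequentially. 1 \<le> X n" by (simp add: filterlim_at_top)
    then obtain n0 where n0: "\<And>n. n0 \<le> n \<Longrightarrow> 1 \<le> X n" by (auto simp: eventually_sequentially)
    define Y where "Y n = X (n + n0)" for n
    have Y: "filterlim Y at_top sequentially" "\<And>n. 0 < Y n"
      unfolding Y_def by (rule filterlim_compose[OF X filterlim_add_const_nat_at_top])
        (rule less_le_trans[OF zero_less_one n0], simp)
    from seq[OF this] have "(\<lambda>n. integral {0<..} (\<lambda>s. Y n powr \<alpha> * D (Y n) s)) \<longlonglongrightarrow> integral {0<..} R"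
      by (rule conjunct2)
    then show "(\<lambda>n. integral {0<..} (\<lambda>s. X n powr \<alpha> * D (X n) s)) \<longlonglongrightarrow> integral {0<..} R"
      unfolding Y_def by (rule LIMSEQ_offset)
  qed
  then have "((\<lambda>x. lam * integral {0<..} (\<lambda>s. x powr \<alpha> * D x s))
      \<longlongrightarrow> lam * (k powr \<alpha> * ramp_moment c d * response_integral)) at_top"
    unfolding intR by (rule tendsto_mult_left)
  moreover have "\<forall>\<^sub>F x in at_top. lam * integral {0<..} (\<lambda>s. x powr \<alpha> * D x s) = x powr \<alpha> * mean_of (scaled_ramp c d x) 0"
    using eventually_gt_at_top[of "0::real"]
  proof eventually_elim
    case (elim x)
    show ?case unfolding D_eq[OF elim] using lam_pos by simp
  qed
  ultimately have "((\<lambda>x. x powr \<alpha> * mean_of (scaled_ramp c d x) 0)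
      \<longlongrightarrow> lam * (k powr \<alpha> * ramp_moment c d * response_integral)) at_top"
    by (rule Lim_transform_eventually)
  then show "((\<lambda>x. x powr \<alpha> * mean_of (scaled_ramp c d x) 0)
      \<longlongrightarrow> lam * k powr \<alpha> * ramp_moment c d * response_integral) at_top"
    by (simp only: mult.assoc)
qed

lemma response_integrable: "(\<lambda>s. response s powr \<alpha>) integrable_on {0<..}"
  by (rule mean_of_ramp_limit(1)[of 1 2]) auto

lemma response_integral_pos: "0 < response_integral"
proof -
  have pos: "0 < response s powr \<alpha>" if "s \<in> {1..2}" for s using response_pos[of s] that by simp
  have "\<forall>s\<in>{1..2}. response s \<noteq> 0"
  proof
    fix s :: real assume "s \<in> {1..2}"
    then show "response s \<noteq> 0" using response_pos[of s] by simp
  qed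
  then have cont: "continuous_on {1..2} (\<lambda>s. response s powr \<alpha>)"
    by (intro continuous_on_powr response_continuous continuous_on_const)
  have "\<exists>u\<in>{1..2}. \<forall>s\<in>{1..2}. response u powr \<alpha> \<le> response s powr \<alpha>"
    by (rule continuous_attains_inf[OF compact_Icc _ cont]) simp
  then obtain u where u: "u \<in> {1..2}" "\<forall>s\<in>{1..2}. response u powr \<alpha> \<le> response s powr \<alpha>" ..
  have on: "(\<lambda>s. response s powr \<alpha>) integrable_on {1..2}" by (rule integrable_continuous_real[OF cont])
  have "integral {1..2} (\<lambda>_::real. response u powr \<alpha>) \<le> integral {1..2} (\<lambda>s. response s powr \<alpha>)"
    by (rule integral_le[OF _ on]) (use u(2) in auto)
  moreover have "integral {1..2} (\<lambda>s. response s powr \<alpha>) \<le> response_integral"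
    unfolding response_integral_def by (rule integral_subset_le[OF _ on response_integrable]) auto
  moreover have "integral {1..2} (\<lambda>_::real. response u powr \<alpha>) = response u powr \<alpha>" by simp
  ultimately show ?thesis using pos[OF u(1)] by linarith
qed

text \<open>The indicator of exceeding \<open>x\<close> lies between the ramps from \<open>x\<close>
  to \<open>d * x\<close> and from \<open>c * x\<close> to \<open>x\<close>. Their moments are at
  least \<open>d powr (- \<alpha>)\<close> and at most \<open>c powr (- \<alpha>)\<close>, and both
  bounds tend to 1 as \<open>d\<close> and \<open>c\<close> tend to 1.\<close>

lemma tail_limit:
  "((\<lambda>x. x powr \<alpha> * measure g {z. x < z $ Inl r}) \<longlongrightarrow> lam * k powr \<alpha> * response_integral) at_top"
proof -
  define \<Lambda> where "\<Lambda> = lam * k powr \<alpha> * response_integral"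
  have \<Lambda>: "0 < \<Lambda>" using lam_pos k_pos response_integral_pos by (simp add: \<Lambda>_def)
  have root: "root_flow 0 z = z $ Inl r" for z by (simp add: root_flow_def)
  have rm [measurable]: "(\<lambda>z. z $ Inl r) \<in> borel_measurable g"
    using root_flow_measurable[of 0] by (simp add: root[abs_def])
  have set_eq: "{z. x < z $ Inl r} = {z \<in> space g. x < z $ Inl r}" for x
    using sets_eq_imp_space_eq[OF sets_g] by simp
  have meas: "measure g {z. x < z $ Inl r} = (\<integral>z. indicator {z \<in> space g. x < z $ Inl r} z \<partial>g)" for x
    unfolding set_eq by simp
  have ramp_int: "integrable g (\<lambda>z. scaled_ramp c d x (z $ Inl r))" for c d x
    by (rule g.integrable_const_bound[of _ 1]) (auto simp: scaled_ramp_def abs_of_nonneg ramp_nonneg ramp_le_1)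
  have ind_int: "integrable g (\<lambda>z. indicator {z \<in> space g. x < z $ Inl r} z :: real)" for x
    by (rule g.integrable_const_bound[of _ 1]) (auto simp: indicator_def)
  have lower: "mean_of (scaled_ramp 1 d x) 0 \<le> measure g {z. x < z $ Inl r}" if "1 < d" "0 < x" for d x
    unfolding meas mean_of_def root
  proof (intro integral_mono ramp_int ind_int)
    fix z assume "z \<in> space g"
    then show "scaled_ramp 1 d x (z $ Inl r) \<le> indicator {z \<in> space g. x < z $ Inl r} z"
      using that ramp_le_1[of 1 d "z $ Inl r / x"] ramp_eq_0[of 1 d "z $ Inl r / x"]
      by (cases "x < z $ Inl r") (simp_all add: scaled_ramp_def)
  qed
  have upper: "measure g {z. x < z $ Inl r} \<le> mean_of (scaled_ramp c 1 x) 0" if "c < 1" "0 < x" for c x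
    unfolding meas mean_of_def root
  proof (intro integral_mono ramp_int ind_int)
    fix z assume "z \<in> space g"
    then show "indicator {z \<in> space g. x < z $ Inl r} z \<le> scaled_ramp c 1 x (z $ Inl r)"
      using that ramp_nonneg[of c 1 "z $ Inl r / x"] ramp_eq_1[of c 1 "z $ Inl r / x"]
      by (cases "x < z $ Inl r") (simp_all add: scaled_ramp_def)
  qed
  have near: "((\<lambda>d. \<Lambda> * d powr (- \<alpha>)) \<longlongrightarrow> \<Lambda>) (at 1)"
    by (rule tendsto_eq_intros | simp)+
  have "((\<lambda>x. x powr \<alpha> * measure g {z. x < z $ Inl r}) \<longlongrightarrow> \<Lambda>) at_top"
  proof (rule order_tendstoI)
    fix l assume "l < \<Lambda>"
    from order_tendstoD(1)[OF near this] have "\<forall>\<^sub>F d in at_right 1. l < \<Lambda> * d powr (- \<alpha>)"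
      by (simp add: eventually_at_split)
    moreover have "\<forall>\<^sub>F d in at_right (1::real). 1 < d" by (simp add: eventually_at_right_less)
    ultimately have "\<forall>\<^sub>F d in at_right 1. 1 < d \<and> l < \<Lambda> * d powr (- \<alpha>)" by eventually_elim simp
    then obtain d where d: "1 < d" "l < \<Lambda> * d powr (- \<alpha>)"
      using eventually_happens[of _ "at_right (1::real)"] by auto
    have "\<Lambda> * d powr (- \<alpha>) \<le> \<Lambda> * ramp_moment 1 d"
      using ramp_moment_bounds(1)[of 1 d] d(1) \<Lambda> by (intro mult_left_mono) auto
    then have "l < lam * k powr \<alpha> * ramp_moment 1 d * response_integral"
      using d(2) by (simp add: \<Lambda>_def mult_ac)
    from order_tendstoD(1)[OF mean_of_ramp_limit(2)[OF zero_less_one d(1)] this] eventually_gt_at_top[of "0::real"]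
    show "\<forall>\<^sub>F x in at_top. l < x powr \<alpha> * measure g {z. x < z $ Inl r}"
    proof eventually_elim
      case (elim x)
      have "x powr \<alpha> * mean_of (scaled_ramp 1 d x) 0 \<le> x powr \<alpha> * measure g {z. x < z $ Inl r}"
        by (intro mult_left_mono lower d elim) simp
      then show ?case using elim by linarith
    qed
  next
    fix l assume "\<Lambda> < l"
    from order_tendstoD(2)[OF near this] have "\<forall>\<^sub>F d in at_left 1. \<Lambda> * d powr (- \<alpha>) < l"
      by (simp add: eventually_at_split)
    moreover have "\<forall>\<^sub>F d in at_left (1::real). d \<in> {0<..<1}" by (rule eventually_at_left_real) simp
    ultimately have "\<forall>\<^sub>F d in at_left 1. d \<in> {0<..<1} \<and> \<Lambda> * d powr (- \<alpha>) < l" by eventually_elim simp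
    then obtain c where c: "0 < c" "c < 1" "\<Lambda> * c powr (- \<alpha>) < l"
      using eventually_happens[of _ "at_left (1::real)"] by auto
    have "\<Lambda> * ramp_moment c 1 \<le> \<Lambda> * c powr (- \<alpha>)"
      using ramp_moment_bounds(2)[of c 1] c \<Lambda> by (intro mult_left_mono) auto
    then have "lam * k powr \<alpha> * ramp_moment c 1 * response_integral < l"
      using c(3) by (simp add: \<Lambda>_def mult_ac)
    from order_tendstoD(2)[OF mean_of_ramp_limit(2)[OF c(1,2)] this] eventually_gt_at_top[of "0::real"]
    show "\<forall>\<^sub>F x in at_top. x powr \<alpha> * measure g {z. x < z $ Inl r} < l"
    proof eventually_elim
      case (elim x)
      have "x powr \<alpha> * measure g {z. x < z $ Inl r} \<le> x powr \<alpha> * mean_of (scaled_ramp c 1 x) 0"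
        by (intro mult_left_mono upper c elim) simp
      then show ?case using elim by linarith
    qed
  qed
  then show ?thesis by (simp add: \<Lambda>_def)
qed

text \<open>The substitution \<open>s = - ln u / H $ r\<close> maps (0, 1] onto the half-line and
  reverses orientation; its derivative supplies the factor \<open>1 / u\<close> and the constant
  \<open>H $ r\<close>.\<close>

lemma tail_constant_eq:
  "tail_constant r trib K H a \<alpha> = H $ r / (K $ r * (\<Sum>e\<in>UNIV. a $ e)) powr \<alpha> * response_integral"
proof -
  define f where "f s = response s powr \<alpha>" for s
  define G where "G u = - ln u / H $ r" for u
  define G' where "G' u = - (1 / u) / H $ r" for u
  define S where "S = K $ r * (\<Sum>e\<in>UNIV. a $ e)"
  define c where "c = S powr \<alpha>"
  have Hr: "0 < H $ r" by (rule H_pos)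
  have pos: "0 < S" unfolding S_def using K_pos a_pos by (intro mult_pos_pos sum_pos) auto
  have image: "G ` {0<..1} = {0..}"
  proof (intro equalityI subsetI)
    fix s :: real assume "s \<in> {0..}"
    then have "s = G (exp (- (H $ r * s)))" "exp (- (H $ r * s)) \<in> {0<..1}" using Hr by (auto simp: G_def)
    then show "s \<in> G ` {0<..1}" by blast
  qed (use Hr in \<open>auto simp: G_def divide_nonpos_pos\<close>)
  have der: "(G has_field_derivative G' u) (at u within {0<..1})" if "u \<in> {0<..1}" for u
    unfolding G_def G'_def using that Hr by (auto intro!: derivative_eq_intros)
  have inj: "inj_on G {0<..1}" using Hr by (auto simp: inj_on_def G_def)
  have "(f has_integral response_integral) {0<..}"
    using response_integrable integrable_integral by (simp add: f_def[abs_def] response_integral_def)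
  \<comment> \<open>The image contains 0, attained at \<open>u = 1\<close>. There \<open>f\<close>
    is 0, because \<open>response 0 = 0\<close> and \<open>0 powr \<alpha> = 0\<close>.\<close>
  then have "((\<lambda>s. if s \<in> {0<..} then f s else 0) has_integral response_integral) {0..}"
    by (subst has_integral_restrict) auto
  then have f_int: "(f has_integral response_integral) {0..}"
    by (rule has_integral_eq[rotated]) (auto simp: f_def)
  then have "f absolutely_integrable_on {0..}"
    by (intro nonnegative_absolutely_integrable_1 has_integral_integrable) (auto simp: f_def)
  with f_int have "f absolutely_integrable_on G ` {0<..1} \<and> integral (G ` {0<..1}) f = response_integral"
    unfolding image by (simp add: integral_unique)
  then have h: "(\<lambda>u. \<bar>G' u\<bar> * f (G u)) absolutely_integrable_on {0<..1}"
      "integral {0<..1} (\<lambda>u. \<bar>G' u\<bar> * f (G u)) = response_integral"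
    using has_absolute_integral_change_of_variables_1'[of "{0<..1}" G G' f response_integral] der inj by auto
  have [measurable]: "f \<in> borel_measurable borel" unfolding f_def by measurable
  \<comment> \<open>Absolute integrability refers to the completed measure; Borel measurability
    carries it over to \<open>lborel\<close>, on which the tail constant is defined.\<close>
  have "set_integrable lborel {0<..1} (\<lambda>u. \<bar>G' u\<bar> * f (G u))"
  proof -
    have "(\<lambda>u. indicator {0<..1} u *\<^sub>R (\<bar>G' u\<bar> * f (G u))) \<in> borel_measurable lborel"
      unfolding G_def G'_def by measurable
    then show ?thesis
      using h(1) unfolding set_integrable_def by (simp only: integrable_completion)
  qed
  from set_borel_integral_eq_integral(2)[OF this]
  have h_lborel: "(LBINT u:{0<..1}. \<bar>G' u\<bar> * f (G u)) = response_integral"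
    unfolding h(2) .
  have "tail_constant r trib K H a \<alpha> = (LBINT u:{0<..1}. H $ r / c * (\<bar>G' u\<bar> * f (G u)))"
    unfolding tail_constant_def
  proof (rule set_lebesgue_integral_cong)
    show "\<forall>u. u \<in> {0<..1} \<longrightarrow> 1 / u * (\<Sum>e\<in>UNIV. H $ e / K $ r * (a $ e / (\<Sum>e'\<in>UNIV. a $ e'))
        * root_response r trib K H u $ e) powr \<alpha> = H $ r / c * (\<bar>G' u\<bar> * f (G u))"
    proof (intro allI impI)
      fix u :: real assume u: "u \<in> {0<..1}"
      then have "0 \<le> response (- ln u / H $ r)" using Hr by (intro response_nonneg divide_nonneg_pos) auto
      then have "(response (- ln u / H $ r) / S) powr \<alpha> = f (G u) / c"
        using pos by (simp add: powr_divide f_def G_def c_def)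
      moreover have "1 / u = H $ r * \<bar>G' u\<bar>" using u Hr by (simp add: G'_def)
      ultimately show "1 / u * (\<Sum>e\<in>UNIV. H $ e / K $ r * (a $ e / (\<Sum>e'\<in>UNIV. a $ e'))
          * root_response r trib K H u $ e) powr \<alpha> = H $ r / c * (\<bar>G' u\<bar> * f (G u))"
        using root_response_eq[of u] u by (simp add: S_def[symmetric])
    qed
  qed simp
  also have "\<dots> = H $ r / c * response_integral"
    by (simp only: set_integral_mult_right h_lborel)
  finally show ?thesis by (simp add: c_def S_def)
qed

lemma tail_asymptotics:
  "(\<lambda>x. measure g {z. x < z $ Inl r}) \<sim>[at_top]
    (\<lambda>x. lam * (k * (\<Sum>e\<in>UNIV. a $ e) * K $ r) powr \<alpha> / H $ r * tail_constant r trib K H a \<alpha> * x powr (- \<alpha>))"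
proof -
  define c where "c = lam * k powr \<alpha> * response_integral"
  have c: "0 < c" using lam_pos k_pos response_integral_pos by (simp add: c_def)
  define S where "S = K $ r * (\<Sum>e\<in>UNIV. a $ e)"
  have pos: "0 < S" unfolding S_def using K_pos a_pos by (intro mult_pos_pos sum_pos) auto
  have kS: "k * (\<Sum>e\<in>UNIV. a $ e) * K $ r = k * S" by (simp add: S_def)
  have "(k * (\<Sum>e\<in>UNIV. a $ e) * K $ r) powr \<alpha> = k powr \<alpha> * S powr \<alpha>"
    unfolding kS using k_pos pos by (simp add: powr_mult)
  then have const: "lam * (k * (\<Sum>e\<in>UNIV. a $ e) * K $ r) powr \<alpha> / H $ r * tail_constant r trib K H a \<alpha> = c"
    using pos H_pos[of r] by (simp add: tail_constant_eq c_def S_def[symmetric])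
  have "((\<lambda>x. x powr \<alpha> * measure g {z. x < z $ Inl r} / c) \<longlongrightarrow> c / c) at_top"
    using tail_limit c unfolding c_def[symmetric] by (intro tendsto_divide tendsto_const) auto
  moreover have "\<forall>\<^sub>F x in at_top. x powr \<alpha> * measure g {z. x < z $ Inl r} / c
      = measure g {z. x < z $ Inl r} / (c * x powr (- \<alpha>))"
    using eventually_gt_at_top[of "0::real"]
    by eventually_elim (simp add: powr_minus field_simps)
  ultimately have "((\<lambda>x. measure g {z. x < z $ Inl r} / (c * x powr (- \<alpha>))) \<longlongrightarrow> 1) at_top"
    using c by (simp add: Lim_transform_eventually)
  then show ?thesis unfolding const by (rule asymp_equivI')
qed

end

theorem proposition5p2:
  fixes r :: "'e::finite" and trib :: "'e \<Rightarrow> 'e set"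
    and K H a :: "real ^ 'e"
    and lam k \<alpha> :: real
    and M :: "'w measure"
    and N :: "real \<Rightarrow> 'w \<Rightarrow> nat" and T P :: "nat \<Rightarrow> 'w \<Rightarrow> real"
    and g :: "(real ^ ('e + 'e)) measure"
  assumes "river_network r trib"
    and "\<And>e. 0 < K $ e" and "\<And>e. 0 < H $ e" and "\<And>e. 0 < a $ e"
    and "0 < lam" and "0 < k" and "0 < \<alpha>" and "\<alpha> < 1"
    and "prob_space M"
    and "prob_space.poisson_process M lam N T"
    and "prob_space.iid_from_1 M P"
    and "prob_space.indep_of_process M P N"
    and "\<And>n. 1 \<le> n \<Longrightarrow> AE \<omega> in M. 0 < P n \<omega>"
    and "\<And>x. k \<le> x \<Longrightarrow> measure M {\<omega> \<in> space M. x < P 1 \<omega>} = (k / x) powr \<alpha>"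
    and "invariant_distribution M (state_process trib K H a N T P) g"
  shows "(\<lambda>x. measure g {z. x < z $ Inl r})
           \<sim>[at_top]
         (\<lambda>x. lam * (k * (\<Sum>e\<in>UNIV. a $ e) * K $ r) powr \<alpha> / H $ r
                * tail_constant r trib K H a \<alpha> * x powr (- \<alpha>))"
proof -
  interpret prob_space M by fact
  have P_meas: "random_variable borel (P n)" if "1 \<le> n" for n
  proof -
    have "indep_vars (\<lambda>_. borel) P {1..}" using assms(11) unfolding iid_from_1_def by (rule conjunct1)
    then have "\<forall>n\<in>{1..}. random_variable borel (P n)" unfolding indep_vars_def by (rule conjunct1)
    then show ?thesis using that by simp
  qed
  have P_law: "distr M borel (P n) = distr M borel (P 1)" if "1 \<le> n" for n
    using assms(11) that unfolding iid_from_1_def by (elim conjE allE impE)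
  \<comment> \<open>The tail formula at \<open>x = k\<close> gives probability 1 for the first mark,
    and all marks have the same law.\<close>
  have P_ge: "AE \<omega> in M. k \<le> P n \<omega>" if n: "1 \<le> n" for n
  proof -
    have tail: "prob {\<omega> \<in> space M. k < P m \<omega>} = measure (distr M borel (P m)) {k<..}" if "1 \<le> m" for m
    proof -
      have "P m -` {k<..} \<inter> space M = {\<omega> \<in> space M. k < P m \<omega>}" by auto
      then show ?thesis using measure_distr[OF P_meas[OF that], of "{k<..}"] by simp
    qed
    have "prob {\<omega> \<in> space M. k < P n \<omega>} = prob {\<omega> \<in> space M. k < P 1 \<omega>}"
      unfolding tail[OF n] tail[OF order_refl] P_law[OF n] ..
    also have "\<dots> = 1" using assms(14)[of k] \<open>0 < k\<close> by simp
    finally have "AE \<omega> in M. \<omega> \<in> {\<omega> \<in> space M. k < P n \<omega>}" by (rule AE_prob_1)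
    then show ?thesis by eventually_elim simp
  qed
  have indep: "indep_var borel (P 1) borel (\<lambda>\<omega>. real (N 1 \<omega>))"
  proof -
    have "indep_var borel ((\<lambda>f. f (1::nat)) \<circ> (\<lambda>\<omega>. \<lambda>n\<in>{1..}. P n \<omega>))
        borel ((\<lambda>f. f (1::nat)) \<circ> (\<lambda>\<omega> n. real ((\<lambda>t\<in>{0..}. N t \<omega>) (real n))))"
    proof (rule indep_var_compose)
      \<comment> \<open>Both index sets consist of natural numbers, so coordinate 1 of the second
        family is the count at time 1.\<close>
      show "indep_var (\<Pi>\<^sub>M n\<in>{1..}. borel) (\<lambda>\<omega>. \<lambda>n\<in>{1..}. P n \<omega>)
          (\<Pi>\<^sub>M n\<in>{0..}. count_space UNIV) (\<lambda>\<omega> n. real ((\<lambda>t\<in>{0..}. N t \<omega>) (real n)))"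
        using assms(12) unfolding indep_of_process_def .
      show "(\<lambda>f. f (1::nat)) \<in> (\<Pi>\<^sub>M n\<in>{1..}. borel) \<rightarrow>\<^sub>M borel"
        by (rule measurable_component_singleton) simp
      have "(\<lambda>f. f (1::nat)) \<in> (\<Pi>\<^sub>M n\<in>{0..}. count_space UNIV) \<rightarrow>\<^sub>M count_space (UNIV :: real set)"
        by (rule measurable_component_singleton) simp
      then show "(\<lambda>f. f (1::nat)) \<in> (\<Pi>\<^sub>M n\<in>{0..}. count_space (UNIV :: real set)) \<rightarrow>\<^sub>M borel"
        by (rule measurable_compose) simp
    qed
    then show ?thesis by (simp add: comp_def)
  qed
  have "linear_network r trib K H a"
    by (rule linear_network.intro[OF assms(1) linear_network_axioms.intro[OF assms(2-4)]])
  moreover have "marked_poisson M lam k N T P"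
    by (rule marked_poisson.intro[OF assms(9) marked_poisson_axioms.intro[OF assms(5,6,10) P_meas P_ge]])
  ultimately have "stationary_network r trib K H a M lam k N T P g"
    by (rule stationary_network.intro[OF _ _ stationary_network_axioms.intro[OF assms(15) indep]])
  moreover have "pareto_network_axioms M k P \<alpha>"
    unfolding pareto_network_axioms_def by (intro conjI allI impI assms(7,8,14))
  ultimately interpret pareto_network r trib K H a M lam k N T P g \<alpha>
    by (rule pareto_network.intro)
  show ?thesis by (rule tail_asymptotics)
qed

end
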